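(* Let $X,Y,A,B$ be inductive families of finite sets, fix $n\in\mathbb N$, and let $\mathcal G_n=(X_n,Y_n,A_n,B_n,\lambda_n)$ be a non-local game; write $\kappa_n=\kappa_{\mathcal G_n}$. Let ${\rm t}\in\{{\rm loc},{\rm qs},{\rm qc},{\rm ns}\}$. If $\Gamma_n\in\mathcal C_{\rm t}(X_n,Y_n,A_n,B_n)$ and $$\tilde\Gamma_n=(\iota_{X,\infty}^{(n)}\otimes\iota_{Y,\infty}^{(n)})\circ\Gamma_n\circ(\mathcal E_{A_n}^\infty\otimes\mathcal E_{B_n}^\infty)|_{C(\Omega_A)\otimes C(\Omega_B)},$$ then $$(\mu_{X_nY_n}\otimes p_{\Gamma_n})(\operatorname{supp}\lambda_n)=(\mu_{XY}\otimes p_{\tilde\Gamma_n})(\kappa_n);$$ consequently, $\omega_{\rm t}(\mathcal G_n,\mu_{X_nY_n})=\omega_{\rm t}(\kappa_n,\mu_{XY})$ for ${\rm t}\in\{{\rm loc},{\rm qs},{\rm qc},{\rm ns}\}$.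
   Context: For $d\in\mathbb N$, $[d]=\{1,\dots,d\}$. An inductive family of finite sets is a sequence $X=(X_n)_{n\in\mathbb N}$ of non-empty finite sets with $X_{n+1}=X_n\times[d_n^X]$ for some $d_n^X\in\mathbb N$. Set $d_0^X=|X_1|$ and identify $X_1$ with $[d_0^X]$, so $X_n=\prod_{i=0}^{n-1}[d_i^X]$. Put $\Omega_X=\prod_{i=0}^\infty[d_i^X]$ (product topology), and let $\mu_X$ be the product of the uniform probability measures; $L^1(\Omega_X),L^\infty(\Omega_X)$ are with respect to $\mu_X$. Write $\mu_{XY}=\mu_X\times\mu_Y$, and $\mu_{X_nY_n}$ for the uniform probability measure on $X_n\times Y_n$. The pairing is $\langle g,f\rangle=\int gf\,d\mu_{XY}$. For $x\in X_n$, $\tilde x\subseteq\Omega_X$ is the cylinder of points whose first $n$ coordinates form $x$. $\mathcal D_S$ is the algebra of diagonal $|S|\times|S|$ matrices with canonical basis $(\delta_s)_{s\in S}$; $\iota_{X,\infty}^{(n)}:\mathcal D_{X_n}\to L^\infty(\Omega_X)$ is $\delta_x\mapsto\chi_{\tilde x}$, and $\mathcal E_{A_n}^\infty:L^\infty(\Omega_A)\to\mathcal D_{A_n}$ is $f\mapsto\sum_{a\in A_n}|A_n|\left(\int_{\tilde a}f\,d\mu_A\right)\delta_a$. $L_g$ denotes the slice map $L^\infty(\Omega_X)\bar\otimes\mathcal B(H)\to\mathcal B(H)$, $L_g(f\otimes T)=(\int fg\,d\mu_X)T$. Cantor correlations. Let $\Gamma:C(\Omega_A)\otimes C(\Omega_B)\to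 L^\infty(\Omega_X)\bar\otimes L^\infty(\Omega_Y)$ be unital completely positive (u.c.p.). $\Gamma\in\mathcal C_{\rm ns}$ if $\Gamma(C(\Omega_A)\otimes1)\subseteq L^\infty(\Omega_X)\otimes1$ and $\Gamma(1\otimes C(\Omega_B))\subseteq1\otimes L^\infty(\Omega_Y)$. $\Gamma\in\mathcal C_{\rm loc}$ if it is a finite convex combination of maps $\Phi\otimes\Psi$ with $\Phi:C(\Omega_A)\to L^\infty(\Omega_X)$, $\Psi:C(\Omega_B)\to L^\infty(\Omega_Y)$ u.c.p. $\Gamma\in\mathcal C_{\rm qs}$ if there are separable Hilbert spaces $H,K$, a unit vector $\xi\in H\otimes K$ and u.c.p. $\Phi:C(\Omega_A)\to L^\infty(\Omega_X)\bar\otimes\mathcal B(H)$, $\Psi:C(\Omega_B)\to L^\infty(\Omega_Y)\bar\otimes\mathcal B(K)$ with $\langle g_1\otimes g_2,\Gamma(f_1\otimes f_2)\rangle=\langle(L_{g_1}(\Phi(f_1))\otimes L_{g_2}(\Psi(f_2)))\xi,\xi\rangle$ for all $f_1\in C(\Omega_A),f_2\in C(\Omega_B),g_1\in L^1(\Omega_X),g_2\in L^1(\Omega_Y)$. $\Gamma\in\mathcal C_{\rm qc}$ if there are a separable $H$, a unit vector $\xi\in H$ and u.c.p. $\Phi:C(\Omega_A)\to L^\infty(\Omega_X)\bar\otimes\mathcal B(H)$, $\Psi:C(\Omega_B)\to L^\infty(\Omega_Y)\bar\otimes\mathcal B(H)$ such that $\Phi(f)_{1,3}$ and $\Psi(g)_{2,3}$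 (leg notation in $L^\infty(\Omega_X)\bar\otimes L^\infty(\Omega_Y)\bar\otimes\mathcal B(H)$) commute for all $f,g$, and $\langle g_1\otimes g_2,\Gamma(f_1\otimes f_2)\rangle=\langle L_{g_1}(\Phi(f_1))L_{g_2}(\Psi(f_2))\xi,\xi\rangle$ for all $f_i,g_i$. Finite correlations over finite $(S,T,U,V)$: families $p=(p(u,v|s,t))$ of conditional probability distributions, identified with maps $\Lambda:\mathcal D_U\otimes\mathcal D_V\to\mathcal D_S\otimes\mathcal D_T$, $\Lambda(\delta_u\otimes\delta_v)=\sum_{s,t}p(u,v|s,t)\delta_s\otimes\delta_t$, and then $p=p_\Lambda$. ns: the marginals $\sum_vp(u,v|s,t)$ and $\sum_up(u,v|s,t)$ do not depend on $t$, resp. $s$; loc: finite convex combinations of products $p_1(u|s)p_2(v|t)$; qs: $p(u,v|s,t)=\langle(P_{s,u}\otimes Q_{t,v})\xi,\xi\rangle$ with $\xi\in H\otimes K$ a unit vector and $(P_{s,u})_u$ on $H$, $(Q_{t,v})_v$ on $K$ POVM's; qc: $p(u,v|s,t)=\langle P_{s,u}Q_{t,v}\xi,\xi\rangle$ with POVM's $(P_{s,u})_u$, $(Q_{t,v})_v$ on one Hilbert space such that $P_{s,u}Q_{t,v}=Q_{t,v}P_{s,u}$. Games and values. A non-local game $\mathcal G_n$ has a rule function $\lambda_n:X_n\times Y_n\times A_n\times B_n\to\{0,1\}$. $\kappa_{\mathcal G_n}\subseteq\Omega_X\times\Omega_Y\times\Omega_A\times\Omega_B$ is the set of quadruples of sequences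 whose truncations to the first $n$ coordinates lie in $\operatorname{supp}\lambda_n$. In the finite case $(\mu_{X_nY_n}\otimes p)(G)=\frac1{|X_n||Y_n|}\sum_{(x,y,a,b)\in G}p(a,b|x,y)$ and $\omega_{\rm t}(\mathcal G_n,\mu_{X_nY_n})=\sup_{p\in\mathcal C_{\rm t}(X_n,Y_n,A_n,B_n)}(\mu_{X_nY_n}\otimes p)(\operatorname{supp}\lambda_n)$. For closed $\kappa\subseteq\Omega_X\times\Omega_Y\times\Omega_A\times\Omega_B$, $\omega_{\rm t}(\kappa,\mu_{XY})=\sup_{\Gamma\in\mathcal C_{\rm t}(X,Y,A,B)}(\mu_{XY}\otimes p_\Gamma)(\kappa)$, where $p_\Gamma=(p_\Gamma(\cdot|x,y))_{(x,y)}$ is the ($\mu_{XY}$-a.e. unique) measurable family of Borel probability measures on $\Omega_A\times\Omega_B$ with $\Gamma(f)(x,y)=\int f\,dp_\Gamma(\cdot|x,y)$ a.e. for each $f\in C(\Omega_A\times\Omega_B)$, and $(\mu_{XY}\otimes p_\Gamma)(M)=\int p_\Gamma(M_{x,y}|x,y)\,d\mu_{XY}(x,y)$ with $M_{x,y}=\{(a,b):(x,y,a,b)\in M\}$. *)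

theory Defs
  imports "HOL-Probability.Probability"
begin

section \<open>Hilbert spaces and operators\<close>

text \<open>
  Up to unitary equivalence every complex Hilbert space is \<open>\<ell>\<^sup>2(J)\<close>, where \<open>J\<close> indexes an
  orthonormal basis, and it is separable iff \<open>J\<close> can be taken to be a set of natural numbers.
  Vectors are functions on the whole index type which vanish off \<open>J\<close>.  The inner product is
  linear in the first argument.
\<close>

definition ell2 :: "'i set \<Rightarrow> ('i \<Rightarrow> complex) set" where
  "ell2 J = {v. (\<forall>i. i \<notin> J \<longrightarrow> v i = 0) \<and> (\<lambda>i. (cmod (v i))\<^sup>2) summable_on UNIV}"

definition ip :: "('i \<Rightarrow> complex) \<Rightarrow> ('i \<Rightarrow> complex) \<Rightarrow> complex" where
  "ip v w = (\<Sum>\<^sub>\<infinity>i. v i * cnj (w i))"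

definition l2norm :: "('i \<Rightarrow> complex) \<Rightarrow> real" where
  "l2norm v = sqrt (\<Sum>\<^sub>\<infinity>i. (cmod (v i))\<^sup>2)"

text \<open>Only the values of an operator on \<open>ell2 J\<close> matter.\<close>

definition bounded_op :: "'i set \<Rightarrow> (('i \<Rightarrow> complex) \<Rightarrow> ('i \<Rightarrow> complex)) \<Rightarrow> bool" where
  "bounded_op J T \<longleftrightarrow>
     (\<forall>v\<in>ell2 J. T v \<in> ell2 J) \<and>
     (\<forall>v\<in>ell2 J. \<forall>w\<in>ell2 J. T (\<lambda>i. v i + w i) = (\<lambda>i. T v i + T w i)) \<and>
     (\<forall>c. \<forall>v\<in>ell2 J. T (\<lambda>i. c * v i) = (\<lambda>i. c * T v i)) \<and>
     (\<exists>C. \<forall>v\<in>ell2 J. l2norm (T v) \<le> C * l2norm v)"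

text \<open>
  Tensor product of linear maps between spaces of functions: \<open>\<Phi>\<close> acts in the first and \<open>\<Psi>\<close> in
  the second variable, so that by linearity a product function \<open>f(a) g(b)\<close> is sent to
  \<open>\<Phi>(f)(x) \<Psi>(g)(y)\<close>.  With \<open>\<ell>\<^sup>2(J) \<otimes> \<ell>\<^sup>2(K) = \<ell>\<^sup>2(J \<times> K)\<close> this is also the tensor product of
  bounded operators.
\<close>

definition tensor_map ::
  "(('a \<Rightarrow> complex) \<Rightarrow> 'x \<Rightarrow> complex) \<Rightarrow> (('b \<Rightarrow> complex) \<Rightarrow> 'y \<Rightarrow> complex) \<Rightarrow>
   ('a \<times> 'b \<Rightarrow> complex) \<Rightarrow> 'x \<times> 'y \<Rightarrow> complex" where
  "tensor_map \<Phi> \<Psi> f = (\<lambda>(x, y). \<Phi> (\<lambda>a. \<Psi> (\<lambda>b. f (a, b)) y) x)"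

definition povm :: "'i set \<Rightarrow> 'u set \<Rightarrow> ('u \<Rightarrow> ('i \<Rightarrow> complex) \<Rightarrow> ('i \<Rightarrow> complex)) \<Rightarrow> bool" where
  "povm J U P \<longleftrightarrow>
     (\<forall>u\<in>U. bounded_op J (P u) \<and> (\<forall>v\<in>ell2 J. ip (P u v) v \<in> \<real>\<^sub>\<ge>\<^sub>0)) \<and>
     (\<forall>v\<in>ell2 J. (\<lambda>i. \<Sum>u\<in>U. P u v i) = v)"

section \<open>Finite correlations\<close>

text \<open>\<open>p s t u v\<close> stands for \<open>p(u,v|s,t)\<close>.\<close>

datatype corr_type = Loc | QS | QC | NS

definition cond_dist :: "'s set \<Rightarrow> 'u set \<Rightarrow> ('s \<Rightarrow> 'u \<Rightarrow> real) \<Rightarrow> bool" where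
  "cond_dist S U q \<longleftrightarrow> (\<forall>s\<in>S. (\<forall>u\<in>U. 0 \<le> q s u) \<and> (\<Sum>u\<in>U. q s u) = 1)"

definition fin_corr ::
  "'s set \<Rightarrow> 't set \<Rightarrow> 'u set \<Rightarrow> 'v set \<Rightarrow> ('s \<Rightarrow> 't \<Rightarrow> 'u \<Rightarrow> 'v \<Rightarrow> real) \<Rightarrow> bool" where
  "fin_corr S T U V p \<longleftrightarrow> cond_dist (S \<times> T) (U \<times> V) (\<lambda>(s, t) (u, v). p s t u v)"

definition fin_ns ::
  "'s set \<Rightarrow> 't set \<Rightarrow> 'u set \<Rightarrow> 'v set \<Rightarrow> ('s \<Rightarrow> 't \<Rightarrow> 'u \<Rightarrow> 'v \<Rightarrow> real) \<Rightarrow> bool" where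
  "fin_ns S T U V p \<longleftrightarrow>
     (\<forall>s\<in>S. \<forall>t\<in>T. \<forall>t'\<in>T. \<forall>u\<in>U. (\<Sum>v\<in>V. p s t u v) = (\<Sum>v\<in>V. p s t' u v)) \<and>
     (\<forall>s\<in>S. \<forall>s'\<in>S. \<forall>t\<in>T. \<forall>v\<in>V. (\<Sum>u\<in>U. p s t u v) = (\<Sum>u\<in>U. p s' t u v))"

definition fin_loc ::
  "'s set \<Rightarrow> 't set \<Rightarrow> 'u set \<Rightarrow> 'v set \<Rightarrow> ('s \<Rightarrow> 't \<Rightarrow> 'u \<Rightarrow> 'v \<Rightarrow> real) \<Rightarrow> bool" where
  "fin_loc S T U V p \<longleftrightarrow>
     (\<exists>(m::nat) c p1 p2.
        (\<forall>k<m. 0 \<le> c k \<and> cond_dist S U (p1 k) \<and> cond_dist T V (p2 k)) \<and>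
        (\<Sum>k<m. c k) = 1 \<and>
        (\<forall>s\<in>S. \<forall>t\<in>T. \<forall>u\<in>U. \<forall>v\<in>V. p s t u v = (\<Sum>k<m. c k * p1 k s u * p2 k t v)))"

text \<open>
  HOL cannot quantify over Hilbert spaces of unbounded dimension, so the quantum classes are
  parametrised by an index type \<open>'i\<close>: the Hilbert spaces are the \<open>\<ell>\<^sup>2(J)\<close> with \<open>J :: 'i set\<close>.
  A theorem for an arbitrary infinite \<open>'i\<close> covers Hilbert spaces of every dimension.
\<close>

definition fin_qs :: "'i itself \<Rightarrow>
  's set \<Rightarrow> 't set \<Rightarrow> 'u set \<Rightarrow> 'v set \<Rightarrow> ('s \<Rightarrow> 't \<Rightarrow> 'u \<Rightarrow> 'v \<Rightarrow> real) \<Rightarrow> bool" where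
  "fin_qs _ S T U V p \<longleftrightarrow>
     (\<exists>(J :: 'i set) (K :: 'i set) \<xi> P Q.
        \<xi> \<in> ell2 (J \<times> K) \<and> l2norm \<xi> = 1 \<and>
        (\<forall>s\<in>S. povm J U (P s)) \<and> (\<forall>t\<in>T. povm K V (Q t)) \<and>
        (\<forall>s\<in>S. \<forall>t\<in>T. \<forall>u\<in>U. \<forall>v\<in>V.
           complex_of_real (p s t u v) = ip (tensor_map (P s u) (Q t v) \<xi>) \<xi>))"

definition fin_qc :: "'i itself \<Rightarrow>
  's set \<Rightarrow> 't set \<Rightarrow> 'u set \<Rightarrow> 'v set \<Rightarrow> ('s \<Rightarrow> 't \<Rightarrow> 'u \<Rightarrow> 'v \<Rightarrow> real) \<Rightarrow> bool" where
  "fin_qc _ S T U V p \<longleftrightarrow>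
     (\<exists>(J :: 'i set) \<xi> P Q.
        \<xi> \<in> ell2 J \<and> l2norm \<xi> = 1 \<and>
        (\<forall>s\<in>S. povm J U (P s)) \<and> (\<forall>t\<in>T. povm J V (Q t)) \<and>
        (\<forall>s\<in>S. \<forall>t\<in>T. \<forall>u\<in>U. \<forall>v\<in>V.
           (\<forall>w\<in>ell2 J. P s u (Q t v w) = Q t v (P s u w)) \<and>
           complex_of_real (p s t u v) = ip (P s u (Q t v \<xi>)) \<xi>))"

definition fin_class :: "'i itself \<Rightarrow> corr_type \<Rightarrow>
  's set \<Rightarrow> 't set \<Rightarrow> 'u set \<Rightarrow> 'v set \<Rightarrow> ('s \<Rightarrow> 't \<Rightarrow> 'u \<Rightarrow> 'v \<Rightarrow> real) set" where
  "fin_class I t S T U V = {p. fin_corr S T U V p \<and>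
     (case t of
        Loc \<Rightarrow> fin_loc S T U V p
      | QS \<Rightarrow> fin_qs I S T U V p
      | QC \<Rightarrow> fin_qc I S T U V p
      | NS \<Rightarrow> fin_ns S T U V p)}"

text \<open>
  The map \<open>\<D>\<^sub>U \<otimes> \<D>\<^sub>V \<rightarrow> \<D>\<^sub>S \<otimes> \<D>\<^sub>T\<close> identified with \<open>p\<close>; a diagonal matrix is the function of its
  diagonal entries.
\<close>

definition fin_map :: "'u set \<Rightarrow> 'v set \<Rightarrow> ('s \<Rightarrow> 't \<Rightarrow> 'u \<Rightarrow> 'v \<Rightarrow> real) \<Rightarrow>
  ('u \<times> 'v \<Rightarrow> complex) \<Rightarrow> 's \<times> 't \<Rightarrow> complex" where
  "fin_map U V p h = (\<lambda>(s, t). \<Sum>(u, v)\<in>U \<times> V. complex_of_real (p s t u v) * h (u, v))"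

text \<open>\<open>(\<mu> \<otimes> p)(G)\<close> for the uniform measure \<open>\<mu>\<close> on \<open>S \<times> T\<close>.\<close>

definition fin_value :: "'s set \<Rightarrow> 't set \<Rightarrow> ('s \<Rightarrow> 't \<Rightarrow> 'u \<Rightarrow> 'v \<Rightarrow> real) \<Rightarrow>
  ('s \<times> 't \<times> 'u \<times> 'v) set \<Rightarrow> real" where
  "fin_value S T p G =
     1 / (real (card S) * real (card T)) * (\<Sum>(s, t, u, v)\<in>G. p s t u v)"

section \<open>Inductive families and their limits\<close>

text \<open>
  An inductive family is given by the sequence \<open>d\<close> of its branching numbers, with \<open>X\<^sub>1 = [d 0]\<close>
  and \<open>X\<^sub>n\<close> the product of the \<open>[d i]\<close>, \<open>i < n\<close>.
\<close>

definition inductive_family :: "(nat \<Rightarrow> nat) \<Rightarrow> bool" where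
  "inductive_family d \<longleftrightarrow> (\<forall>i. 1 \<le> d i)"

definition level :: "(nat \<Rightarrow> nat) \<Rightarrow> nat \<Rightarrow> (nat \<Rightarrow> nat) set" where
  "level d n = (\<Pi>\<^sub>E i\<in>{..<n}. {1..d i})"

definition Omega :: "(nat \<Rightarrow> nat) \<Rightarrow> (nat \<Rightarrow> nat) set" where
  "Omega d = {\<omega>. \<forall>i. \<omega> i \<in> {1..d i}}"

definition mu :: "(nat \<Rightarrow> nat) \<Rightarrow> (nat \<Rightarrow> nat) measure" where
  "mu d = (\<Pi>\<^sub>M i\<in>UNIV. uniform_count_measure {1..d i})"

definition trunc :: "nat \<Rightarrow> (nat \<Rightarrow> nat) \<Rightarrow> nat \<Rightarrow> nat" where
  "trunc n \<omega> = restrict \<omega> {..<n}"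

definition cyl :: "(nat \<Rightarrow> nat) \<Rightarrow> nat \<Rightarrow> (nat \<Rightarrow> nat) \<Rightarrow> (nat \<Rightarrow> nat) set" where
  "cyl d n x = {\<omega> \<in> Omega d. trunc n \<omega> = x}"

definition iota :: "(nat \<Rightarrow> nat) \<Rightarrow> nat \<Rightarrow> ((nat \<Rightarrow> nat) \<Rightarrow> complex) \<Rightarrow> (nat \<Rightarrow> nat) \<Rightarrow> complex" where
  "iota d n h = (\<lambda>\<omega>. \<Sum>x\<in>level d n. h x * indicator (cyl d n x) \<omega>)"

definition expect :: "(nat \<Rightarrow> nat) \<Rightarrow> nat \<Rightarrow> ((nat \<Rightarrow> nat) \<Rightarrow> complex) \<Rightarrow> (nat \<Rightarrow> nat) \<Rightarrow> complex" where
  "expect d n f = (\<lambda>a. of_nat (card (level d n)) * set_lebesgue_integral (mu d) (cyl d n a) f)"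

section \<open>Function algebras and unital completely positive maps\<close>

text \<open>
  \<open>C(\<Omega>\<^sub>A) \<otimes> C(\<Omega>\<^sub>B)\<close> and the von Neumann tensor product of \<open>L\<^sup>\<infinity>(\<Omega>\<^sub>X)\<close> and \<open>L\<^sup>\<infinity>(\<Omega>\<^sub>Y)\<close> are
  \<open>C(\<Omega>\<^sub>A \<times> \<Omega>\<^sub>B)\<close> and \<open>L\<^sup>\<infinity>(\<mu>\<^sub>X \<times> \<mu>\<^sub>Y)\<close>.  Elements of \<open>L\<^sup>\<infinity>\<close> are represented by functions, so
  identities between them hold almost everywhere.
\<close>

definition Cfun :: "'a::topological_space set \<Rightarrow> ('a \<Rightarrow> complex) set" where
  "Cfun K = {f. continuous_on K f}"

definition Linf :: "'m measure \<Rightarrow> ('m \<Rightarrow> complex) set" where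
  "Linf M = {f \<in> borel_measurable M. \<exists>C. AE x in M. cmod (f x) \<le> C}"

definition tens :: "('a \<Rightarrow> complex) \<Rightarrow> ('b \<Rightarrow> complex) \<Rightarrow> 'a \<times> 'b \<Rightarrow> complex" where
  "tens f g = (\<lambda>(a, b). f a * g b)"

definition psd :: "nat \<Rightarrow> (nat \<Rightarrow> nat \<Rightarrow> complex) \<Rightarrow> bool" where
  "psd m A \<longleftrightarrow> (\<forall>c. (\<Sum>i<m. \<Sum>j<m. cnj (c i) * A i j * c j) \<in> \<real>\<^sub>\<ge>\<^sub>0)"

text \<open>
  Complete positivity tests all matrix amplifications.  An element of \<open>M\<^sub>m(C(K))\<close> or \<open>M\<^sub>m(L\<^sup>\<infinity>)\<close> is
  positive iff it is so pointwise (almost everywhere).  Positivity and linearity force the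
  value of the map at \<open>f\<close> to depend on the restriction of \<open>f\<close> to \<open>K\<close> only.
\<close>

definition ucp_Linf :: "'a::topological_space set \<Rightarrow> 'm measure \<Rightarrow>
  (('a \<Rightarrow> complex) \<Rightarrow> 'm \<Rightarrow> complex) \<Rightarrow> bool" where
  "ucp_Linf K M \<Phi> \<longleftrightarrow>
     (\<forall>f\<in>Cfun K. \<Phi> f \<in> Linf M) \<and>
     (\<forall>f\<in>Cfun K. \<forall>g\<in>Cfun K. AE x in M. \<Phi> (\<lambda>a. f a + g a) x = \<Phi> f x + \<Phi> g x) \<and>
     (\<forall>c. \<forall>f\<in>Cfun K. AE x in M. \<Phi> (\<lambda>a. c * f a) x = c * \<Phi> f x) \<and>
     (AE x in M. \<Phi> (\<lambda>_. 1) x = 1) \<and>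
     (\<forall>m F. (\<forall>i<m. \<forall>j<m. F i j \<in> Cfun K) \<and> (\<forall>a\<in>K. psd m (\<lambda>i j. F i j a)) \<longrightarrow>
        (AE x in M. psd m (\<lambda>i j. \<Phi> (F i j) x)))"

text \<open>
  The von Neumann tensor product of \<open>L\<^sup>\<infinity>(M)\<close> and \<open>B(\<ell>\<^sup>2(J))\<close>, for countable \<open>J\<close>: the closure of the
  algebraic tensor product in the weak operator topology of \<open>B(L\<^sup>2(M; \<ell>\<^sup>2(J)))\<close>.  As \<open>\<ell>\<^sup>2(J)\<close> is
  separable, its elements are decomposable: they are given by essentially bounded, weakly
  measurable fields \<open>F\<close> of operators, acting by \<open>(F u)(x) = F x (u x)\<close>.
\<close>

definition L2field :: "'m measure \<Rightarrow> nat set \<Rightarrow> ('m \<Rightarrow> nat \<Rightarrow> complex) set" where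
  "L2field M J = {u. (\<forall>x\<in>space M. u x \<in> ell2 J) \<and> (\<forall>i. (\<lambda>x. u x i) \<in> borel_measurable M) \<and>
     integrable M (\<lambda>x. (l2norm (u x))\<^sup>2)}"

definition opfield :: "'m measure \<Rightarrow> nat set \<Rightarrow>
  ('m \<Rightarrow> (nat \<Rightarrow> complex) \<Rightarrow> (nat \<Rightarrow> complex)) set" where
  "opfield M J = {F. (\<forall>x\<in>space M. bounded_op J (F x)) \<and>
     (\<forall>v\<in>ell2 J. \<forall>w\<in>ell2 J. (\<lambda>x. ip (F x v) w) \<in> borel_measurable M) \<and>
     (\<exists>C. AE x in M. \<forall>v\<in>ell2 J. l2norm (F x v) \<le> C * l2norm v)}"

definition alg_tensor :: "'m measure \<Rightarrow> nat set \<Rightarrow>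
  ('m \<Rightarrow> (nat \<Rightarrow> complex) \<Rightarrow> (nat \<Rightarrow> complex)) set" where
  "alg_tensor M J = {F \<in> opfield M J. \<exists>(m::nat) f T.
     (\<forall>k<m. f k \<in> Linf M \<and> bounded_op J (T k)) \<and>
     (AE x in M. \<forall>v\<in>ell2 J. F x v = (\<lambda>i. \<Sum>k<m. f k x * T k v i))}"

definition vn_tensor :: "'m measure \<Rightarrow> nat set \<Rightarrow>
  ('m \<Rightarrow> (nat \<Rightarrow> complex) \<Rightarrow> (nat \<Rightarrow> complex)) set" where
  "vn_tensor M J = {F \<in> opfield M J.
     \<forall>W \<epsilon>. finite W \<and> W \<subseteq> L2field M J \<times> L2field M J \<and> \<epsilon> > 0 \<longrightarrow>
       (\<exists>G\<in>alg_tensor M J. \<forall>(u, v)\<in>W.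
          cmod ((LINT x|M. ip (F x (u x)) (v x)) - (LINT x|M. ip (G x (u x)) (v x))) < \<epsilon>)}"

definition psd_op :: "nat set \<Rightarrow> nat \<Rightarrow>
  (nat \<Rightarrow> nat \<Rightarrow> (nat \<Rightarrow> complex) \<Rightarrow> (nat \<Rightarrow> complex)) \<Rightarrow> bool" where
  "psd_op J m A \<longleftrightarrow>
     (\<forall>v. (\<forall>i<m. v i \<in> ell2 J) \<longrightarrow> (\<Sum>i<m. \<Sum>j<m. ip (A i j (v j)) (v i)) \<in> \<real>\<^sub>\<ge>\<^sub>0)"

definition ucp_vn :: "'a::topological_space set \<Rightarrow> 'm measure \<Rightarrow> nat set \<Rightarrow>
  (('a \<Rightarrow> complex) \<Rightarrow> 'm \<Rightarrow> (nat \<Rightarrow> complex) \<Rightarrow> (nat \<Rightarrow> complex)) \<Rightarrow> bool" where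
  "ucp_vn K M J \<Phi> \<longleftrightarrow>
     (\<forall>f\<in>Cfun K. \<Phi> f \<in> vn_tensor M J) \<and>
     (\<forall>f\<in>Cfun K. \<forall>g\<in>Cfun K. AE x in M. \<forall>v\<in>ell2 J.
        \<Phi> (\<lambda>a. f a + g a) x v = (\<lambda>i. \<Phi> f x v i + \<Phi> g x v i)) \<and>
     (\<forall>c. \<forall>f\<in>Cfun K. AE x in M. \<forall>v\<in>ell2 J. \<Phi> (\<lambda>a. c * f a) x v = (\<lambda>i. c * \<Phi> f x v i)) \<and>
     (AE x in M. \<forall>v\<in>ell2 J. \<Phi> (\<lambda>_. 1) x v = v) \<and>
     (\<forall>m F. (\<forall>i<m. \<forall>j<m. F i j \<in> Cfun K) \<and> (\<forall>a\<in>K. psd m (\<lambda>i j. F i j a)) \<longrightarrow>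
        (AE x in M. psd_op J m (\<lambda>i j. \<Phi> (F i j) x)))"

text \<open>The slice map \<open>L\<^sub>g\<close>, given by \<open>\<langle>L\<^sub>g(F) v, w\<rangle> = \<integral> g(x) \<langle>F(x) v, w\<rangle>\<close>, in coordinates.\<close>

definition slice :: "'m measure \<Rightarrow> ('m \<Rightarrow> complex) \<Rightarrow>
  ('m \<Rightarrow> (nat \<Rightarrow> complex) \<Rightarrow> (nat \<Rightarrow> complex)) \<Rightarrow> (nat \<Rightarrow> complex) \<Rightarrow> nat \<Rightarrow> complex" where
  "slice M g F v = (\<lambda>i. LINT x|M. g x * F x v i)"

section \<open>Cantor correlations\<close>

type_synonym cmap =
  "((nat \<Rightarrow> nat) \<times> (nat \<Rightarrow> nat) \<Rightarrow> complex) \<Rightarrow> (nat \<Rightarrow> nat) \<times> (nat \<Rightarrow> nat) \<Rightarrow> complex"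

definition cantor_corr :: "(nat \<Rightarrow> nat) \<Rightarrow> (nat \<Rightarrow> nat) \<Rightarrow> (nat \<Rightarrow> nat) \<Rightarrow> (nat \<Rightarrow> nat) \<Rightarrow>
  cmap \<Rightarrow> bool" where
  "cantor_corr dX dY dA dB \<Gamma> \<longleftrightarrow> ucp_Linf (Omega dA \<times> Omega dB) (mu dX \<Otimes>\<^sub>M mu dY) \<Gamma>"

definition cantor_ns :: "(nat \<Rightarrow> nat) \<Rightarrow> (nat \<Rightarrow> nat) \<Rightarrow> (nat \<Rightarrow> nat) \<Rightarrow> (nat \<Rightarrow> nat) \<Rightarrow>
  cmap \<Rightarrow> bool" where
  "cantor_ns dX dY dA dB \<Gamma> \<longleftrightarrow>
     (\<forall>f\<in>Cfun (Omega dA). \<exists>h\<in>Linf (mu dX).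
        AE z in mu dX \<Otimes>\<^sub>M mu dY. \<Gamma> (tens f (\<lambda>_. 1)) z = tens h (\<lambda>_. 1) z) \<and>
     (\<forall>f\<in>Cfun (Omega dB). \<exists>h\<in>Linf (mu dY).
        AE z in mu dX \<Otimes>\<^sub>M mu dY. \<Gamma> (tens (\<lambda>_. 1) f) z = tens (\<lambda>_. 1) h z)"

text \<open>The maps \<open>\<Phi> \<otimes> \<Psi>\<close> and \<open>\<Gamma>\<close> are determined by their values on elementary tensors.\<close>

definition cantor_loc :: "(nat \<Rightarrow> nat) \<Rightarrow> (nat \<Rightarrow> nat) \<Rightarrow> (nat \<Rightarrow> nat) \<Rightarrow> (nat \<Rightarrow> nat) \<Rightarrow>
  cmap \<Rightarrow> bool" where
  "cantor_loc dX dY dA dB \<Gamma> \<longleftrightarrow>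
     (\<exists>(m::nat) c \<Phi> \<Psi>.
        (\<forall>k<m. 0 \<le> c k \<and> ucp_Linf (Omega dA) (mu dX) (\<Phi> k) \<and>
                ucp_Linf (Omega dB) (mu dY) (\<Psi> k)) \<and>
        (\<Sum>k<m. c k) = 1 \<and>
        (\<forall>f\<in>Cfun (Omega dA). \<forall>g\<in>Cfun (Omega dB). AE z in mu dX \<Otimes>\<^sub>M mu dY.
           \<Gamma> (tens f g) z = (\<Sum>k<m. complex_of_real (c k) * tens (\<Phi> k f) (\<Psi> k g) z)))"

definition cantor_qs :: "(nat \<Rightarrow> nat) \<Rightarrow> (nat \<Rightarrow> nat) \<Rightarrow> (nat \<Rightarrow> nat) \<Rightarrow> (nat \<Rightarrow> nat) \<Rightarrow>
  cmap \<Rightarrow> bool" where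
  "cantor_qs dX dY dA dB \<Gamma> \<longleftrightarrow>
     (\<exists>(J :: nat set) (K :: nat set) \<xi> \<Phi> \<Psi>.
        \<xi> \<in> ell2 (J \<times> K) \<and> l2norm \<xi> = 1 \<and>
        ucp_vn (Omega dA) (mu dX) J \<Phi> \<and> ucp_vn (Omega dB) (mu dY) K \<Psi> \<and>
        (\<forall>f1\<in>Cfun (Omega dA). \<forall>f2\<in>Cfun (Omega dB). \<forall>g1 g2.
           integrable (mu dX) g1 \<and> integrable (mu dY) g2 \<longrightarrow>
           (LINT z|(mu dX \<Otimes>\<^sub>M mu dY). tens g1 g2 z * \<Gamma> (tens f1 f2) z) =
           ip (tensor_map (slice (mu dX) g1 (\<Phi> f1)) (slice (mu dY) g2 (\<Psi> f2)) \<xi>) \<xi>))"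

text \<open>
  In the commuting condition, \<open>\<Phi>(f)\<^sub>1\<^sub>,\<^sub>3\<close> and \<open>\<Psi>(g)\<^sub>2\<^sub>,\<^sub>3\<close> are the operator fields
  \<open>(x, y) \<mapsto> \<Phi>(f)(x)\<close> and \<open>(x, y) \<mapsto> \<Psi>(g)(y)\<close>.
\<close>

definition cantor_qc :: "(nat \<Rightarrow> nat) \<Rightarrow> (nat \<Rightarrow> nat) \<Rightarrow> (nat \<Rightarrow> nat) \<Rightarrow> (nat \<Rightarrow> nat) \<Rightarrow>
  cmap \<Rightarrow> bool" where
  "cantor_qc dX dY dA dB \<Gamma> \<longleftrightarrow>
     (\<exists>(J :: nat set) \<xi> \<Phi> \<Psi>.
        \<xi> \<in> ell2 J \<and> l2norm \<xi> = 1 \<and>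
        ucp_vn (Omega dA) (mu dX) J \<Phi> \<and> ucp_vn (Omega dB) (mu dY) J \<Psi> \<and>
        (\<forall>f\<in>Cfun (Omega dA). \<forall>g\<in>Cfun (Omega dB). AE (x, y) in mu dX \<Otimes>\<^sub>M mu dY. \<forall>v\<in>ell2 J.
           \<Phi> f x (\<Psi> g y v) = \<Psi> g y (\<Phi> f x v)) \<and>
        (\<forall>f1\<in>Cfun (Omega dA). \<forall>f2\<in>Cfun (Omega dB). \<forall>g1 g2.
           integrable (mu dX) g1 \<and> integrable (mu dY) g2 \<longrightarrow>
           (LINT z|(mu dX \<Otimes>\<^sub>M mu dY). tens g1 g2 z * \<Gamma> (tens f1 f2) z) =
           ip (slice (mu dX) g1 (\<Phi> f1) (slice (mu dY) g2 (\<Psi> f2) \<xi>)) \<xi>))"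

definition cantor_class :: "corr_type \<Rightarrow> (nat \<Rightarrow> nat) \<Rightarrow> (nat \<Rightarrow> nat) \<Rightarrow> (nat \<Rightarrow> nat) \<Rightarrow>
  (nat \<Rightarrow> nat) \<Rightarrow> cmap set" where
  "cantor_class t dX dY dA dB = {\<Gamma>. cantor_corr dX dY dA dB \<Gamma> \<and>
     (case t of
        Loc \<Rightarrow> cantor_loc dX dY dA dB \<Gamma>
      | QS \<Rightarrow> cantor_qs dX dY dA dB \<Gamma>
      | QC \<Rightarrow> cantor_qc dX dY dA dB \<Gamma>
      | NS \<Rightarrow> cantor_ns dX dY dA dB \<Gamma>)}"

text \<open>The family \<open>p\<^sub>\<Gamma>\<close>; it is unique only up to a null set, and a representative is chosen.\<close>

definition kernel :: "(nat \<Rightarrow> nat) \<Rightarrow> (nat \<Rightarrow> nat) \<Rightarrow> (nat \<Rightarrow> nat) \<Rightarrow> (nat \<Rightarrow> nat) \<Rightarrow>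
  cmap \<Rightarrow> (nat \<Rightarrow> nat) \<times> (nat \<Rightarrow> nat) \<Rightarrow> ((nat \<Rightarrow> nat) \<times> (nat \<Rightarrow> nat)) measure" where
  "kernel dX dY dA dB \<Gamma> = (SOME p.
     p \<in> (mu dX \<Otimes>\<^sub>M mu dY) \<rightarrow>\<^sub>M prob_algebra (restrict_space borel (Omega dA \<times> Omega dB)) \<and>
     (\<forall>f\<in>Cfun (Omega dA \<times> Omega dB). AE z in mu dX \<Otimes>\<^sub>M mu dY. \<Gamma> f z = (LINT w|p z. f w)))"

definition cantor_value :: "(nat \<Rightarrow> nat) \<Rightarrow> (nat \<Rightarrow> nat) \<Rightarrow> (nat \<Rightarrow> nat) \<Rightarrow> (nat \<Rightarrow> nat) \<Rightarrow>
  cmap \<Rightarrow> ((nat \<Rightarrow> nat) \<times> (nat \<Rightarrow> nat) \<times> (nat \<Rightarrow> nat) \<times> (nat \<Rightarrow> nat)) set \<Rightarrow> real" where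
  "cantor_value dX dY dA dB \<Gamma> M =
     (LINT (x, y)|(mu dX \<Otimes>\<^sub>M mu dY).
        measure (kernel dX dY dA dB \<Gamma> (x, y)) {(a, b). (x, y, a, b) \<in> M})"

section \<open>Games and values\<close>

definition rule_fun :: "(nat \<Rightarrow> nat) \<Rightarrow> (nat \<Rightarrow> nat) \<Rightarrow> (nat \<Rightarrow> nat) \<Rightarrow> (nat \<Rightarrow> nat) \<Rightarrow> nat \<Rightarrow>
  ((nat \<Rightarrow> nat) \<times> (nat \<Rightarrow> nat) \<times> (nat \<Rightarrow> nat) \<times> (nat \<Rightarrow> nat) \<Rightarrow> nat) \<Rightarrow> bool" where
  "rule_fun dX dY dA dB n lam \<longleftrightarrow>
     lam \<in> level dX n \<times> level dY n \<times> level dA n \<times> level dB n \<rightarrow> {0, 1}"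

definition supp :: "(nat \<Rightarrow> nat) \<Rightarrow> (nat \<Rightarrow> nat) \<Rightarrow> (nat \<Rightarrow> nat) \<Rightarrow> (nat \<Rightarrow> nat) \<Rightarrow> nat \<Rightarrow>
  ((nat \<Rightarrow> nat) \<times> (nat \<Rightarrow> nat) \<times> (nat \<Rightarrow> nat) \<times> (nat \<Rightarrow> nat) \<Rightarrow> nat) \<Rightarrow>
  ((nat \<Rightarrow> nat) \<times> (nat \<Rightarrow> nat) \<times> (nat \<Rightarrow> nat) \<times> (nat \<Rightarrow> nat)) set" where
  "supp dX dY dA dB n lam =
     {q \<in> level dX n \<times> level dY n \<times> level dA n \<times> level dB n. lam q \<noteq> 0}"

definition kappa :: "(nat \<Rightarrow> nat) \<Rightarrow> (nat \<Rightarrow> nat) \<Rightarrow> (nat \<Rightarrow> nat) \<Rightarrow> (nat \<Rightarrow> nat) \<Rightarrow> nat \<Rightarrow>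
  ((nat \<Rightarrow> nat) \<times> (nat \<Rightarrow> nat) \<times> (nat \<Rightarrow> nat) \<times> (nat \<Rightarrow> nat) \<Rightarrow> nat) \<Rightarrow>
  ((nat \<Rightarrow> nat) \<times> (nat \<Rightarrow> nat) \<times> (nat \<Rightarrow> nat) \<times> (nat \<Rightarrow> nat)) set" where
  "kappa dX dY dA dB n lam =
     {(x, y, a, b) \<in> Omega dX \<times> Omega dY \<times> Omega dA \<times> Omega dB.
        (trunc n x, trunc n y, trunc n a, trunc n b) \<in> supp dX dY dA dB n lam}"

definition omega_fin :: "'i itself \<Rightarrow> corr_type \<Rightarrow>
  (nat \<Rightarrow> nat) \<Rightarrow> (nat \<Rightarrow> nat) \<Rightarrow> (nat \<Rightarrow> nat) \<Rightarrow> (nat \<Rightarrow> nat) \<Rightarrow> nat \<Rightarrow>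
  ((nat \<Rightarrow> nat) \<times> (nat \<Rightarrow> nat) \<times> (nat \<Rightarrow> nat) \<times> (nat \<Rightarrow> nat) \<Rightarrow> nat) \<Rightarrow> real" where
  "omega_fin I t dX dY dA dB n lam =
     (SUP p\<in>fin_class I t (level dX n) (level dY n) (level dA n) (level dB n).
        fin_value (level dX n) (level dY n) p (supp dX dY dA dB n lam))"

definition omega_cantor :: "corr_type \<Rightarrow>
  (nat \<Rightarrow> nat) \<Rightarrow> (nat \<Rightarrow> nat) \<Rightarrow> (nat \<Rightarrow> nat) \<Rightarrow> (nat \<Rightarrow> nat) \<Rightarrow>
  ((nat \<Rightarrow> nat) \<times> (nat \<Rightarrow> nat) \<times> (nat \<Rightarrow> nat) \<times> (nat \<Rightarrow> nat)) set \<Rightarrow> real" where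
  "omega_cantor t dX dY dA dB \<kappa> =
     (SUP \<Gamma>\<in>cantor_class t dX dY dA dB. cantor_value dX dY dA dB \<Gamma> \<kappa>)"

definition lift_corr :: "(nat \<Rightarrow> nat) \<Rightarrow> (nat \<Rightarrow> nat) \<Rightarrow> (nat \<Rightarrow> nat) \<Rightarrow> (nat \<Rightarrow> nat) \<Rightarrow> nat \<Rightarrow>
  ((nat \<Rightarrow> nat) \<Rightarrow> (nat \<Rightarrow> nat) \<Rightarrow> (nat \<Rightarrow> nat) \<Rightarrow> (nat \<Rightarrow> nat) \<Rightarrow> real) \<Rightarrow> cmap" where
  "lift_corr dX dY dA dB n p =
     tensor_map (iota dX n) (iota dY n) \<circ> fin_map (level dA n) (level dB n) p \<circ>
     tensor_map (expect dA n) (expect dB n)"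

end

theory Submission
  imports Defs
begin

text \<open>
  For a Cantor correlation \<open>\<Gamma>\<close> the section of \<open>\<kappa>\<^sub>n\<close> at \<open>(x, y)\<close> is a union of cylinders, and on
  cylinders the kernel of \<open>\<Gamma>\<close> is given by \<open>\<Gamma>\<close> itself. Hence the value of \<open>\<Gamma>\<close> depends only on the
  averages of \<open>\<Gamma>(\<chi>\<^sub>a \<otimes> \<chi>\<^sub>b)\<close> over the cylinders of level \<open>n\<close>, and it is the value of the finite
  correlation formed by these averages. Lifting is a right inverse of averaging, and both operations
  preserve each of the four classes, so the two suprema are taken over the same set of numbers.
  For the quantum classes, averaging turns a completely positive map into the POVMs of slices of its
  values at cylinder functions. For lifting, a Hilbert space of a finite model is first cut down to
  the span of countably many basis vectors that is invariant under the finitely many operators.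
\<close>

section \<open>Square-summable families and bounded operators\<close>

text \<open>The value of a Cantor correlation is defined through a kernel chosen by
  \<open>SOME\<close>, so nothing can be said about it before a kernel is known to exist. Existence
  rests on the clopen sets: there are only countably many, so the a.e. identities for \<Gamma> hold
  at almost every point for all of them at once, and at such a point they form a finitely additive
  probability that extends to a measure. The two sides use different Hilbert spaces: finite quantum
  models are indexed by subsets of \<open>'i\<close>, Cantor models by sets of naturals. Each
  direction therefore renames basis vectors; in one of them the infinity of \<open>'i\<close>
  supplies the injection of the naturals. Complete positivity of a lifted quantum map amounts to a
  nonnegative sum of entries of the Schur product of two positive semidefinite matrices: one comes
  from the states on the answers, the other from a POVM element. In the opposite direction, fields
  that commute almost everywhere must yield slices that commute exactly. This needs Fubini for
  \<open>F x (G y v)\<close>, whose joint measurability is obtained by expanding in matrix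
  columns.\<close>

definition bvec :: "'i \<Rightarrow> 'i \<Rightarrow> complex" where
  "bvec j = (\<lambda>i. if i = j then 1 else 0)"

lemma ell2_summable: "v \<in> ell2 J \<Longrightarrow> (\<lambda>i. (cmod (v i))\<^sup>2) summable_on UNIV"
  by (simp add: ell2_def)

lemma ell2_outside: "v \<in> ell2 J \<Longrightarrow> i \<notin> J \<Longrightarrow> v i = 0"
  by (simp add: ell2_def)

lemma ell2_mono: "v \<in> ell2 J \<Longrightarrow> J \<subseteq> J' \<Longrightarrow> v \<in> ell2 J'"
  by (auto simp: ell2_def)

lemma ell2_zero [simp]: "(\<lambda>_. 0) \<in> ell2 J"
  by (simp add: ell2_def)

lemma l2norm_nonneg [simp]: "0 \<le> l2norm v"
  unfolding l2norm_def by (auto intro!: infsum_nonneg)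

lemma l2norm_power2: "(l2norm v)\<^sup>2 = (\<Sum>\<^sub>\<infinity>i. (cmod (v i))\<^sup>2)"
  unfolding l2norm_def by (simp add: infsum_nonneg)

lemma l2norm_zero [simp]: "l2norm (\<lambda>_. 0) = 0"
  by (simp add: l2norm_def)

lemma sum_le_l2norm:
  assumes "v \<in> ell2 J" "finite S"
  shows "(\<Sum>i\<in>S. (cmod (v i))\<^sup>2) \<le> (l2norm v)\<^sup>2"
  unfolding l2norm_power2
  by (rule finite_sum_le_infsum) (use assms ell2_summable in auto)

lemma cmod_le_l2norm:
  assumes "v \<in> ell2 J"
  shows "cmod (v i) \<le> l2norm v"
proof -
  have "(cmod (v i))\<^sup>2 \<le> (l2norm v)\<^sup>2" using sum_le_l2norm[OF assms, of "{i}"] by simp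
  thus ?thesis by (rule power2_le_imp_le) simp
qed

text \<open>The usual route into \<open>ell2\<close>: the estimates below control finite partial
  sums, and a bound uniform in the finite set gives membership and the norm bound together.\<close>

lemma ell2_bounded_sums:
  assumes "\<And>i. i \<notin> J \<Longrightarrow> v i = 0"
    and le: "\<And>S. finite S \<Longrightarrow> (\<Sum>i\<in>S. (cmod (v i))\<^sup>2) \<le> B\<^sup>2" and "0 \<le> B"
  shows "v \<in> ell2 J" "l2norm v \<le> B"
proof -
  have s: "(\<lambda>i. (cmod (v i))\<^sup>2) summable_on UNIV"
    by (rule nonneg_bdd_above_summable_on) (auto intro!: bdd_aboveI[of _ "B\<^sup>2"] le)
  then show "v \<in> ell2 J" using assms by (simp add: ell2_def)
  have "(l2norm v)\<^sup>2 \<le> B\<^sup>2" unfolding l2norm_power2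
    by (rule infsum_le_finite_sums[OF s]) (use le in auto)
  thus "l2norm v \<le> B" using \<open>0 \<le> B\<close> by (rule power2_le_imp_le)
qed

text \<open>Minkowski's inequality on finite sets, with a bound that does not depend on the
  set.\<close>

lemma l2norm_add:
  assumes "v \<in> ell2 J" "w \<in> ell2 J"
  shows "(\<lambda>i. v i + w i) \<in> ell2 J" "l2norm (\<lambda>i. v i + w i) \<le> l2norm v + l2norm w"
proof -
  have le: "(\<Sum>i\<in>S. (cmod (v i + w i))\<^sup>2) \<le> (l2norm v + l2norm w)\<^sup>2" if "finite S" for S
  proof -
    have "L2_set (\<lambda>i. cmod (v i + w i)) S \<le> L2_set (\<lambda>i. cmod (v i) + cmod (w i)) S"
      by (rule L2_set_mono) (auto intro: norm_triangle_ineq)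
    also have "\<dots> \<le> L2_set (\<lambda>i. cmod (v i)) S + L2_set (\<lambda>i. cmod (w i)) S"
      by (rule L2_set_triangle_ineq)
    also have "\<dots> \<le> l2norm v + l2norm w"
      using sum_le_l2norm[OF assms(1) that] sum_le_l2norm[OF assms(2) that]
      by (intro add_mono) (auto simp: L2_set_def intro!: real_le_lsqrt sum_nonneg)
    finally have "(L2_set (\<lambda>i. cmod (v i + w i)) S)\<^sup>2 \<le> (l2norm v + l2norm w)\<^sup>2"
      by (intro power_mono) auto
    thus ?thesis by (simp add: L2_set_def sum_nonneg)
  qed
  show "(\<lambda>i. v i + w i) \<in> ell2 J" "l2norm (\<lambda>i. v i + w i) \<le> l2norm v + l2norm w"
    using ell2_bounded_sums[OF _ le] ell2_outside[OF assms(1)] ell2_outside[OF assms(2)] by auto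
qed

lemma l2norm_scale:
  assumes "v \<in> ell2 J"
  shows "(\<lambda>i. c * v i) \<in> ell2 J" "l2norm (\<lambda>i. c * v i) = cmod c * l2norm v"
proof -
  have "(\<lambda>i. (cmod (c * v i))\<^sup>2) summable_on UNIV"
    using ell2_summable[OF assms] by (auto simp: norm_mult power_mult_distrib intro!: summable_on_cmult_right)
  thus "(\<lambda>i. c * v i) \<in> ell2 J" using assms by (auto simp: ell2_def)
  show "l2norm (\<lambda>i. c * v i) = cmod c * l2norm v"
    unfolding l2norm_def by (simp add: norm_mult power_mult_distrib infsum_cmult_right' real_sqrt_mult)
qed

lemma ell2_sum:
  assumes "\<And>k. k \<in> A \<Longrightarrow> v k \<in> ell2 J"
  shows "(\<lambda>i. \<Sum>k\<in>A. v k i) \<in> ell2 J"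
  using assms
proof (induction A rule: infinite_finite_induct)
  case (insert x F)
  then show ?case using l2norm_add(1)[of "v x" J "\<lambda>i. \<Sum>k\<in>F. v k i"] by simp
qed auto

lemma ell2_restrict:
  assumes "v \<in> ell2 J"
  shows "(\<lambda>i. if i \<in> S then v i else 0) \<in> ell2 (J \<inter> S)"
proof -
  have "(\<lambda>i. (cmod (if i \<in> S then v i else 0))\<^sup>2) summable_on UNIV"
    by (rule summable_on_comparison_test[OF ell2_summable[OF assms]]) auto
  thus ?thesis using assms by (auto simp: ell2_def)
qed

lemma bvec_ell2: "j \<in> J \<Longrightarrow> bvec j \<in> ell2 J"
  by (rule ell2_bounded_sums(1)[where B = 1])
     (auto simp: bvec_def if_distrib[of cmod] if_distrib[of "\<lambda>x. x\<^sup>2"] sum.delta cong: if_cong)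

section \<open>The inner product\<close>

lemma ip_summable:
  assumes "v \<in> ell2 J" "w \<in> ell2 J"
  shows "(\<lambda>i. v i * cnj (w i)) summable_on UNIV"
    and "(\<lambda>i. cmod (v i * cnj (w i))) summable_on UNIV"
proof -
  show "(\<lambda>i. cmod (v i * cnj (w i))) summable_on UNIV"
  proof (rule summable_on_comparison_test)
    show "(\<lambda>i. (cmod (v i))\<^sup>2 + (cmod (w i))\<^sup>2) summable_on UNIV"
      by (intro summable_on_add ell2_summable[OF assms(1)] ell2_summable[OF assms(2)])
    fix i
    have "2 * (cmod (v i) * cmod (w i)) \<le> (cmod (v i))\<^sup>2 + (cmod (w i))\<^sup>2"
      using sum_squares_bound[of "cmod (v i)" "cmod (w i)"] by simp
    moreover have "0 \<le> cmod (v i) * cmod (w i)" by simp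
    ultimately show "cmod (v i * cnj (w i)) \<le> (cmod (v i))\<^sup>2 + (cmod (w i))\<^sup>2"
      unfolding norm_mult complex_mod_cnj by linarith
  qed auto
  thus "(\<lambda>i. v i * cnj (w i)) summable_on UNIV" by (rule abs_summable_summable)
qed

text \<open>Cauchy-Schwarz for partial sums. Uniformity in \<open>S\<close> provides the dominating
  function in \<open>ip_slice\<close>.\<close>

lemma ip_partial_bound:
  assumes "v \<in> ell2 J" "w \<in> ell2 J" "finite S"
  shows "cmod (\<Sum>i\<in>S. v i * cnj (w i)) \<le> l2norm v * l2norm w"
proof -
  have "cmod (\<Sum>i\<in>S. v i * cnj (w i)) \<le> (\<Sum>i\<in>S. \<bar>cmod (v i)\<bar> * \<bar>cmod (w i)\<bar>)"
    by (rule order_trans[OF norm_sum]) (simp add: norm_mult)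
  also have "\<dots> \<le> L2_set (\<lambda>i. cmod (v i)) S * L2_set (\<lambda>i. cmod (w i)) S"
    by (rule L2_set_mult_ineq)
  also have "\<dots> \<le> l2norm v * l2norm w"
    using sum_le_l2norm[OF assms(1,3)] sum_le_l2norm[OF assms(2,3)]
    by (intro mult_mono) (auto simp: L2_set_def intro!: real_le_lsqrt sum_nonneg)
  finally show ?thesis .
qed

lemma ip_add_left:
  assumes "v \<in> ell2 J" "v' \<in> ell2 J" "w \<in> ell2 J"
  shows "ip (\<lambda>i. v i + v' i) w = ip v w + ip v' w"
  unfolding ip_def distrib_right
  by (rule infsum_add[OF ip_summable(1)[OF assms(1,3)] ip_summable(1)[OF assms(2,3)]])

lemma ip_scale_left: "ip (\<lambda>i. c * v i) w = c * ip v w"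
  unfolding ip_def by (simp add: infsum_cmult_right' mult.assoc)

lemma ip_zero_left [simp]: "ip (\<lambda>i. 0) w = 0"
  by (simp add: ip_def)

lemma ip_sum_left:
  assumes "\<And>k. k \<in> A \<Longrightarrow> v k \<in> ell2 J" "w \<in> ell2 J"
  shows "ip (\<lambda>i. \<Sum>k\<in>A. v k i) w = (\<Sum>k\<in>A. ip (v k) w)"
  using assms
proof (induction A rule: infinite_finite_induct)
  case (insert x F)
  then show ?case using ip_add_left[of "v x" J "\<lambda>i. \<Sum>k\<in>F. v k i" w] ell2_sum[of F v J] by simp
qed auto

lemma ip_cnj: "ip w v = cnj (ip v w)"
  unfolding ip_def infsum_cnj[symmetric] by (simp add: mult.commute)

lemma ip_bvec: "ip v (bvec i) = v i"
proof -
  have "(\<Sum>\<^sub>\<infinity>j. v j * cnj (bvec i j)) = (\<Sum>\<^sub>\<infinity>j\<in>{i}. v j * cnj (bvec i j))"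
    by (rule infsum_cong_neutral) (auto simp: bvec_def)
  thus ?thesis by (simp add: ip_def bvec_def)
qed

section \<open>Bounded operators and their matrix entries\<close>

lemma bounded_opD:
  assumes "bounded_op J T"
  shows "v \<in> ell2 J \<Longrightarrow> T v \<in> ell2 J"
    and "v \<in> ell2 J \<Longrightarrow> w \<in> ell2 J \<Longrightarrow> T (\<lambda>i. v i + w i) = (\<lambda>i. T v i + T w i)"
    and "v \<in> ell2 J \<Longrightarrow> T (\<lambda>i. c * v i) = (\<lambda>i. c * T v i)"
  using assms unfolding bounded_op_def by blast+

text \<open>On the zero space the constant in \<open>bounded_op\<close> may be negative; replacing
  it by its maximum with 0 allows inequalities to be multiplied by it.\<close>

lemma bounded_op_bound:
  assumes "bounded_op J T"
  obtains C where "0 \<le> C" "\<And>v. v \<in> ell2 J \<Longrightarrow> l2norm (T v) \<le> C * l2norm v"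
proof -
  obtain C where C: "\<And>v. v \<in> ell2 J \<Longrightarrow> l2norm (T v) \<le> C * l2norm v"
    using assms unfolding bounded_op_def by blast
  have "l2norm (T v) \<le> max C 0 * l2norm v" if "v \<in> ell2 J" for v
    using C[OF that] mult_right_mono[of C "max C 0" "l2norm v"] by simp
  thus ?thesis using that[of "max C 0"] by simp
qed

lemma bounded_op_zero: "bounded_op J T \<Longrightarrow> T (\<lambda>_. 0) = (\<lambda>_. 0)"
  using bounded_opD(3)[of J T "\<lambda>_. 0" 0] by simp

lemma bounded_op_sum:
  assumes "bounded_op J T" "\<And>k. k \<in> A \<Longrightarrow> v k \<in> ell2 J"
  shows "T (\<lambda>i. \<Sum>k\<in>A. v k i) = (\<lambda>i. \<Sum>k\<in>A. T (v k) i)"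
  using assms(2)
proof (induction A rule: infinite_finite_induct)
  case (insert x F)
  then show ?case
    using bounded_opD(2)[OF assms(1), of "v x" "\<lambda>i. \<Sum>k\<in>F. v k i"] ell2_sum[of F v J] by simp
qed (auto simp: bounded_op_zero[OF assms(1)])

text \<open>What remains of \<open>v\<close> after finitely many coordinates are removed tends to 0
  in norm, and the operator bound carries this over to each coordinate of \<open>T v\<close>.
  Unordered summation covers index sets of every cardinality.\<close>

lemma bounded_op_has_sum:
  assumes T: "bounded_op J T" and v: "v \<in> ell2 J"
  shows "((\<lambda>j. v j * T (bvec j) i) has_sum T v i) UNIV"
proof -
  obtain C where C: "0 \<le> C" "\<And>v. v \<in> ell2 J \<Longrightarrow> l2norm (T v) \<le> C * l2norm v"
    using bounded_op_bound[OF T] by blast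
  define r where "r S = (\<lambda>i. if i \<in> - S then v i else 0)" for S
  have r: "r S \<in> ell2 J" for S
    unfolding r_def using ell2_restrict[OF v, of "-S"] ell2_mono by blast
  have part: "T v i = T (r S) i + (\<Sum>j\<in>S. v j * T (bvec j) i)" if "finite S" for S
  proof -
    \<comment> \<open>For \<open>j\<close> outside \<open>J\<close> the vector \<open>bvec j\<close>
      is not in \<open>ell2 J\<close>, so linearity says nothing about it; but then
      \<open>v j = 0\<close> and both sides vanish.\<close>
    have b: "(\<lambda>i. v j * bvec j i) \<in> ell2 J \<and> T (\<lambda>i. v j * bvec j i) = (\<lambda>i. v j * T (bvec j) i)" for j
    proof (cases "j \<in> J")
      case True
      then show ?thesis
        using l2norm_scale(1)[OF bvec_ell2[OF True]] bounded_opD(3)[OF T bvec_ell2[OF True]] by simp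
    next
      case False
      then show ?thesis using ell2_outside[OF v False] bounded_op_zero[OF T] by simp
    qed
    have "v = (\<lambda>i. r S i + (\<Sum>j\<in>S. v j * bvec j i))"
    proof
      fix i
      have "(\<Sum>j\<in>S. v j * bvec j i) = (\<Sum>j\<in>S. if i = j then v j else 0)"
        by (intro sum.cong) (auto simp: bvec_def)
      then show "v i = r S i + (\<Sum>j\<in>S. v j * bvec j i)"
        using that by (simp add: r_def)
    qed
    hence "T v = T (\<lambda>i. r S i + (\<Sum>j\<in>S. v j * bvec j i))" by simp
    also have "\<dots> = (\<lambda>i. T (r S) i + T (\<lambda>i. \<Sum>j\<in>S. v j * bvec j i) i)"
      by (rule bounded_opD(2)[OF T r ell2_sum]) (use b in auto)
    also have "T (\<lambda>i. \<Sum>j\<in>S. v j * bvec j i) = (\<lambda>i. \<Sum>j\<in>S. v j * T (bvec j) i)"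
      using bounded_op_sum[OF T, of S "\<lambda>j i. v j * bvec j i"] b by simp
    finally show ?thesis by (simp add: fun_eq_iff)
  qed
  have rn: "(l2norm (r S))\<^sup>2 = (l2norm v)\<^sup>2 - (\<Sum>j\<in>S. (cmod (v j))\<^sup>2)" if "finite S" for S
  proof -
    have 1: "(\<Sum>\<^sub>\<infinity>j\<in>S \<union> (-S). (cmod (v j))\<^sup>2) = (\<Sum>\<^sub>\<infinity>j\<in>S. (cmod (v j))\<^sup>2) + (\<Sum>\<^sub>\<infinity>j\<in>-S. (cmod (v j))\<^sup>2)"
      using that by (intro infsum_Un_disjoint summable_on_subset_banach[OF ell2_summable[OF v]]) auto
    have 2: "(\<Sum>\<^sub>\<infinity>j\<in>-S. (cmod (v j))\<^sup>2) = (\<Sum>\<^sub>\<infinity>j. (cmod (r S j))\<^sup>2)"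
      by (rule infsum_cong_neutral) (auto simp: r_def)
    show ?thesis using 1 2 that by (simp add: l2norm_power2)
  qed
  have "((\<lambda>S. (l2norm v)\<^sup>2 - (\<Sum>j\<in>S. (cmod (v j))\<^sup>2)) \<longlongrightarrow> (l2norm v)\<^sup>2 - (l2norm v)\<^sup>2) (finite_subsets_at_top UNIV)"
    by (intro tendsto_intros)
       (use has_sum_infsum[OF ell2_summable[OF v]] in \<open>simp add: l2norm_power2 has_sum_def\<close>)
  hence "((\<lambda>S. sqrt ((l2norm v)\<^sup>2 - (\<Sum>j\<in>S. (cmod (v j))\<^sup>2))) \<longlongrightarrow> sqrt 0) (finite_subsets_at_top UNIV)"
    by (intro tendsto_real_sqrt) simp
  hence lim: "((\<lambda>S. C * sqrt ((l2norm v)\<^sup>2 - (\<Sum>j\<in>S. (cmod (v j))\<^sup>2))) \<longlongrightarrow> 0) (finite_subsets_at_top UNIV)"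
    using tendsto_mult_left[of _ 0 _ C] by force
  have "((\<lambda>S. (\<Sum>j\<in>S. v j * T (bvec j) i) - T v i) \<longlongrightarrow> 0) (finite_subsets_at_top UNIV)"
  proof (rule Lim_null_comparison[OF _ lim])
    show "\<forall>\<^sub>F S in finite_subsets_at_top UNIV. norm ((\<Sum>j\<in>S. v j * T (bvec j) i) - T v i) \<le>
        C * sqrt ((l2norm v)\<^sup>2 - (\<Sum>j\<in>S. (cmod (v j))\<^sup>2))"
    proof (rule eventually_mono[OF eventually_finite_subsets_at_top_weakI])
      fix S :: "'a set" assume fin: "finite S"
      have "norm ((\<Sum>j\<in>S. v j * T (bvec j) i) - T v i) = cmod (T (r S) i)"
        unfolding part[OF fin] by simp
      also have "\<dots> \<le> l2norm (T (r S))" by (rule cmod_le_l2norm[OF bounded_opD(1)[OF T r]])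
      also have "\<dots> \<le> C * l2norm (r S)" by (rule C(2)[OF r])
      also have "l2norm (r S) = sqrt ((l2norm v)\<^sup>2 - (\<Sum>j\<in>S. (cmod (v j))\<^sup>2))"
        unfolding rn[OF fin, symmetric] by simp
      finally show "norm ((\<Sum>j\<in>S. v j * T (bvec j) i) - T v i) \<le>
        C * sqrt ((l2norm v)\<^sup>2 - (\<Sum>j\<in>S. (cmod (v j))\<^sup>2))" .
    qed auto
  qed
  thus ?thesis unfolding has_sum_def by (rule LIM_zero_cancel)
qed

lemma bounded_op_combination:
  assumes "finite A" "\<And>k. k \<in> A \<Longrightarrow> bounded_op J (T k)"
  shows "bounded_op J (\<lambda>v i. \<Sum>k\<in>A. c k * T k v i)"
    and "\<exists>C. \<forall>v\<in>ell2 J. l2norm (\<lambda>i. \<Sum>k\<in>A. c k * T k v i) \<le> C * l2norm v"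
proof -
  show ex: "\<exists>C. \<forall>v\<in>ell2 J. l2norm (\<lambda>i. \<Sum>k\<in>A. c k * T k v i) \<le> C * l2norm v"
    using assms
  proof (induction A rule: finite_induct)
    case empty
    then show ?case by (intro exI[of _ 0]) auto
  next
    case (insert x F)
    obtain C where C: "\<forall>v\<in>ell2 J. l2norm (\<lambda>i. \<Sum>k\<in>F. c k * T k v i) \<le> C * l2norm v"
      using insert by blast
    obtain D where D: "\<And>v. v\<in>ell2 J \<Longrightarrow> l2norm (T x v) \<le> D * l2norm v"
      using bounded_op_bound[OF insert.prems[of x]] by auto
    have "l2norm (\<lambda>i. \<Sum>k\<in>insert x F. c k * T k v i) \<le> (cmod (c x) * D + C) * l2norm v"
      if v: "v \<in> ell2 J" for v
    proof -
      have 1: "T k v \<in> ell2 J" if "k \<in> insert x F" for k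
        using bounded_opD(1)[OF insert.prems[OF that] v] .
      have "l2norm (\<lambda>i. \<Sum>k\<in>insert x F. c k * T k v i) = l2norm (\<lambda>i. c x * T x v i + (\<Sum>k\<in>F. c k * T k v i))"
        using insert by simp
      also have "\<dots> \<le> l2norm (\<lambda>i. c x * T x v i) + l2norm (\<lambda>i. \<Sum>k\<in>F. c k * T k v i)"
        by (rule l2norm_add(2)[where J = J]) (use 1 in \<open>auto intro!: l2norm_scale ell2_sum\<close>)
      also have "\<dots> \<le> cmod (c x) * (D * l2norm v) + C * l2norm v"
      proof (rule add_mono)
        show "l2norm (\<lambda>i. c x * T x v i) \<le> cmod (c x) * (D * l2norm v)"
          using l2norm_scale(2)[OF 1, of x "c x"] D[OF v] by (simp add: mult_left_mono)
        show "l2norm (\<lambda>i. \<Sum>k\<in>F. c k * T k v i) \<le> C * l2norm v" using C v by blast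
      qed
      finally show ?thesis by (simp add: algebra_simps)
    qed
    then show ?case by blast
  qed
  show "bounded_op J (\<lambda>v i. \<Sum>k\<in>A. c k * T k v i)"
    unfolding bounded_op_def
  proof (intro conjI ex ballI allI)
    fix v assume v: "v \<in> ell2 J"
    show "(\<lambda>i. \<Sum>k\<in>A. c k * T k v i) \<in> ell2 J"
      by (intro ell2_sum l2norm_scale) (use assms v bounded_opD(1) in blast)
    show "(\<lambda>i. \<Sum>k\<in>A. c k * T k (\<lambda>i. v i + w i) i) =
      (\<lambda>i. (\<Sum>k\<in>A. c k * T k v i) + (\<Sum>k\<in>A. c k * T k w i))" if "w \<in> ell2 J" for w
      using bounded_opD(2)[OF assms(2) v that]
      by (simp add: sum.distrib[symmetric] distrib_left)
    show "(\<lambda>i. \<Sum>k\<in>A. c k * T k (\<lambda>i. a * v i) i) = (\<lambda>i. a * (\<Sum>k\<in>A. c k * T k v i))" for a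
      using bounded_opD(3)[OF assms(2) v, of _ a]
      by (auto simp: sum_distrib_left mult_ac intro!: ext sum.cong)
  qed
qed

section \<open>Positive semidefinite matrices\<close>

lemma nonneg_Reals_sum_I:
  "(\<And>u. u \<in> U \<Longrightarrow> (f u :: complex) \<in> \<real>\<^sub>\<ge>\<^sub>0) \<Longrightarrow> sum f U \<in> \<real>\<^sub>\<ge>\<^sub>0"
  by (auto simp: complex_nonneg_Reals_iff intro: sum_nonneg)

lemma psd_1_iff: "psd 1 A \<longleftrightarrow> A 0 0 \<in> \<real>\<^sub>\<ge>\<^sub>0"
proof
  assume "psd 1 A"
  from this[unfolded psd_def, rule_format, of "\<lambda>_. 1"] show "A 0 0 \<in> \<real>\<^sub>\<ge>\<^sub>0" by simp
next
  assume *: "A 0 0 \<in> \<real>\<^sub>\<ge>\<^sub>0"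
  have "cnj (c 0) * A 0 0 * c 0 \<in> \<real>\<^sub>\<ge>\<^sub>0" for c :: "nat \<Rightarrow> complex"
  proof -
    have "cnj (c 0) * A 0 0 * c 0 = of_real ((cmod (c 0))\<^sup>2) * A 0 0"
      unfolding complex_norm_square by (simp add: mult_ac)
    also have "\<dots> \<in> \<real>\<^sub>\<ge>\<^sub>0" by (intro nonneg_Reals_mult_I *) auto
    finally show ?thesis .
  qed
  thus "psd 1 A" by (auto simp: psd_def)
qed

lemma psd_weighted_sum:
  assumes "\<And>u. u \<in> U \<Longrightarrow> 0 \<le> w u" "\<And>u. u \<in> U \<Longrightarrow> psd m (A u)"
  shows "psd m (\<lambda>i j. \<Sum>u\<in>U. complex_of_real (w u) * A u i j)"
  unfolding psd_def
proof
  fix c :: "nat \<Rightarrow> complex"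
  have "(\<Sum>i<m. \<Sum>j<m. cnj (c i) * (\<Sum>u\<in>U. complex_of_real (w u) * A u i j) * c j) =
    (\<Sum>i<m. \<Sum>j<m. \<Sum>u\<in>U. complex_of_real (w u) * (cnj (c i) * A u i j * c j))"
    by (simp add: sum_distrib_left sum_distrib_right mult_ac)
  also have "\<dots> = (\<Sum>i<m. \<Sum>u\<in>U. \<Sum>j<m. complex_of_real (w u) * (cnj (c i) * A u i j * c j))"
    by (intro sum.cong refl sum.swap)
  also have "\<dots> = (\<Sum>u\<in>U. \<Sum>i<m. \<Sum>j<m. complex_of_real (w u) * (cnj (c i) * A u i j * c j))"
    by (rule sum.swap)
  also have "\<dots> = (\<Sum>u\<in>U. complex_of_real (w u) * (\<Sum>i<m. \<Sum>j<m. cnj (c i) * A u i j * c j))"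
    by (simp add: sum_distrib_left)
  also have "\<dots> \<in> \<real>\<^sub>\<ge>\<^sub>0"
    by (rule nonneg_Reals_sum_I, rule nonneg_Reals_mult_I) (use assms in \<open>auto simp: psd_def\<close>)
  finally show "(\<Sum>i<m. \<Sum>j<m. cnj (c i) * (\<Sum>u\<in>U. complex_of_real (w u) * A u i j) * c j) \<in> \<real>\<^sub>\<ge>\<^sub>0" .
qed

text \<open>Test vectors supported on two indices. Hermitian symmetry and the vanishing of columns
  with zero diagonal entry both come from special values of \<open>x\<close> and
  \<open>y\<close>.\<close>

lemma psd_pair:
  assumes "psd m A" "i < m" "j < m" "i \<noteq> j"
  shows "cnj x * A i i * x + cnj x * A i j * y + cnj y * A j i * x + cnj y * A j j * y \<in> \<real>\<^sub>\<ge>\<^sub>0"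
proof -
  define c where "c k = (if k = i then x else if k = j then y else 0)" for k
  have "(\<Sum>k<m. \<Sum>l<m. cnj (c k) * A k l * c l) = (\<Sum>k\<in>{i,j}. \<Sum>l<m. cnj (c k) * A k l * c l)"
    using assms by (intro sum.mono_neutral_right) (auto simp: c_def)
  also have "\<dots> = (\<Sum>k\<in>{i,j}. \<Sum>l\<in>{i,j}. cnj (c k) * A k l * c l)"
    using assms by (intro sum.cong refl sum.mono_neutral_right) (auto simp: c_def)
  also have "\<dots> = cnj x * A i i * x + cnj x * A i j * y + cnj y * A j i * x + cnj y * A j j * y"
    using assms by (simp add: c_def)
  finally show ?thesis using assms(1)[unfolded psd_def, rule_format, of c] by simp
qed

lemma psd_diag: "psd m A \<Longrightarrow> i < m \<Longrightarrow> A i i \<in> \<real>\<^sub>\<ge>\<^sub>0"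
proof -
  assume A: "psd m A" and i: "i < m"
  define c :: "nat \<Rightarrow> complex" where "c k = (if k = i then 1 else 0)" for k
  have "(\<Sum>k<m. \<Sum>l<m. cnj (c k) * A k l * c l) = (\<Sum>k\<in>{i}. \<Sum>l<m. cnj (c k) * A k l * c l)"
    using i by (intro sum.mono_neutral_right) (auto simp: c_def)
  also have "\<dots> = (\<Sum>k\<in>{i}. \<Sum>l\<in>{i}. cnj (c k) * A k l * c l)"
    using i by (intro sum.cong refl sum.mono_neutral_right) (auto simp: c_def)
  also have "\<dots> = A i i" by (simp add: c_def)
  finally show ?thesis using A[unfolded psd_def, rule_format, of c] by simp
qed

lemma psd_hermitian:
  assumes "psd m A" "i < m" "j < m"
  shows "A j i = cnj (A i j)"
proof (cases "i = j")
  case True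
  then show ?thesis using psd_diag[OF assms(1,2)] by (auto simp: complex_nonneg_Reals_iff complex_eq_iff)
next
  case False
  have "Im (A i i) = 0" "Im (A j j) = 0"
    using psd_diag[OF assms(1,2)] psd_diag[OF assms(1,3)] by (auto simp: complex_nonneg_Reals_iff)
  \<comment> \<open>The pair (1, 1) shows that the imaginary parts of \<open>A i j\<close> and
    \<open>A j i\<close> cancel, the pair (1, \<i>) that their real parts agree.\<close>
  with psd_pair[OF assms False, of 1 1] psd_pair[OF assms False, of 1 \<i>]
  show ?thesis by (auto simp: complex_nonneg_Reals_iff complex_eq_iff)
qed

lemma psd_zero_diag:
  assumes "psd m A" "i < m" "j < m" "A j j = 0"
  shows "A i j = 0"
proof (cases "i = j")
  case False
  show ?thesis
  proof (rule ccontr)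
    assume nz: "A i j \<noteq> 0"
    define r where "r = Re (A i i)"
    \<comment> \<open>Chosen so that the form at \<open>1\<close> and
      \<open>- of_real t * cnj (A i j)\<close> has real part \<open>r - (r + 1)\<close>, which is
      negative.\<close>
    define t where "t = (r + 1) / (2 * (cmod (A i j))\<^sup>2)"
    have A: "A j i = cnj (A i j)" by (rule psd_hermitian[OF assms(1-3)])
    have "0 \<le> Re (A i i + A i j * (- of_real t * cnj (A i j)) + cnj (- of_real t * cnj (A i j)) * A j i)"
      using psd_pair[OF assms(1-3) False, of 1 "- of_real t * cnj (A i j)"] assms(4)
      by (simp add: complex_nonneg_Reals_iff)
    also have "A i i + A i j * (- of_real t * cnj (A i j)) + cnj (- of_real t * cnj (A i j)) * A j i =
      A i i - of_real (2 * t * (cmod (A i j))\<^sup>2)"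
      unfolding A of_real_mult complex_norm_square by (simp add: algebra_simps)
    also have "2 * t * (cmod (A i j))\<^sup>2 = r + 1" using nz by (simp add: t_def)
    finally show False by (simp add: r_def)
  qed
qed (use assms in auto)

text \<open>The induction splits off one rank-one (Cholesky) term of \<open>A\<close>.\<close>

lemma psd_schur_sum:
  assumes "psd m A" "psd m B"
  shows "(\<Sum>i<m. \<Sum>j<m. A i j * B i j) \<in> \<real>\<^sub>\<ge>\<^sub>0"
  using assms
proof (induction m arbitrary: A)
  case (Suc m)
  define a where "a = Re (A m m)"
  have a: "A m m = of_real a" "0 \<le> a"
    using psd_diag[OF Suc.prems(1), of m] by (auto simp: a_def complex_nonneg_Reals_iff complex_eq_iff)
  \<comment> \<open>If \<open>a = 0\<close>, division by zero makes \<open>u\<close> vanish, which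
    is the right value: column \<open>m\<close> of \<open>A\<close> is then zero by
    \<open>psd_zero_diag\<close>.\<close>
  define u where "u i = A i m / of_real (sqrt a)" for i
  define A' where "A' i j = A i j - u i * cnj (u j)" for i j
  have herm: "A j i = cnj (A i j)" if "i \<le> m" "j \<le> m" for i j
    by (rule psd_hermitian[OF Suc.prems(1)]) (use that in auto)
  have uu: "u i * cnj (u j) = A i m * A m j / A m m" if "i \<le> m" "j \<le> m" for i j
  proof -
    have "of_real (sqrt a) * of_real (sqrt a) = complex_of_real a"
      using a(2) by (metis of_real_mult real_sqrt_mult_self abs_of_nonneg)
    thus ?thesis using herm[of j m] that by (simp add: u_def a(1))
  qed
  have zero: "A' i m = 0 \<and> A' m i = 0" if "i \<le> m" for i
  proof (cases "a = 0")
    case True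
    then have "A m m = 0" using a by simp
    then show ?thesis
      using psd_zero_diag[OF Suc.prems(1), of i m] herm[of i m] that by (simp add: A'_def uu)
  next
    case False
    then show ?thesis using that a by (simp add: A'_def uu)
  qed
  have psdA': "psd m A'"
    unfolding psd_def
  proof
    fix c :: "nat \<Rightarrow> complex"
    define s where "s = (\<Sum>j<m. A m j * c j)"
    \<comment> \<open>Completing the square: the last coordinate is chosen such that the form of
      \<open>A\<close> at \<open>d\<close> is the form of the Schur complement \<open>A'\<close> at
      \<open>c\<close>.\<close>
    define d where "d k = (if k < m then c k else - s / A m m)" for k
    have expand: "(\<Sum>i<Suc m. \<Sum>j<Suc m. cnj (d i) * M i j * d j) =
      (\<Sum>i<m. \<Sum>j<m. cnj (c i) * M i j * c j) + (\<Sum>i<m. cnj (c i) * M i m) * d m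
       + cnj (d m) * (\<Sum>j<m. M m j * c j) + cnj (d m) * M m m * d m" for M :: "nat \<Rightarrow> nat \<Rightarrow> complex"
      by (simp add: d_def sum.distrib sum_subtractf sum_negf sum_distrib_left sum_distrib_right mult_ac)
    have t: "(\<Sum>i<m. cnj (c i) * A i m) = cnj s"
      unfolding s_def cnj_sum
    proof (intro sum.cong refl)
      fix i assume "i \<in> {..<m}"
      then have "A i m = cnj (A m i)" by (intro herm) auto
      then show "cnj (c i) * A i m = cnj (A m i * c i)" by simp
    qed
    have ss: "cnj s * s = (\<Sum>i<m. \<Sum>j<m. (cnj (c i) * A i m) * (A m j * c j))"
    proof -
      have "cnj s * s = (\<Sum>i<m. cnj (c i) * A i m) * s" by (simp only: t)
      also have "\<dots> = (\<Sum>i<m. \<Sum>j<m. (cnj (c i) * A i m) * (A m j * c j))"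
        unfolding s_def by (rule sum_product)
      finally show ?thesis .
    qed
    have "(\<Sum>i<m. \<Sum>j<m. cnj (c i) * A' i j * c j) =
      (\<Sum>i<m. \<Sum>j<m. cnj (c i) * A i j * c j - (cnj (c i) * A i m) * (A m j * c j) / A m m)"
      by (intro sum.cong refl) (simp add: A'_def uu algebra_simps)
    also have "\<dots> = (\<Sum>i<m. \<Sum>j<m. cnj (c i) * A i j * c j) - cnj s * s / A m m"
      unfolding ss by (simp add: sum_subtractf sum_divide_distrib)
    also have "\<dots> = (\<Sum>i<Suc m. \<Sum>j<Suc m. cnj (d i) * A i j * d j)"
      unfolding expand t s_def[symmetric] using a(1) by (simp add: d_def)
    finally show "(\<Sum>i<m. \<Sum>j<m. cnj (c i) * A' i j * c j) \<in> \<real>\<^sub>\<ge>\<^sub>0"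
      using Suc.prems(1)[unfolded psd_def, rule_format, of d] by simp
  qed
  have psdB: "psd m B"
    unfolding psd_def
  proof
    fix c :: "nat \<Rightarrow> complex"
    have "(\<Sum>i<Suc m. \<Sum>j<Suc m. cnj (if i < m then c i else 0) * B i j * (if j < m then c j else 0)) \<in> \<real>\<^sub>\<ge>\<^sub>0"
      by (rule Suc.prems(2)[unfolded psd_def, rule_format])
    then show "(\<Sum>i<m. \<Sum>j<m. cnj (c i) * B i j * c j) \<in> \<real>\<^sub>\<ge>\<^sub>0" by simp
  qed
  \<comment> \<open>The rank-one part of \<open>A\<close> contributes the quadratic form of
    \<open>B\<close> at the vector \<open>cnj (u i)\<close>.\<close>
  have "(\<Sum>i<Suc m. \<Sum>j<Suc m. A i j * B i j) =
    (\<Sum>i<Suc m. \<Sum>j<Suc m. A' i j * B i j) + (\<Sum>i<Suc m. \<Sum>j<Suc m. cnj (cnj (u i)) * B i j * cnj (u j))"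
    unfolding sum.distrib[symmetric] by (intro sum.cong refl) (simp add: A'_def algebra_simps)
  also have "(\<Sum>i<Suc m. \<Sum>j<Suc m. A' i j * B i j) = (\<Sum>i<m. \<Sum>j<m. A' i j * B i j)"
    using zero by simp
  finally show ?case
    using Suc.IH[OF psdA' psdB] Suc.prems(2)[unfolded psd_def, rule_format, of "\<lambda>i. cnj (u i)"]
    by (simp add: nonneg_Reals_add_I)
qed simp

lemma psd_op_1D: "psd_op J 1 A \<Longrightarrow> v \<in> ell2 J \<Longrightarrow> ip (A 0 0 v) v \<in> \<real>\<^sub>\<ge>\<^sub>0"
  unfolding psd_op_def by (drule spec[of _ "\<lambda>_. v"]) simp

lemma ip_sum_right:
  assumes "\<And>k. k \<in> A \<Longrightarrow> v k \<in> ell2 J" "w \<in> ell2 J"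
  shows "ip w (\<lambda>i. \<Sum>k\<in>A. v k i) = (\<Sum>k\<in>A. ip w (v k))"
  unfolding ip_cnj[of w] using ip_sum_left[of A v J w] assms by simp

lemma ip_scale_right: "ip w (\<lambda>i. c * v i) = cnj c * ip w v"
  unfolding ip_cnj[of w] ip_scale_left by simp

text \<open>Testing the matrix with coefficients \<open>c\<close> evaluates the positive form of
  \<open>T\<close> at one vector, the combination of the \<open>v j\<close> with these
  coefficients.\<close>

lemma psd_positive_op:
  assumes "bounded_op J T" "\<forall>v\<in>ell2 J. ip (T v) v \<in> \<real>\<^sub>\<ge>\<^sub>0" "\<And>i. i < m \<Longrightarrow> v i \<in> ell2 J"
  shows "psd m (\<lambda>i j. ip (T (v j)) (v i))"
  unfolding psd_def
proof
  fix c :: "nat \<Rightarrow> complex"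
  define w where "w = (\<lambda>k. \<Sum>j<m. c j * v j k)"
  have cv: "(\<lambda>k. c j * v j k) \<in> ell2 J" if "j < m" for j using that assms(3) l2norm_scale(1) by blast
  have w: "w \<in> ell2 J" unfolding w_def by (rule ell2_sum) (use cv in auto)
  have "T w = (\<lambda>i. \<Sum>j<m. T (\<lambda>k. c j * v j k) i)"
    unfolding w_def by (rule bounded_op_sum[OF assms(1)]) (use cv in auto)
  also have "\<dots> = (\<lambda>i. \<Sum>j<m. c j * T (v j) i)"
    using bounded_opD(3)[OF assms(1,3)] by simp
  finally have "ip (T w) w = ip (\<lambda>i. \<Sum>j<m. c j * T (v j) i) w" by simp
  also have "\<dots> = (\<Sum>j<m. ip (\<lambda>i. c j * T (v j) i) w)"
    by (rule ip_sum_left[OF _ w]) (use assms(3) bounded_opD(1)[OF assms(1)] l2norm_scale(1) in blast)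
  also have "\<dots> = (\<Sum>j<m. \<Sum>i<m. c j * (cnj (c i) * ip (T (v j)) (v i)))"
  proof (intro sum.cong refl)
    fix j assume "j \<in> {..<m}"
    hence "T (v j) \<in> ell2 J" using bounded_opD(1)[OF assms(1)] assms(3) by simp
    hence "ip (T (v j)) w = (\<Sum>i<m. ip (T (v j)) (\<lambda>k. c i * v i k))"
      unfolding w_def by (intro ip_sum_right) (use cv in auto)
    thus "ip (\<lambda>i. c j * T (v j) i) w = (\<Sum>i<m. c j * (cnj (c i) * ip (T (v j)) (v i)))"
      by (simp add: ip_scale_left ip_scale_right sum_distrib_left)
  qed
  also have "\<dots> = (\<Sum>i<m. \<Sum>j<m. cnj (c i) * ip (T (v j)) (v i) * c j)"
    by (subst sum.swap) (simp add: mult_ac)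
  finally show "(\<Sum>i<m. \<Sum>j<m. cnj (c i) * ip (T (v j)) (v i) * c j) \<in> \<real>\<^sub>\<ge>\<^sub>0"
    using assms(2) w by metis
qed

section \<open>The Cantor space and its measure\<close>

lemma Omega_PiE: "Omega d = (\<Pi>\<^sub>E i\<in>UNIV. {1..d i})"
  by (auto simp: Omega_def PiE_def Pi_def)

lemma compact_Omega: "compact (Omega d)"
proof -
  have "compactin (product_topology (\<lambda>i. euclidean :: nat topology) (UNIV :: nat set)) (\<Pi>\<^sub>E i\<in>UNIV. {1..d i})"
    unfolding compactin_PiE by (auto intro: finite_imp_compact)
  thus ?thesis unfolding euclidean_product_topology Omega_PiE by simp
qed

lemma Omega_nonempty: "inductive_family d \<Longrightarrow> (\<lambda>_. 1) \<in> Omega d"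
  by (simp add: Omega_def inductive_family_def)

lemma finite_level [simp, intro]: "finite (level d n)"
  unfolding level_def by (intro finite_PiE) auto

lemma card_level: "card (level d n) = (\<Prod>i<n. d i)"
  unfolding level_def by (simp add: card_PiE)

lemma card_level_pos: "inductive_family d \<Longrightarrow> 0 < card (level d n)"
  unfolding card_level inductive_family_def by (auto intro!: prod_pos simp: Suc_le_eq)

lemma trunc_in_level: "\<omega> \<in> Omega d \<Longrightarrow> trunc n \<omega> \<in> level d n"
  by (auto simp: trunc_def Omega_def level_def)

lemma trunc_eq_iff: "trunc n \<omega> = trunc n \<omega>' \<longleftrightarrow> (\<forall>i<n. \<omega> i = \<omega>' i)"
  by (auto simp: trunc_def restrict_def fun_eq_iff)

lemma open_trunc_class: "open {\<omega>'. trunc n \<omega>' = trunc n \<omega>}"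
proof -
  have "open ((\<lambda>\<omega>'. \<omega>' i) -` {\<omega> i} :: (nat \<Rightarrow> nat) set)" for i
    by (rule open_vimage) (auto intro: continuous_on_subset[OF continuous_on_product_coordinates] simp: discrete_topology_class.open_discrete)
  hence "open (\<Inter>i\<in>{..<n}. (\<lambda>\<omega>'. \<omega>' i) -` {\<omega> i} :: (nat \<Rightarrow> nat) set)"
    by (intro open_INT) auto
  moreover have "(\<Inter>i\<in>{..<n}. (\<lambda>\<omega>'. \<omega>' i) -` {\<omega> i}) = {\<omega>'. trunc n \<omega>' = trunc n \<omega>}"
    by (auto simp: trunc_eq_iff)
  ultimately show ?thesis by simp
qed

text \<open>A basic open set of the product topology restricts only finitely many coordinates, and
  any \<open>n\<close> beyond them works.\<close>

lemma trunc_nbhd: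
  assumes "open U" "\<omega> \<in> U"
  obtains n where "\<And>\<omega>'. trunc n \<omega>' = trunc n \<omega> \<Longrightarrow> \<omega>' \<in> U"
proof -
  obtain X where X: "\<omega> \<in> Pi\<^sub>E UNIV X" "\<And>i. open (X i)" "finite {i. X i \<noteq> UNIV}" "Pi\<^sub>E UNIV X \<subseteq> U"
    using product_topology_open_contains_basis[of "\<lambda>_. euclidean" UNIV U \<omega>] assms
    unfolding euclidean_product_topology by (auto simp: open_openin[symmetric])
  obtain n where n: "{i. X i \<noteq> UNIV} \<subseteq> {..<n}"
    using finite_nat_iff_bounded X(3) by blast
  show ?thesis
  proof (rule that[of n])
    fix \<omega>' :: "nat \<Rightarrow> nat" assume "trunc n \<omega>' = trunc n \<omega>"
    have "\<omega>' i \<in> X i" for i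
    proof (cases "i < n")
      case True
      then have "\<omega>' i = \<omega> i" using \<open>trunc n \<omega>' = trunc n \<omega>\<close> by (simp add: trunc_eq_iff)
      then show ?thesis using PiE_mem[OF X(1), of i] by simp
    next
      case False
      then have "i \<notin> {i. X i \<noteq> UNIV}" using n by auto
      then show ?thesis by simp
    qed
    thus "\<omega>' \<in> U" using X(4) by (auto simp: PiE_def Pi_def)
  qed
qed

lemma locally_constant_continuous_on:
  assumes "\<And>x. x \<in> K \<Longrightarrow> \<exists>A. open A \<and> x \<in> A \<and> (\<forall>y\<in>K \<inter> A. f y = f x)"
  shows "continuous_on K f"
  unfolding continuous_on_topological
proof (intro ballI allI impI)
  fix x B assume x: "x \<in> K" "open B" "f x \<in> B"
  obtain A where "open A" "x \<in> A" "\<forall>y\<in>K \<inter> A. f y = f x" using assms[OF x(1)] by blast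
  moreover from this have "f y \<in> B" if "y \<in> K" "y \<in> A" for y using x(3) that by (metis IntI)
  ultimately show "\<exists>A. open A \<and> x \<in> A \<and> (\<forall>y\<in>K. y \<in> A \<longrightarrow> f y \<in> B)" by blast
qed

text \<open>
  The functions \<open>chi d n a\<close> extend the indicators of the cylinders to all sequences in such a way
  that they add up to 1 everywhere, not only on \<open>Omega d\<close>.
\<close>

definition clamp :: "(nat \<Rightarrow> nat) \<Rightarrow> nat \<Rightarrow> (nat \<Rightarrow> nat) \<Rightarrow> nat \<Rightarrow> nat" where
  "clamp d n \<omega> = (\<lambda>i\<in>{..<n}. if \<omega> i \<in> {1..d i} then \<omega> i else 1)"

definition chi :: "(nat \<Rightarrow> nat) \<Rightarrow> nat \<Rightarrow> (nat \<Rightarrow> nat) \<Rightarrow> (nat \<Rightarrow> nat) \<Rightarrow> complex" where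
  "chi d n a \<omega> = (if clamp d n \<omega> = a then 1 else 0)"

lemma clamp_in_level: "inductive_family d \<Longrightarrow> clamp d n \<omega> \<in> level d n"
  by (auto simp: clamp_def level_def inductive_family_def)

lemma clamp_Omega: "\<omega> \<in> Omega d \<Longrightarrow> clamp d n \<omega> = trunc n \<omega>"
  by (auto simp: clamp_def trunc_def Omega_def fun_eq_iff)

lemma clamp_cong: "trunc n \<omega> = trunc n \<omega>' \<Longrightarrow> clamp d n \<omega> = clamp d n \<omega>'"
  unfolding trunc_eq_iff clamp_def by (intro ext) simp

lemma chi_Omega: "\<omega> \<in> Omega d \<Longrightarrow> chi d n a \<omega> = (if trunc n \<omega> = a then 1 else 0)"
  by (simp add: chi_def clamp_Omega)

lemma chi_Omega_cyl: "\<omega> \<in> Omega d \<Longrightarrow> chi d n a \<omega> = indicator (cyl d n a) \<omega>"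
  by (simp add: chi_Omega cyl_def indicator_def)

lemma sum_chi: "inductive_family d \<Longrightarrow> (\<Sum>a\<in>level d n. chi d n a \<omega>) = 1"
  using clamp_in_level[of d n \<omega>] by (simp add: chi_def)

lemma chi_Cfun: "chi d n a \<in> Cfun K"
  unfolding Cfun_def
proof (clarsimp, rule locally_constant_continuous_on)
  fix \<omega>
  show "\<exists>A. open A \<and> \<omega> \<in> A \<and> (\<forall>y\<in>K \<inter> A. chi d n a y = chi d n a \<omega>)"
    by (rule exI[of _ "{\<omega>'. trunc n \<omega>' = trunc n \<omega>}"])
       (auto simp: open_trunc_class chi_def dest: clamp_cong[of n _ \<omega> d])
qed

lemma Cfun_const [simp]: "(\<lambda>_. c) \<in> Cfun K"
  by (simp add: Cfun_def)

lemma Cfun_tens: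
  assumes "f \<in> Cfun A" "g \<in> Cfun B"
  shows "tens f g \<in> Cfun (A \<times> B)"
  using assms unfolding Cfun_def tens_def
  by (auto simp: case_prod_unfold intro!: continuous_intros
      intro: continuous_on_compose2[of A f] continuous_on_compose2[of B g])

lemma Cfun_add: "f \<in> Cfun A \<Longrightarrow> g \<in> Cfun A \<Longrightarrow> (\<lambda>a. f a + g a) \<in> Cfun A"
  and Cfun_scale: "f \<in> Cfun A \<Longrightarrow> (\<lambda>a. c * f a) \<in> Cfun A"
  unfolding Cfun_def by (auto intro!: continuous_intros)

lemma Cfun_sum: "(\<And>u. u \<in> U \<Longrightarrow> f u \<in> Cfun A) \<Longrightarrow> (\<lambda>a. \<Sum>u\<in>U. f u a) \<in> Cfun A"
  unfolding Cfun_def by (auto intro!: continuous_intros)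

lemma Cfun_bounded:
  assumes "compact K" "f \<in> Cfun K"
  obtains C where "\<And>x. x \<in> K \<Longrightarrow> cmod (f x) \<le> C"
proof -
  have "bounded (f ` K)" using assms compact_continuous_image compact_imp_bounded unfolding Cfun_def by auto
  thus ?thesis using that unfolding bounded_iff by auto
qed

section \<open>The product measure and its cylinders\<close>

lemma product_prob_space_mu:
  assumes "inductive_family d"
  shows "product_prob_space (\<lambda>i. uniform_count_measure {1..d i})"
proof -
  have p: "prob_space (uniform_count_measure {1..d i})" for i
    using assms[unfolded inductive_family_def, rule_format, of i]
    by (intro prob_space_uniform_count_measure) simp_all
  interpret prob_space "uniform_count_measure {1..d i}" for i by (rule p)
  show ?thesis
    unfolding product_prob_space_def product_prob_space_axioms_def product_sigma_finite_def
    using p by (intro conjI allI prob_space_imp_sigma_finite) blast+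
qed

lemma space_mu [simp]: "space (mu d) = Omega d"
  by (simp add: mu_def space_PiM Omega_PiE space_uniform_count_measure)

lemma prob_space_mu: "inductive_family d \<Longrightarrow> prob_space (mu d)"
  unfolding mu_def inductive_family_def
  by (intro prob_space_PiM prob_space_uniform_count_measure) simp_all

lemma cyl_prod_emb:
  "x \<in> level d n \<Longrightarrow> cyl d n x =
    prod_emb UNIV (\<lambda>i. uniform_count_measure {1..d i}) {..<n} (\<Pi>\<^sub>E i\<in>{..<n}. {x i})"
proof -
  assume x: "x \<in> level d n"
  have "trunc n \<omega> = x \<longleftrightarrow> restrict \<omega> {..<n} \<in> (\<Pi>\<^sub>E i\<in>{..<n}. {x i})" for \<omega>
    using x PiE_singleton[of x "{..<n}"] unfolding level_def trunc_def by (simp add: PiE_def)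
  thus ?thesis unfolding cyl_def prod_emb_def Omega_PiE by (auto simp: space_uniform_count_measure)
qed

lemma level_mem: "x \<in> level d n \<Longrightarrow> i < n \<Longrightarrow> x i \<in> {1..d i}"
  using PiE_mem[of x "{..<n}" "\<lambda>i. {1..d i}" i] by (simp add: level_def)

lemma sets_cyl:
  assumes "x \<in> level d n"
  shows "cyl d n x \<in> sets (mu d)"
  unfolding cyl_prod_emb[OF assms] mu_def
  by (intro sets_PiM_I) (use level_mem[OF assms] in simp_all)

lemma measure_cyl:
  assumes "inductive_family d" "x \<in> level d n"
  shows "measure (mu d) (cyl d n x) = 1 / card (level d n)"
proof -
  interpret product_prob_space "\<lambda>i. uniform_count_measure {1..d i}" UNIV
    by (rule product_prob_space_mu[OF assms(1)])
  note x = level_mem[OF assms(2)]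
  have "measure (mu d) (cyl d n x) = (\<Prod>i<n. measure (uniform_count_measure {1..d i}) {x i})"
    unfolding cyl_prod_emb[OF assms(2)] mu_def by (rule measure_PiM_emb) (use x in simp_all)
  also have "\<dots> = (\<Prod>i<n. 1 / real (d i))"
    by (intro prod.cong refl) (use x in \<open>simp add: measure_uniform_count_measure\<close>)
  also have "\<dots> = 1 / card (level d n)" by (simp add: card_level prod_dividef)
  finally show ?thesis .
qed

text \<open>Turns every function of the first \<open>n\<close> coordinates into a finite combination
  of cylinder functions, which settles its measurability and its integrals.\<close>

lemma cyl_eq_chi: "\<omega> \<in> Omega d \<Longrightarrow>
    f (trunc n \<omega>) = (\<Sum>x\<in>level d n. f x * chi d n x \<omega>)"
  for f :: "_ \<Rightarrow> complex"
proof -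
  assume \<omega>: "\<omega> \<in> Omega d"
  have "(\<Sum>x\<in>level d n. f x * chi d n x \<omega>) = (\<Sum>x\<in>level d n. if trunc n \<omega> = x then f x else 0)"
    by (intro sum.cong) (auto simp: chi_Omega[OF \<omega>])
  then show ?thesis using trunc_in_level[OF \<omega>, of n] by simp
qed

text \<open>Reconciles two \<sigma>-algebras: \<open>mu d\<close> carries the product of the
  discrete ones, while continuous functions are measurable for the Borel sets of the product
  topology.\<close>

lemma id_measurable_mu: "(\<lambda>\<omega>. \<omega>) \<in> mu d \<rightarrow>\<^sub>M restrict_space borel (Omega d)"
proof (rule measurable_restrict_space2)
  show "(\<lambda>\<omega>. \<omega>) \<in> space (mu d) \<rightarrow> Omega d" by simp
  have "(\<lambda>\<omega>. \<omega> i) \<in> mu d \<rightarrow>\<^sub>M (borel :: nat measure)" for i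
  proof -
    have "(\<lambda>\<omega>. \<omega> i) \<in> mu d \<rightarrow>\<^sub>M uniform_count_measure {1..d i}"
      unfolding mu_def by (rule measurable_component_singleton) simp
    moreover have "(\<lambda>k. k) \<in> uniform_count_measure {1..d i} \<rightarrow>\<^sub>M (borel :: nat measure)"
      by (simp add: measurable_def)
    ultimately show ?thesis by (rule measurable_compose)
  qed
  thus "(\<lambda>\<omega>. \<omega>) \<in> mu d \<rightarrow>\<^sub>M borel"
    by (intro measurable_coordinatewise_then_product)
qed

lemma id_measurable_mu_pair:
  "(\<lambda>z. z) \<in> mu d \<Otimes>\<^sub>M mu d' \<rightarrow>\<^sub>M restrict_space borel (Omega d \<times> Omega d')"
proof (rule measurable_restrict_space2)
  show "(\<lambda>z. z) \<in> space (mu d \<Otimes>\<^sub>M mu d') \<rightarrow> Omega d \<times> Omega d'" by (simp add: space_pair_measure)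
  have 1: "(\<lambda>\<omega>. \<omega>) \<in> mu d \<rightarrow>\<^sub>M borel" for d
    using id_measurable_mu[of d] by (simp add: measurable_restrict_space2_iff)
  have "(\<lambda>z. (fst z, snd z)) \<in> mu d \<Otimes>\<^sub>M mu d' \<rightarrow>\<^sub>M borel \<Otimes>\<^sub>M borel"
    by (intro measurable_Pair measurable_compose[OF measurable_fst 1] measurable_compose[OF measurable_snd 1])
  thus "(\<lambda>z. z) \<in> mu d \<Otimes>\<^sub>M mu d' \<rightarrow>\<^sub>M borel" by (simp add: borel_prod)
qed

lemma Cfun_measurable: "f \<in> Cfun (Omega d) \<Longrightarrow> f \<in> borel_measurable (mu d)"
  using measurable_compose[OF id_measurable_mu borel_measurable_continuous_on_restrict]
  by (auto simp: Cfun_def)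

lemma Cfun_measurable_pair:
  "f \<in> Cfun (Omega d \<times> Omega d') \<Longrightarrow> f \<in> borel_measurable (mu d \<Otimes>\<^sub>M mu d')"
  using measurable_compose[OF id_measurable_mu_pair borel_measurable_continuous_on_restrict]
  by (auto simp: Cfun_def)

lemma chi_measurable [measurable]: "chi d n a \<in> borel_measurable (mu d)"
  by (rule Cfun_measurable[OF chi_Cfun])

lemma prob_space_mu_pair:
  assumes "inductive_family d" "inductive_family d'"
  shows "prob_space (mu d \<Otimes>\<^sub>M mu d')"
proof -
  interpret A: prob_space "mu d" by (rule prob_space_mu[OF assms(1)])
  interpret B: prob_space "mu d'" by (rule prob_space_mu[OF assms(2)])
  interpret pair_prob_space "mu d" "mu d'" ..
  show ?thesis by unfold_locales
qed

lemma integrable_Cfun: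
  assumes "inductive_family d" "f \<in> Cfun (Omega d)"
  shows "integrable (mu d) f"
proof -
  interpret prob_space "mu d" by (rule prob_space_mu[OF assms(1)])
  obtain C where "\<And>x. x \<in> Omega d \<Longrightarrow> cmod (f x) \<le> C"
    using Cfun_bounded[OF compact_Omega assms(2)] by blast
  thus ?thesis by (intro integrable_const_bound[of _ C] Cfun_measurable[OF assms(2)]) auto
qed

lemma integrable_Cfun_pair:
  assumes "inductive_family d" "inductive_family d'" "f \<in> Cfun (Omega d \<times> Omega d')"
  shows "integrable (mu d \<Otimes>\<^sub>M mu d') f"
proof -
  interpret prob_space "mu d \<Otimes>\<^sub>M mu d'" by (rule prob_space_mu_pair[OF assms(1,2)])
  obtain C where "\<And>x. x \<in> Omega d \<times> Omega d' \<Longrightarrow> cmod (f x) \<le> C"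
    using Cfun_bounded[OF compact_Times[OF compact_Omega compact_Omega] assms(3)] by blast
  thus ?thesis
    by (intro integrable_const_bound[of _ C] Cfun_measurable_pair[OF assms(3)]) (auto simp: space_pair_measure)
qed

lemma integral_chi:
  assumes "inductive_family d" "a \<in> level d n"
  shows "(LINT \<omega>|mu d. chi d n a \<omega>) = 1 / of_nat (card (level d n))"
proof -
  interpret prob_space "mu d" by (rule prob_space_mu[OF assms(1)])
  have "(LINT \<omega>|mu d. chi d n a \<omega>) = (LINT \<omega>|mu d. complex_of_real (indicator (cyl d n a) \<omega>))"
    by (intro Bochner_Integration.integral_cong refl) (simp add: chi_Omega_cyl indicator_def)
  also have "\<dots> = of_real (measure (mu d) (cyl d n a))"
    unfolding integral_complex_of_real using sets.sets_into_space[OF sets_cyl[OF assms(2)]]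
    by (simp add: Int_absorb2)
  finally show ?thesis unfolding measure_cyl[OF assms] by simp
qed

lemma integral_chi_pair:
  assumes "inductive_family d" "a \<in> level d n" "inductive_family d'" "b \<in> level d' n"
  shows "(LINT z|(mu d \<Otimes>\<^sub>M mu d'). tens (chi d n a) (chi d' n b) z) =
    1 / (of_nat (card (level d n)) * of_nat (card (level d' n)))"
proof -
  interpret A: prob_space "mu d" by (rule prob_space_mu[OF assms(1)])
  interpret B: prob_space "mu d'" by (rule prob_space_mu[OF assms(3)])
  interpret pair_sigma_finite "mu d" "mu d'" ..
  have "integrable (mu d \<Otimes>\<^sub>M mu d') (tens (chi d n a) (chi d' n b))"
    by (intro integrable_Cfun_pair assms Cfun_tens chi_Cfun)
  from integral_fst'[OF this] show ?thesis
    by (simp add: tens_def integral_chi[OF assms(1,2)] integral_chi[OF assms(3,4)] mult.commute)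
qed

section \<open>Positive maps into essentially bounded functions\<close>

lemma ucp_LinfD:
  assumes "ucp_Linf K M \<Phi>"
  shows "f \<in> Cfun K \<Longrightarrow> \<Phi> f \<in> Linf M"
    and "f \<in> Cfun K \<Longrightarrow> g \<in> Cfun K \<Longrightarrow> AE x in M. \<Phi> (\<lambda>a. f a + g a) x = \<Phi> f x + \<Phi> g x"
    and "f \<in> Cfun K \<Longrightarrow> AE x in M. \<Phi> (\<lambda>a. c * f a) x = c * \<Phi> f x"
    and "AE x in M. \<Phi> (\<lambda>_. 1) x = 1"
  using assms unfolding ucp_Linf_def by blast+

lemma ucp_measurable: "ucp_Linf K M \<Phi> \<Longrightarrow> f \<in> Cfun K \<Longrightarrow> \<Phi> f \<in> borel_measurable M"
  using ucp_LinfD(1) by (auto simp: Linf_def)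

lemma ucp_positive:
  assumes "ucp_Linf K M \<Phi>" "f \<in> Cfun K" "\<And>a. a \<in> K \<Longrightarrow> f a \<in> \<real>\<^sub>\<ge>\<^sub>0"
  shows "AE x in M. \<Phi> f x \<in> \<real>\<^sub>\<ge>\<^sub>0"
proof -
  have "AE x in M. psd 1 (\<lambda>i j. \<Phi> ((\<lambda>i j. f) i j) x)"
    using assms(1) unfolding ucp_Linf_def
    by (elim conjE) (erule allE[of _ 1], erule allE[of _ "\<lambda>i j. f"], use assms(2,3) in \<open>auto simp: psd_1_iff[simplified]\<close>)
  thus ?thesis by (simp add: psd_1_iff[simplified])
qed

lemma ucp_sum:
  assumes "ucp_Linf K M \<Phi>" "finite U" "\<And>u. u \<in> U \<Longrightarrow> f u \<in> Cfun K"
  shows "AE x in M. \<Phi> (\<lambda>a. \<Sum>u\<in>U. c u * f u a) x = (\<Sum>u\<in>U. c u * \<Phi> (f u) x)"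
  using assms(2,3)
proof (induction U rule: finite_induct)
  case empty
  then show ?case using ucp_LinfD(3)[OF assms(1) Cfun_const, of 0 0] by simp
next
  case (insert u U)
  have "AE x in M. \<Phi> (\<lambda>a. c u * f u a + (\<Sum>u\<in>U. c u * f u a)) x =
      \<Phi> (\<lambda>a. c u * f u a) x + \<Phi> (\<lambda>a. \<Sum>u\<in>U. c u * f u a) x"
    by (rule ucp_LinfD(2)[OF assms(1)]) (use insert in \<open>auto intro!: Cfun_sum Cfun_scale\<close>)
  moreover have "AE x in M. \<Phi> (\<lambda>a. c u * f u a) x = c u * \<Phi> (f u) x"
    by (rule ucp_LinfD(3)[OF assms(1)]) (use insert in auto)
  moreover have "AE x in M. \<Phi> (\<lambda>a. \<Sum>u\<in>U. c u * f u a) x = (\<Sum>u\<in>U. c u * \<Phi> (f u) x)"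
    by (rule insert.IH) (use insert in auto)
  ultimately show ?case using insert by (auto elim!: eventually_elim2)
qed

lemma ucp_diff:
  assumes "ucp_Linf K M \<Phi>" "f \<in> Cfun K" "g \<in> Cfun K"
  shows "AE x in M. \<Phi> (\<lambda>a. f a - g a) x = \<Phi> f x - \<Phi> g x"
proof -
  have "AE x in M. \<Phi> (\<lambda>a. f a + (-1) * g a) x = \<Phi> f x + \<Phi> (\<lambda>a. (-1) * g a) x"
    by (rule ucp_LinfD(2)[OF assms(1,2)]) (rule Cfun_scale[OF assms(3)])
  moreover have "AE x in M. \<Phi> (\<lambda>a. (-1) * g a) x = (-1) * \<Phi> g x"
    by (rule ucp_LinfD(3)[OF assms(1,3)])
  ultimately show ?thesis by (auto elim!: eventually_elim2)
qed

text \<open>Positivity squeezes the images of the real and the imaginary part between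
  \<open>- e\<close> and \<open>e\<close> separately, whence the factor 2. It is harmless, as the
  bound is applied with \<open>e = 0\<close> and with \<open>e\<close> tending to 0.\<close>

lemma ucp_bound:
  assumes "ucp_Linf K M \<Phi>" "f \<in> Cfun K" "\<And>a. a \<in> K \<Longrightarrow> cmod (f a) \<le> e"
  shows "AE x in M. cmod (\<Phi> f x) \<le> 2 * e"
proof -
  have c: "continuous_on K f" using assms(2) by (simp add: Cfun_def)
  have const: "AE x in M. \<Phi> (\<lambda>_. of_real e) x = of_real e"
  proof -
    have "AE x in M. \<Phi> (\<lambda>_. of_real e * 1) x = of_real e * \<Phi> (\<lambda>_. 1) x"
      by (rule ucp_LinfD(3)[OF assms(1)]) simp
    with ucp_LinfD(4)[OF assms(1)] show ?thesis by (auto elim!: eventually_elim2)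
  qed
  have real: "AE x in M. \<Phi> (\<lambda>a. of_real (g a)) x \<in> \<real> \<and> cmod (\<Phi> (\<lambda>a. of_real (g a)) x) \<le> e"
    if g: "continuous_on K g" "\<And>a. a \<in> K \<Longrightarrow> \<bar>g a\<bar> \<le> e" for g :: "_ \<Rightarrow> real"
  proof -
    have G: "(\<lambda>a. complex_of_real (g a)) \<in> Cfun K" using g(1) by (auto simp: Cfun_def intro!: continuous_intros)
    have b: "- e \<le> g a" "g a \<le> e" if "a \<in> K" for a using g(2)[OF that] by auto
    have 1: "AE x in M. \<Phi> (\<lambda>a. of_real e + of_real (g a)) x \<in> \<real>\<^sub>\<ge>\<^sub>0"
    proof (rule ucp_positive[OF assms(1) Cfun_add[OF Cfun_const G]])
      fix a assume "a \<in> K"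
      then show "complex_of_real e + of_real (g a) \<in> \<real>\<^sub>\<ge>\<^sub>0"
        using b(1)[of a] by (simp add: complex_nonneg_Reals_iff)
    qed
    have 2: "AE x in M. \<Phi> (\<lambda>a. of_real e - of_real (g a)) x \<in> \<real>\<^sub>\<ge>\<^sub>0"
      by (rule ucp_positive[OF assms(1)])
         (use b G in \<open>auto simp: complex_nonneg_Reals_iff Cfun_def intro!: continuous_intros\<close>)
    have 3: "AE x in M. \<Phi> (\<lambda>a. of_real e + of_real (g a)) x = \<Phi> (\<lambda>_. of_real e) x + \<Phi> (\<lambda>a. of_real (g a)) x"
      by (rule ucp_LinfD(2)[OF assms(1) Cfun_const G])
    have 4: "AE x in M. \<Phi> (\<lambda>a. of_real e - of_real (g a)) x = \<Phi> (\<lambda>_. of_real e) x - \<Phi> (\<lambda>a. of_real (g a)) x"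
      by (rule ucp_diff[OF assms(1) Cfun_const G])
    from 1 2 3 4 const show ?thesis
    proof eventually_elim
      case (elim x)
      define t where "t = \<Phi> (\<lambda>a. complex_of_real (g a)) x"
      have "of_real e + t \<in> \<real>\<^sub>\<ge>\<^sub>0" "of_real e - t \<in> \<real>\<^sub>\<ge>\<^sub>0" using elim by (simp_all add: t_def)
      hence "Im t = 0" "\<bar>Re t\<bar> \<le> e" by (auto simp: complex_nonneg_Reals_iff)
      thus ?case unfolding t_def[symmetric] by (auto simp: complex_is_Real_iff cmod_eq_Re)
    qed
  qed
  have re: "continuous_on K (\<lambda>a. Re (f a))" and im: "continuous_on K (\<lambda>a. Im (f a))"
    using c by (auto intro!: continuous_intros)
  have ri: "AE x in M. \<Phi> (\<lambda>a. of_real (Re (f a)) + \<i> * of_real (Im (f a))) x =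
      \<Phi> (\<lambda>a. of_real (Re (f a))) x + \<Phi> (\<lambda>a. \<i> * of_real (Im (f a))) x"
    by (rule ucp_LinfD(2)[OF assms(1)]) (use re im in \<open>auto simp: Cfun_def intro!: continuous_intros\<close>)
  have ii: "AE x in M. \<Phi> (\<lambda>a. \<i> * of_real (Im (f a))) x = \<i> * \<Phi> (\<lambda>a. of_real (Im (f a))) x"
    by (rule ucp_LinfD(3)[OF assms(1)]) (use im in \<open>auto simp: Cfun_def intro!: continuous_intros\<close>)
  have ff: "(\<lambda>a. of_real (Re (f a)) + \<i> * of_real (Im (f a))) = f"
    by (auto simp: fun_eq_iff complex_eq_iff)
  have "AE x in M. cmod (\<Phi> (\<lambda>a. of_real (Re (f a))) x) \<le> e"
    using real[OF re] assms(3) abs_Re_le_cmod order_trans by (smt (verit) eventually_mono)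
  moreover have "AE x in M. cmod (\<Phi> (\<lambda>a. of_real (Im (f a))) x) \<le> e"
    using real[OF im] assms(3) abs_Im_le_cmod order_trans by (smt (verit) eventually_mono)
  ultimately show ?thesis using ri[unfolded ff] ii
  proof eventually_elim
    case (elim x)
    have "cmod (\<Phi> f x) \<le> cmod (\<Phi> (\<lambda>a. of_real (Re (f a))) x) + cmod (\<i> * \<Phi> (\<lambda>a. of_real (Im (f a))) x)"
      using elim(3,4) norm_triangle_ineq by metis
    with elim(1,2) show ?case by (simp add: norm_mult)
  qed
qed

text \<open>The case \<open>e = 0\<close> of \<open>ucp_bound\<close>. It makes functions that
  differ off \<open>K\<close> interchangeable, such as \<open>chi2\<close> and the indicator of the
  corresponding cylinder.\<close>

lemma ucp_cong:
  assumes "ucp_Linf K M \<Phi>" "f \<in> Cfun K" "g \<in> Cfun K" "\<And>a. a \<in> K \<Longrightarrow> f a = g a"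
  shows "AE x in M. \<Phi> f x = \<Phi> g x"
proof -
  have "AE x in M. cmod (\<Phi> (\<lambda>a. f a - g a) x) \<le> 2 * 0"
    by (rule ucp_bound[OF assms(1)])
       (use assms in \<open>auto simp: Cfun_def intro!: continuous_intros\<close>)
  with ucp_diff[OF assms(1-3)] show ?thesis by eventually_elim simp
qed

section \<open>Disintegration over the clopen algebra\<close>

definition agree :: "nat \<Rightarrow> (nat \<Rightarrow> nat) \<times> (nat \<Rightarrow> nat) \<Rightarrow> (nat \<Rightarrow> nat) \<times> (nat \<Rightarrow> nat) \<Rightarrow> bool" where
  "agree n z z' \<longleftrightarrow> trunc n (fst z) = trunc n (fst z') \<and> trunc n (snd z) = trunc n (snd z')"

text \<open>Described by finitely many coordinates instead of topologically, which makes the algebra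
  laws, countability and the continuity of indicators easy to verify.\<close>

definition clopens :: "((nat \<Rightarrow> nat) \<times> (nat \<Rightarrow> nat)) set \<Rightarrow> ((nat \<Rightarrow> nat) \<times> (nat \<Rightarrow> nat)) set set" where
  "clopens K = {C. C \<subseteq> K \<and> (\<exists>n. \<forall>z\<in>K. \<forall>z'\<in>K. agree n z z' \<longrightarrow> (z \<in> C \<longleftrightarrow> z' \<in> C))}"

lemma agree_refl [simp]: "agree n z z"
  by (simp add: agree_def)

lemma agree_mono: "agree n z z' \<Longrightarrow> m \<le> n \<Longrightarrow> agree m z z'"
  by (auto simp: agree_def trunc_eq_iff)

lemma open_agree: "open {z'. agree n z z'}"
proof -
  have "{z'. agree n z z'} = {\<omega>. trunc n \<omega> = trunc n (fst z)} \<times> {\<omega>. trunc n \<omega> = trunc n (snd z)}"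
    by (auto simp: agree_def)
  thus ?thesis using open_Times[OF open_trunc_class open_trunc_class] by simp
qed

lemma agree_nbhd:
  assumes "open U" "z \<in> U"
  obtains n where "\<And>z'. agree n z z' \<Longrightarrow> z' \<in> U"
proof -
  obtain A B where AB: "open A" "open B" "z \<in> A \<times> B" "A \<times> B \<subseteq> U"
    using open_prod_elim[OF assms] by metis
  obtain m where m: "\<And>\<omega>'. trunc m \<omega>' = trunc m (fst z) \<Longrightarrow> \<omega>' \<in> A"
    using trunc_nbhd[OF AB(1), of "fst z"] AB(3) by (metis mem_Times_iff)
  obtain k where k: "\<And>\<omega>'. trunc k \<omega>' = trunc k (snd z) \<Longrightarrow> \<omega>' \<in> B"
    using trunc_nbhd[OF AB(2), of "snd z"] AB(3) by (metis mem_Times_iff)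
  show ?thesis
  proof (rule that[of "max m k"])
    fix z' assume a: "agree (max m k) z z'"
    have "fst z' \<in> A" using agree_mono[OF a, of m] m by (simp add: agree_def)
    moreover have "snd z' \<in> B" using agree_mono[OF a, of k] k by (simp add: agree_def)
    ultimately show "z' \<in> U" using AB(4) by (metis mem_Times_iff subsetD)
  qed
qed

lemma clopens_algebra: "algebra K (clopens K)"
  unfolding algebra_iff_Un
proof (intro conjI ballI)
  show "clopens K \<subseteq> Pow K" "{} \<in> clopens K" by (auto simp: clopens_def)
  show "K - a \<in> clopens K" if "a \<in> clopens K" for a
    using that by (auto simp: clopens_def)
  fix a b assume a: "a \<in> clopens K" and b: "b \<in> clopens K"
  obtain m where m: "\<And>z z'. z \<in> K \<Longrightarrow> z' \<in> K \<Longrightarrow> agree m z z' \<Longrightarrow> z \<in> a \<longleftrightarrow> z' \<in> a"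
    using a unfolding clopens_def by blast
  obtain k where k: "\<And>z z'. z \<in> K \<Longrightarrow> z' \<in> K \<Longrightarrow> agree k z z' \<Longrightarrow> z \<in> b \<longleftrightarrow> z' \<in> b"
    using b unfolding clopens_def by blast
  have "\<forall>z\<in>K. \<forall>z'\<in>K. agree (max m k) z z' \<longrightarrow> (z \<in> a \<union> b \<longleftrightarrow> z' \<in> a \<union> b)"
  proof (intro ballI impI)
    fix z z' assume z: "z \<in> K" "z' \<in> K" "agree (max m k) z z'"
    show "z \<in> a \<union> b \<longleftrightarrow> z' \<in> a \<union> b"
      using m[OF z(1,2) agree_mono[OF z(3)]] k[OF z(1,2) agree_mono[OF z(3)]] by simp
  qed
  thus "a \<union> b \<in> clopens K" using a b unfolding clopens_def by blast
qed

lemma clopens_open: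
  assumes "C \<in> clopens K"
  obtains U where "open U" "C = K \<inter> U"
proof -
  obtain n where n: "\<And>z z'. z \<in> K \<Longrightarrow> z' \<in> K \<Longrightarrow> agree n z z' \<Longrightarrow> z \<in> C \<longleftrightarrow> z' \<in> C"
    using assms unfolding clopens_def by blast
  have sub: "C \<subseteq> K" using assms by (simp add: clopens_def)
  have "C = K \<inter> (\<Union>z\<in>C. {z'. agree n z z'})"
  proof (intro equalityI subsetI)
    fix z' assume "z' \<in> K \<inter> (\<Union>z\<in>C. {z'. agree n z z'})"
    then obtain z where "z' \<in> K" "z \<in> C" "agree n z z'" by blast
    thus "z' \<in> C" using n[of z z'] sub by blast
  next
    fix z' assume "z' \<in> C"
    thus "z' \<in> K \<inter> (\<Union>z\<in>C. {z'. agree n z z'})" using sub agree_refl[of n z'] by blast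
  qed
  thus ?thesis using that[of "\<Union>z\<in>C. {z'. agree n z z'}"] open_agree by blast
qed

lemma sigma_sets_clopens: "sigma_sets K (clopens K) = sets (restrict_space borel K)"
proof (intro equalityI subsetI)
  fix A assume "A \<in> sigma_sets K (clopens K)"
  thus "A \<in> sets (restrict_space borel K)"
  proof (induction rule: sigma_sets.induct)
    case (Basic a)
    then obtain U where "open U" "a = K \<inter> U" using clopens_open by blast
    then show ?case by (auto simp: sets_restrict_space)
  next
    case (Compl a)
    then show ?case using sets.compl_sets[OF Compl.IH] by (simp add: space_restrict_space)
  qed auto
next
  have open_in: "K \<inter> U \<in> sigma_sets K (clopens K)" if U: "open U" for U
  proof -
    \<comment> \<open>The points whose whole level-\<open>n\<close> cylinder stays inside
      \<open>U\<close>. Each is a set of level \<open>n\<close>, and since cylinders form a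
      neighbourhood basis these countably many sets exhaust \<open>K \<inter> U\<close>.\<close>
    define D where "D n = {z\<in>K. \<forall>z'\<in>K. agree n z z' \<longrightarrow> z' \<in> U}" for n
    have D: "D n \<in> clopens K" for n
      unfolding clopens_def D_def by (auto simp: agree_def intro!: exI[of _ n])
    have "K \<inter> U = (\<Union>n. D n)"
    proof (intro equalityI subsetI)
      fix z assume "z \<in> K \<inter> U"
      then obtain n where "\<And>z'. agree n z z' \<Longrightarrow> z' \<in> U" using agree_nbhd[OF U, of z] by blast
      hence "z \<in> D n" using \<open>z \<in> K \<inter> U\<close> unfolding D_def by blast
      thus "z \<in> (\<Union>n. D n)" by blast
    next
      fix z assume "z \<in> (\<Union>n. D n)"
      thus "z \<in> K \<inter> U" unfolding D_def using agree_refl by blast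
    qed
    thus ?thesis using D by (auto intro: sigma_sets.Union sigma_sets.Basic)
  qed
  fix A assume "A \<in> sets (restrict_space borel K)"
  then obtain B where B: "B \<in> sets borel" "A = K \<inter> B" by (auto simp: sets_restrict_space)
  have "B \<in> sigma_sets UNIV {S. open S}" using B(1) by (simp add: borel_def)
  hence "K \<inter> B \<in> sigma_sets K (clopens K)"
  proof (induction rule: sigma_sets.induct)
    case (Compl a)
    have "K \<inter> (UNIV - a) = K - K \<inter> a" by auto
    then show ?case using sigma_sets.Compl[OF Compl.IH] by simp
  next
    case (Union a)
    have "K \<inter> \<Union>(range a) = (\<Union>i. K \<inter> a i)" by auto
    then show ?case using sigma_sets.Union[OF Union.IH] by simp
  qed (auto intro: open_in sigma_sets.Empty)
  thus "A \<in> sigma_sets K (clopens K)" using B(2) by simp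
qed

text \<open>A set decided at level \<open>n\<close> is determined by the pairs of truncations it
  contains, out of finitely many. Countability lets a.e. statements about single clopen sets be
  combined into one.\<close>

lemma countable_clopens: "countable (clopens (Omega d \<times> Omega d'))" (is "countable (clopens ?K)")
proof -
  define F where "F n S = {z\<in>?K. (trunc n (fst z), trunc n (snd z)) \<in> S}" for n S
  have "clopens ?K \<subseteq> (\<Union>n. F n ` Pow (level d n \<times> level d' n))"
  proof
    fix C assume C: "C \<in> clopens ?K"
    then obtain n where n: "\<And>z z'. z \<in> ?K \<Longrightarrow> z' \<in> ?K \<Longrightarrow> agree n z z' \<Longrightarrow> z \<in> C \<longleftrightarrow> z' \<in> C"
      unfolding clopens_def by blast
    have sub: "C \<subseteq> ?K" using C by (simp add: clopens_def)
    have "C = F n ((\<lambda>z. (trunc n (fst z), trunc n (snd z))) ` C)"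
    proof (intro equalityI subsetI)
      fix z assume "z \<in> F n ((\<lambda>z. (trunc n (fst z), trunc n (snd z))) ` C)"
      then obtain z' where "z \<in> ?K" "z' \<in> C" "agree n z' z" unfolding F_def agree_def by auto
      thus "z \<in> C" using n[of z' z] sub by blast
    qed (use sub in \<open>auto simp: F_def\<close>)
    moreover have "(\<lambda>z. (trunc n (fst z), trunc n (snd z))) ` C \<in> Pow (level d n \<times> level d' n)"
    proof (clarsimp)
      fix x y assume "(x, y) \<in> C"
      then have "x \<in> Omega d" "y \<in> Omega d'" using sub by auto
      then show "trunc n x \<in> level d n \<and> trunc n y \<in> level d' n" using trunc_in_level by blast
    qed
    ultimately show "C \<in> (\<Union>n. F n ` Pow (level d n \<times> level d' n))" by blast
  qed
  moreover have "countable (\<Union>n. F n ` Pow (level d n \<times> level d' n))"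
    by (rule countable_UN) (simp_all add: countable_finite)
  ultimately show ?thesis by (rule countable_subset)
qed

text \<open>By compactness, finite additivity on the clopen algebra already implies continuity at the empty set.\<close>

lemma clopens_extend:
  assumes K: "compact K"
    and pos: "\<And>C. C \<in> clopens K \<Longrightarrow> 0 \<le> m C"
    and add: "\<And>C D. C \<in> clopens K \<Longrightarrow> D \<in> clopens K \<Longrightarrow> C \<inter> D = {} \<Longrightarrow> m (C \<union> D) = m C + m D"
    and one: "m K = (1::real)"
  obtains P where "prob_space P" "sets P = sets (restrict_space borel K)"
    "\<And>C. C \<in> clopens K \<Longrightarrow> emeasure P C = ennreal (m C)"
proof -
  interpret algebra K "clopens K" by (rule clopens_algebra)
  define f where "f C = ennreal (m C)" for C
  have "m {} = 0" using add[of "{}" "{}"] by simp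
  hence posf: "positive (clopens K) f" by (simp add: positive_def f_def)
  have addf: "additive (clopens K) f"
    unfolding additive_def f_def using add pos by (simp add: ennreal_plus)
  have "\<exists>\<mu>. (\<forall>s\<in>clopens K. \<mu> s = f s) \<and> measure_space K (sigma_sets K (clopens K)) \<mu>"
  proof (rule caratheodory_empty_continuous[OF posf addf])
    fix A :: "nat \<Rightarrow> _" assume A: "range A \<subseteq> clopens K" "decseq A" "(\<Inter>i. A i) = {}"
    have "\<exists>U. open U \<and> K - A i = K \<inter> U" for i
    proof -
      have "K - A i \<in> clopens K" using A(1) by auto
      then show ?thesis using clopens_open by metis
    qed
    then obtain U where U: "\<And>i. open (U i)" "\<And>i. K - A i = K \<inter> U i" by metis
    \<comment> \<open>The complements of the \<open>A i\<close> form an open cover. A finite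
      subcover with largest index \<open>N\<close> forces \<open>A i\<close> to be empty from
      \<open>N\<close> on, so convergence to 0 is eventual equality.\<close>
    have "K \<subseteq> (\<Union>i. U i)" using A(3) U(2) by blast
    then obtain I where I: "finite I" "K \<subseteq> (\<Union>i\<in>I. U i)"
      using compactE_image[OF K, of UNIV U] U(1) by auto
    obtain N where N: "\<And>i. i \<in> I \<Longrightarrow> i \<le> N" using I(1) finite_nat_set_iff_bounded_le by auto
    have empty: "A i = {}" if "N \<le> i" for i
    proof -
      have "z \<notin> A i" for z
      proof
        assume z: "z \<in> A i"
        have zK: "z \<in> K" using z A(1) by (auto simp: clopens_def)
        then obtain j where "j \<in> I" "z \<in> U j" using I(2) by blast
        hence "z \<notin> A j" using U(2)[of j] zK by blast
        moreover have "A i \<subseteq> A j" using decseqD[OF A(2), of j i] N[OF \<open>j \<in> I\<close>] that by simp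
        ultimately show False using z by blast
      qed
      thus ?thesis by blast
    qed
    show "(\<lambda>i. f (A i)) \<longlonglongrightarrow> 0"
      by (rule tendsto_eventually) (auto simp: eventually_sequentially f_def empty \<open>m {} = 0\<close> intro!: exI[of _ N])
  qed (simp add: f_def)
  then obtain \<mu> where \<mu>: "\<forall>s\<in>clopens K. \<mu> s = f s" "measure_space K (sigma_sets K (clopens K)) \<mu>"
    by blast
  define P where "P = measure_of K (clopens K) \<mu>"
  have sub: "clopens K \<subseteq> Pow K" by (auto simp: clopens_def)
  have em: "emeasure P C = f C" if "C \<in> clopens K" for C
    using emeasure_measure_of[OF P_def sub, of C] \<mu> that
    by (auto simp: measure_space_def P_def sets_measure_of[OF sub])
  show ?thesis
  proof (rule that[of P])
    show "sets P = sets (restrict_space borel K)"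
      unfolding P_def sets_measure_of[OF sub] by (rule sigma_sets_clopens)
    show "prob_space P"
      by (rule prob_spaceI) (use em[of K] one in \<open>auto simp: P_def space_measure_of[OF sub] f_def\<close>)
    show "emeasure P C = ennreal (m C)" if "C \<in> clopens K" for C
      using em[OF that] by (simp add: f_def)
  qed
qed

section \<open>Cylinder functions of two variables and uniform approximation\<close>

lemma clopens_sets: "C \<in> clopens K \<Longrightarrow> C \<in> sets (restrict_space borel K)"
  unfolding sigma_sets_clopens[symmetric] by (rule sigma_sets.Basic)

lemma clopens_Cfun: "C \<in> clopens K \<Longrightarrow> (\<lambda>w. if w \<in> C then 1 else 0) \<in> Cfun K"
  unfolding Cfun_def mem_Collect_eq
proof (rule locally_constant_continuous_on)
  fix x assume C: "C \<in> clopens K" and x: "x \<in> K"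
  obtain n where n: "\<And>z z'. z \<in> K \<Longrightarrow> z' \<in> K \<Longrightarrow> agree n z z' \<Longrightarrow> z \<in> C \<longleftrightarrow> z' \<in> C"
    using C unfolding clopens_def by blast
  show "\<exists>A. open A \<and> x \<in> A \<and> (\<forall>y\<in>K \<inter> A. (if y \<in> C then 1 else 0) = (if x \<in> C then 1 else 0 :: complex))"
  proof (intro exI[of _ "{y. agree n x y}"] conjI ballI)
    fix y assume "y \<in> K \<inter> {y. agree n x y}"
    then have "x \<in> C \<longleftrightarrow> y \<in> C" using n[OF x] by blast
    then show "(if y \<in> C then 1 else 0) = (if x \<in> C then 1 else 0 :: complex)" by simp
  qed (simp_all add: open_agree)
qed

text \<open>Chooses a sample point in the cylinder of a word; 1 is an admissible letter in every
  coordinate.\<close>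

definition pad :: "nat \<Rightarrow> (nat \<Rightarrow> nat) \<Rightarrow> nat \<Rightarrow> nat" where
  "pad n a i = (if i < n then a i else 1)"

lemma pad_Omega: "inductive_family d \<Longrightarrow> a \<in> level d n \<Longrightarrow> pad n a \<in> Omega d"
  using level_mem[of a d n] by (simp add: pad_def Omega_def inductive_family_def)

lemma trunc_pad: "trunc n (pad n (trunc n \<omega>)) = trunc n \<omega>"
  by (simp add: trunc_eq_iff) (simp add: pad_def trunc_def)

definition chi2 :: "(nat \<Rightarrow> nat) \<Rightarrow> (nat \<Rightarrow> nat) \<Rightarrow> nat \<Rightarrow> (nat \<Rightarrow> nat) \<times> (nat \<Rightarrow> nat) \<Rightarrow>
    (nat \<Rightarrow> nat) \<times> (nat \<Rightarrow> nat) \<Rightarrow> complex" where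
  "chi2 d d' n u = tens (chi d n (fst u)) (chi d' n (snd u))"

lemma chi2_Cfun: "chi2 d d' n u \<in> Cfun (A \<times> B)"
  unfolding chi2_def by (intro Cfun_tens chi_Cfun)

lemma chi2_Omega: "z \<in> Omega d \<times> Omega d' \<Longrightarrow>
    chi2 d d' n u z = (if u = (trunc n (fst z), trunc n (snd z)) then 1 else 0)"
  by (cases u) (auto simp: chi2_def tens_def chi_Omega)

lemma sum_chi2:
  assumes "z \<in> Omega d \<times> Omega d'"
  shows "(\<Sum>u\<in>level d n \<times> level d' n. c u * chi2 d d' n u z) = c (trunc n (fst z), trunc n (snd z))"
proof -
  have "(\<Sum>u\<in>level d n \<times> level d' n. c u * chi2 d d' n u z) =
      (\<Sum>u\<in>level d n \<times> level d' n. if u = (trunc n (fst z), trunc n (snd z)) then c u else 0)"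
    by (intro sum.cong refl) (simp add: chi2_Omega[OF assms])
  also have "\<dots> = c (trunc n (fst z), trunc n (snd z))"
    using trunc_in_level[of "fst z" d n] trunc_in_level[of "snd z" d' n] assms
    by (subst sum.delta) (auto simp: mem_Times_iff)
  finally show ?thesis .
qed

text \<open>Uniform continuity with the level of agreement in place of a distance: each point has
  its own level, and compactness bounds the levels that occur.\<close>

lemma Cfun_uniform:
  assumes K: "compact K" and f: "f \<in> Cfun K" and e: "e > 0"
  obtains n where "\<And>z z'. z \<in> K \<Longrightarrow> z' \<in> K \<Longrightarrow> agree n z z' \<Longrightarrow> cmod (f z - f z') < e"
proof -
  have "\<exists>n. \<forall>z'\<in>K. agree n z z' \<longrightarrow> cmod (f z' - f z) < e / 2" if z: "z \<in> K" for z
  proof -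
    have "f z \<in> ball (f z) (e / 2)" using e by auto
    from f[unfolded Cfun_def mem_Collect_eq continuous_on_topological, rule_format, OF z open_ball this]
    obtain A where A: "open A" "z \<in> A" "\<forall>y\<in>K. y \<in> A \<longrightarrow> f y \<in> ball (f z) (e / 2)"
      by blast
    obtain n where "\<And>z'. agree n z z' \<Longrightarrow> z' \<in> A" using agree_nbhd[OF A(1,2)] by blast
    with A(3) show ?thesis by (intro exI[of _ n]) (auto simp: dist_norm norm_minus_commute)
  qed
  then obtain N where N: "\<And>z z'. z \<in> K \<Longrightarrow> z' \<in> K \<Longrightarrow> agree (N z) z z' \<Longrightarrow> cmod (f z' - f z) < e / 2"
    by metis
  obtain I where I: "I \<subseteq> K" "finite I" "K \<subseteq> (\<Union>z\<in>I. {z'. agree (N z) z z'})"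
  proof (rule compactE_image[OF K])
    show "open {z'. agree (N z) z z'}" for z by (rule open_agree)
    show "K \<subseteq> (\<Union>z\<in>K. {z'. agree (N z) z z'})" by auto
  qed
  obtain M where M: "\<And>z. z \<in> I \<Longrightarrow> N z \<le> M"
    using finite_nat_set_iff_bounded_le[of "N ` I"] I(2) by auto
  show ?thesis
  proof (rule that[of M])
    fix z z' assume z: "z \<in> K" "z' \<in> K" "agree M z z'"
    obtain y where y: "y \<in> I" "agree (N y) y z" using I(3) z(1) by blast
    \<comment> \<open>Agreement at a level is transitive, so \<open>z'\<close> falls into the same
      neighbourhood of \<open>y\<close> as \<open>z\<close> without shrinking anything.\<close>
    have "agree (N y) y z'" using y(2) agree_mono[OF z(3) M[OF y(1)]] by (simp add: agree_def)
    hence "cmod (f z' - f y) < e / 2" "cmod (f z - f y) < e / 2"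
      using N[OF _ z(2), of y] N[OF _ z(1), of y] y I(1) by blast+
    thus "cmod (f z - f z') < e"
      using norm_triangle_ineq4[of "f z - f y" "f z' - f y"] by simp
  qed
qed

lemma cylinder_clopens: "{z\<in>K. (trunc n (fst z), trunc n (snd z)) \<in> S} \<in> clopens K"
  unfolding clopens_def by (auto simp: agree_def intro!: exI[of _ n])

section \<open>Existence of the disintegration kernel\<close>

lemma Cfun_integrable_prob:
  assumes P: "prob_space P" "sets P = sets (restrict_space borel K)" and K: "compact K" and f: "f \<in> Cfun K"
  shows "integrable P f"
proof -
  interpret prob_space P by (rule P(1))
  have sp: "space P = K" using sets_eq_imp_space_eq[OF P(2)] by (simp add: space_restrict_space)
  obtain C where C: "\<And>x. x \<in> K \<Longrightarrow> cmod (f x) \<le> C" using Cfun_bounded[OF K f] by blast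
  have "f \<in> borel_measurable P"
    using borel_measurable_continuous_on_restrict[of K f] f measurable_cong_sets[OF P(2) refl]
    by (auto simp: Cfun_def)
  thus ?thesis by (intro integrable_const_bound[of _ C]) (use C sp in auto)
qed

lemma integral_chi2_prob:
  assumes P: "prob_space P" "sets P = sets (restrict_space borel (Omega d \<times> Omega d'))"
  shows "(LINT w|P. chi2 d d' n u w) =
    of_real (measure P {z\<in>Omega d \<times> Omega d'. (trunc n (fst z), trunc n (snd z)) \<in> {u}})"
    (is "_ = of_real (measure P ?C)")
proof -
  have sp: "space P = Omega d \<times> Omega d'"
    using sets_eq_imp_space_eq[OF P(2)] by (simp add: space_restrict_space)
  have "?C \<in> sets P" unfolding P(2) by (rule clopens_sets[OF cylinder_clopens])
  moreover have "?C \<subseteq> space P" using sp by auto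
  moreover have "(LINT w|P. chi2 d d' n u w) = (LINT w|P. complex_of_real (indicator ?C w))"
    by (intro Bochner_Integration.integral_cong refl)
       (auto simp: chi2_Omega sp indicator_def)
  ultimately show ?thesis by (simp add: Int_absorb2)
qed

text \<open>At almost every point the values of \<Gamma> on clopen indicators are nonnegative,
  additive and of total mass 1, hence extend to a probability measure. The integral formula then
  holds for cylinder functions by construction and passes to continuous functions by uniform
  approximation.\<close>

lemma kernel_exists:
  assumes fam: "inductive_family d" "inductive_family d'"
    and U: "ucp_Linf (Omega d \<times> Omega d') M \<Gamma>" (is "ucp_Linf ?K M \<Gamma>")
  shows "\<exists>p. p \<in> M \<rightarrow>\<^sub>M prob_algebra (restrict_space borel ?K) \<and>
    (\<forall>f\<in>Cfun ?K. AE z in M. \<Gamma> f z = (LINT w|p z. f w))"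
proof -
  have K: "compact ?K" by (intro compact_Times compact_Omega)
  define ind where "ind C w = (if w \<in> C then 1 else 0 :: complex)" for C and w :: "(nat \<Rightarrow> nat) \<times> (nat \<Rightarrow> nat)"
  have ind: "ind C \<in> Cfun ?K" if "C \<in> clopens ?K" for C
    using clopens_Cfun[OF that] unfolding ind_def .
  define m where "m z C = \<Gamma> (ind C) z" for z C
  define good where "good z \<longleftrightarrow> (\<forall>C\<in>clopens ?K. m z C \<in> \<real>\<^sub>\<ge>\<^sub>0) \<and>
     (\<forall>C\<in>clopens ?K. \<forall>D\<in>clopens ?K. C \<inter> D = {} \<longrightarrow> m z (C \<union> D) = m z C + m z D) \<and> m z ?K = 1" for z
  have cnt: "countable (clopens ?K)" by (rule countable_clopens)
  have KK: "?K \<in> clopens ?K" by (auto simp: clopens_def)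
  have "AE z in M. good z"
    unfolding good_def
  proof (intro AE_conjI)
    show "AE z in M. \<forall>C\<in>clopens ?K. m z C \<in> \<real>\<^sub>\<ge>\<^sub>0"
      unfolding AE_ball_countable[OF cnt] m_def
      by (intro ballI ucp_positive[OF U ind]) (auto simp: ind_def)
    show "AE z in M. \<forall>C\<in>clopens ?K. \<forall>D\<in>clopens ?K. C \<inter> D = {} \<longrightarrow> m z (C \<union> D) = m z C + m z D"
      unfolding AE_ball_countable[OF cnt]
    proof (intro ballI)
      fix C D assume CD: "C \<in> clopens ?K" "D \<in> clopens ?K"
      show "AE z in M. C \<inter> D = {} \<longrightarrow> m z (C \<union> D) = m z C + m z D"
      proof (cases "C \<inter> D = {}")
        case True
        then have "ind (C \<union> D) = (\<lambda>w. ind C w + ind D w)" by (auto simp: ind_def fun_eq_iff)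
        then show ?thesis using ucp_LinfD(2)[OF U ind[OF CD(1)] ind[OF CD(2)]] by (simp add: m_def)
      qed simp
    qed
    have "AE z in M. m z ?K = \<Gamma> (\<lambda>_. 1) z"
      unfolding m_def by (rule ucp_cong[OF U ind[OF KK] Cfun_const]) (simp add: ind_def)
    with ucp_LinfD(4)[OF U] show "AE z in M. m z ?K = 1" by eventually_elim simp
  qed
  then obtain N where N: "{z\<in>space M. \<not> good z} \<subseteq> N" "N \<in> null_sets M"
    by (auto elim!: AE_E simp: null_sets_def)
  have "\<exists>P. prob_space P \<and> sets P = sets (restrict_space borel ?K) \<and>
      (\<forall>C\<in>clopens ?K. emeasure P C = ennreal (Re (m z C)))" if "z \<in> space M - N" for z
  proof -
    have g: "good z" using that N(1) by auto
    obtain P where "prob_space P" "sets P = sets (restrict_space borel ?K)"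
      "\<And>C. C \<in> clopens ?K \<Longrightarrow> emeasure P C = ennreal (Re (m z C))"
      by (rule clopens_extend[OF K, of "\<lambda>C. Re (m z C)"]) (use g in \<open>auto simp: good_def complex_nonneg_Reals_iff\<close>)
    thus ?thesis by blast
  qed
  then obtain Q where Q: "\<And>z. z \<in> space M - N \<Longrightarrow> prob_space (Q z) \<and> sets (Q z) = sets (restrict_space borel ?K) \<and>
      (\<forall>C\<in>clopens ?K. emeasure (Q z) C = ennreal (Re (m z C)))"
    by metis
  \<comment> \<open>The kernel must be a probability measure at every point. On the exceptional null
    set the point mass at \<open>z0\<close> serves; it exists because all branching numbers are at
    least 1.\<close>
  define z0 :: "(nat \<Rightarrow> nat) \<times> (nat \<Rightarrow> nat)" where "z0 = ((\<lambda>_. 1), (\<lambda>_. 1))"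
  have z0: "z0 \<in> ?K" using Omega_nonempty[OF fam(1)] Omega_nonempty[OF fam(2)] by (simp add: z0_def)
  define p where "p z = (if z \<in> N then return (restrict_space borel ?K) z0 else Q z)" for z
  have prob: "prob_space (p z)" and sets: "sets (p z) = sets (restrict_space borel ?K)" if "z \<in> space M" for z
    using that Q[of z] z0 by (auto simp: p_def space_restrict_space intro!: prob_space_return)
  \<comment> \<open>Measurability in \<open>z\<close> is checked on the clopen sets only: they are
    stable under intersections and generate the Borel sets.\<close>
  have meas: "p \<in> M \<rightarrow>\<^sub>M prob_algebra (restrict_space borel ?K)"
  proof (rule measurable_prob_algebra_generated[OF sigma_sets_clopens[symmetric] _ _ prob sets])
    interpret algebra ?K "clopens ?K" by (rule clopens_algebra)
    show "Int_stable (clopens ?K)" by (auto simp: Int_stable_def)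
    show "clopens ?K \<subseteq> Pow ?K" by (auto simp: clopens_def)
    fix A assume A: "A \<in> clopens ?K"
    have "\<Gamma> (ind A) \<in> borel_measurable M" by (rule ucp_measurable[OF U ind[OF A]])
    hence "(\<lambda>z. if z \<in> N then indicator A z0 else ennreal (Re (\<Gamma> (ind A) z))) \<in> borel_measurable M"
      using N(2) by (intro measurable_If_set) auto
    moreover have "emeasure (p z) A = (if z \<in> N then indicator A z0 else ennreal (Re (\<Gamma> (ind A) z)))"
      if "z \<in> space M" for z
      using that Q[of z] A clopens_sets[OF A] by (auto simp: p_def m_def)
    ultimately show "(\<lambda>z. emeasure (p z) A) \<in> borel_measurable M"
      by (subst measurable_cong) auto
  qed
  have AEN: "AE z in M. z \<notin> N" by (rule AE_not_in[OF N(2)])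
  have base: "AE z in M. \<Gamma> (chi2 d d' n u) z = (LINT w|p z. chi2 d d' n u w)" for n u
  proof -
    define C where "C = {z\<in>?K. (trunc n (fst z), trunc n (snd z)) \<in> {u}}"
    have C: "C \<in> clopens ?K" unfolding C_def by (rule cylinder_clopens)
    have "AE z in M. \<Gamma> (chi2 d d' n u) z = m z C"
      unfolding m_def by (rule ucp_cong[OF U chi2_Cfun ind[OF C]]) (auto simp: chi2_Omega ind_def C_def)
    with AEN AE_space show ?thesis
    proof eventually_elim
      case (elim z)
      have "(LINT w|p z. chi2 d d' n u w) = of_real (measure (p z) C)"
        unfolding C_def by (rule integral_chi2_prob[OF prob sets]) (use elim in auto)
      moreover have "m z C \<in> \<real>\<^sub>\<ge>\<^sub>0" using elim N(1) C by (auto simp: good_def)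
      moreover have "emeasure (p z) C = ennreal (Re (m z C))"
        using Q[of z] C elim by (auto simp: p_def)
      ultimately show ?case using elim(3)
        by (auto simp: measure_def complex_nonneg_Reals_iff complex_eq_iff)
    qed
  qed
  have "AE z in M. \<Gamma> f z = (LINT w|p z. f w)" if f: "f \<in> Cfun ?K" for f
  proof -
    \<comment> \<open>The 3 splits as 2 for \<open>\<Gamma> f - \<Gamma> g\<close>, from
      \<open>ucp_bound\<close>, and 1 for the integrals of \<open>g\<close> and \<open>f\<close>
      against a probability measure. Errors of the form \<open>inverse (real (Suc k))\<close> keep
      the number of exceptional sets countable.\<close>
    have "AE z in M. cmod (\<Gamma> f z - (LINT w|p z. f w)) \<le> 3 * inverse (real (Suc k))" for k
    proof -
      define e where "e = inverse (real (Suc k))"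
      have "e > 0" by (simp add: e_def)
      then obtain n where n: "\<And>z z'. z \<in> ?K \<Longrightarrow> z' \<in> ?K \<Longrightarrow> agree n z z' \<Longrightarrow> cmod (f z - f z') < e"
        using Cfun_uniform[OF K f] by blast
      define L where "L = level d n \<times> level d' n"
      have finL: "finite L" by (simp add: L_def)
      \<comment> \<open>On each cylinder \<open>f\<close> is replaced by its value at the sample
        point.\<close>
      define c where "c u = f (pad n (fst u), pad n (snd u))" for u
      define g where "g = (\<lambda>w. \<Sum>u\<in>L. c u * chi2 d d' n u w)"
      have g: "g \<in> Cfun ?K" unfolding g_def by (intro Cfun_sum Cfun_scale chi2_Cfun)
      have fg: "cmod (f z - g z) \<le> e" if z: "z \<in> ?K" for z
      proof -
        have z': "fst z \<in> Omega d" "snd z \<in> Omega d'" using z by auto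
        define y where "y = (pad n (trunc n (fst z)), pad n (trunc n (snd z)))"
        have "g z = f y" using sum_chi2[OF z, of c n] by (simp add: g_def c_def L_def y_def)
        moreover have "y \<in> ?K"
          using pad_Omega[OF fam(1) trunc_in_level[OF z'(1)]] pad_Omega[OF fam(2) trunc_in_level[OF z'(2)]]
          by (simp add: y_def)
        moreover have "agree n z y" by (simp add: agree_def y_def trunc_pad)
        ultimately show ?thesis using n[OF z, of y] by simp
      qed
      have "AE z in M. \<Gamma> g z = (\<Sum>u\<in>L. c u * \<Gamma> (chi2 d d' n u) z)"
        unfolding g_def by (rule ucp_sum[OF U finL chi2_Cfun])
      moreover have "AE z in M. \<forall>u\<in>L. \<Gamma> (chi2 d d' n u) z = (LINT w|p z. chi2 d d' n u w)"
        using base by (intro AE_finite_allI finL)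
      moreover have "AE z in M. \<Gamma> (\<lambda>a. f a - g a) z = \<Gamma> f z - \<Gamma> g z" by (rule ucp_diff[OF U f g])
      moreover have "AE z in M. cmod (\<Gamma> (\<lambda>a. f a - g a) z) \<le> 2 * e"
        by (rule ucp_bound[OF U]) (use f g fg in \<open>auto simp: Cfun_def intro!: continuous_intros\<close>)
      ultimately show ?thesis unfolding e_def[symmetric] using AE_space
      proof eventually_elim
        case (elim z)
        note P = prob[OF elim(5)] sets[OF elim(5)]
        interpret prob_space "p z" by (rule P(1))
        have sp: "space (p z) = ?K" using sets_eq_imp_space_eq[OF P(2)] by (simp add: space_restrict_space)
        note int = Cfun_integrable_prob[OF P K]
        have "\<Gamma> g z = (\<Sum>u\<in>L. c u * (LINT w|p z. chi2 d d' n u w))" using elim(1,2) by simp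
        also have "\<dots> = (LINT w|p z. g w)"
          unfolding g_def using int[OF chi2_Cfun] by (subst Bochner_Integration.integral_sum) auto
        finally have 1: "\<Gamma> g z = (LINT w|p z. g w)" .
        have "cmod ((LINT w|p z. g w) - (LINT w|p z. f w)) = cmod (LINT w|p z. g w - f w)"
          using int[OF f] int[OF g] by simp
        also have "\<dots> \<le> (LINT w|p z. cmod (g w - f w))" by (rule integral_norm_bound)
        also have "\<dots> \<le> (LINT w|p z. e)"
          using int[OF f] int[OF g] fg sp by (intro integral_mono) (auto simp: norm_minus_commute)
        also have "\<dots> = e" using prob_space by simp
        finally have "cmod (\<Gamma> g z - (LINT w|p z. f w)) \<le> e" unfolding 1 .
        moreover have "cmod (\<Gamma> f z - \<Gamma> g z) \<le> 2 * e" using elim(3,4) by simp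
        ultimately show ?case
          using norm_triangle_ineq[of "\<Gamma> f z - \<Gamma> g z" "\<Gamma> g z - (LINT w|p z. f w)"] by simp
      qed
    qed
    hence "AE z in M. \<forall>k. cmod (\<Gamma> f z - (LINT w|p z. f w)) \<le> 3 * inverse (real (Suc k))"
      by (simp add: AE_all_countable)
    thus ?thesis
    proof eventually_elim
      case (elim z)
      have "(\<lambda>k. 3 * inverse (real (Suc k))) \<longlonglongrightarrow> 3 * 0"
        by (intro tendsto_mult_left LIMSEQ_inverse_real_of_nat)
      hence "cmod (\<Gamma> f z - (LINT w|p z. f w)) \<le> 3 * 0"
        by (rule LIMSEQ_le_const) (use elim in auto)
      thus ?case by simp
    qed
  qed
  with meas show ?thesis by blast
qed

section \<open>The value of a Cantor correlation\<close>

lemma level_nonempty: "inductive_family d \<Longrightarrow> level d n \<noteq> {}"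
  using card_level_pos[of d n] by force

text \<open>Existence turns the \<open>SOME\<close> in \<open>kernel\<close> into a genuine
  disintegration of \<Gamma>.\<close>

lemma kernel_spec:
  assumes "inductive_family dA" "inductive_family dB" "cantor_corr dX dY dA dB \<Gamma>"
  shows "kernel dX dY dA dB \<Gamma> \<in> (mu dX \<Otimes>\<^sub>M mu dY) \<rightarrow>\<^sub>M prob_algebra (restrict_space borel (Omega dA \<times> Omega dB))"
    and "f \<in> Cfun (Omega dA \<times> Omega dB) \<Longrightarrow>
      AE z in mu dX \<Otimes>\<^sub>M mu dY. \<Gamma> f z = (LINT w|kernel dX dY dA dB \<Gamma> z. f w)"
  using someI_ex[OF kernel_exists[OF assms(1,2) assms(3)[unfolded cantor_corr_def]]]
  unfolding kernel_def by blast+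

lemma Linf_integrable:
  assumes "prob_space M" "f \<in> Linf M"
  shows "integrable M f"
proof -
  interpret prob_space M by (rule assms(1))
  from assms(2) obtain C where "AE x in M. cmod (f x) \<le> C" "f \<in> borel_measurable M"
    by (auto simp: Linf_def)
  then show ?thesis by (intro integrable_const_bound[of _ C])
qed

lemma chi2_measurable [measurable]: "chi2 d d' n u \<in> borel_measurable (mu d \<Otimes>\<^sub>M mu d')"
  by (rule Cfun_measurable_pair[OF chi2_Cfun])

lemma integrable_chi2_mult:
  assumes "prob_space (mu d \<Otimes>\<^sub>M mu d')" "f \<in> Linf (mu d \<Otimes>\<^sub>M mu d')"
  shows "integrable (mu d \<Otimes>\<^sub>M mu d') (\<lambda>z. chi2 d d' n u z * f z)"
proof (rule Bochner_Integration.integrable_bound[OF Linf_integrable[OF assms]])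
  show "(\<lambda>z. chi2 d d' n u z * f z) \<in> borel_measurable (mu d \<Otimes>\<^sub>M mu d')"
    using assms(2) by (auto simp: Linf_def)
  show "AE z in mu d \<Otimes>\<^sub>M mu d'. norm (chi2 d d' n u z * f z) \<le> norm (f z)"
    by (rule AE_I2) (auto simp: space_pair_measure chi2_Omega norm_mult)
qed

text \<open>The average of \<Gamma> on a cylinder function over the cylinder of
  \<open>(s, t)\<close>: the two cardinalities are the reciprocal of its measure. Complex-valued
  because \<Gamma> is; \<open>cfin_of_real\<close> shows that no imaginary part arises.\<close>

definition cfin :: "(nat \<Rightarrow> nat) \<Rightarrow> (nat \<Rightarrow> nat) \<Rightarrow> (nat \<Rightarrow> nat) \<Rightarrow> (nat \<Rightarrow> nat) \<Rightarrow> nat \<Rightarrow> cmap \<Rightarrow>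
    (nat \<Rightarrow> nat) \<Rightarrow> (nat \<Rightarrow> nat) \<Rightarrow> (nat \<Rightarrow> nat) \<Rightarrow> (nat \<Rightarrow> nat) \<Rightarrow> complex" where
  "cfin dX dY dA dB n \<Gamma> s t a b = of_nat (card (level dX n)) * of_nat (card (level dY n)) *
     (LINT z|(mu dX \<Otimes>\<^sub>M mu dY). chi2 dX dY n (s, t) z * \<Gamma> (chi2 dA dB n (a, b)) z)"

lemma finite_supp: "finite (supp dX dY dA dB n lam)"
  unfolding supp_def by (rule finite_subset[of _ "level dX n \<times> level dY n \<times> level dA n \<times> level dB n"]) auto

text \<open>Written this way, the section is visibly decided at level \<open>n\<close>, hence a
  clopen set, on which the kernel can be computed.\<close>

lemma kappa_section:
  assumes "z \<in> Omega dX \<times> Omega dY"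
  shows "{(a, b). (fst z, snd z, a, b) \<in> kappa dX dY dA dB n lam} =
    {w \<in> Omega dA \<times> Omega dB. (trunc n (fst w), trunc n (snd w)) \<in>
      {(a, b). (trunc n (fst z), trunc n (snd z), a, b) \<in> supp dX dY dA dB n lam}}"
  using assms unfolding kappa_def by auto

text \<open>A single quadruple of truncations decides membership, so the indicator of the section is
  a sum over \<open>supp\<close> of products of cylinder functions. After integration
  \<open>P\<close> occurs only through its integrals of \<open>chi2\<close>.\<close>

lemma measure_kappa_section:
  assumes P: "prob_space P" "sets P = sets (restrict_space borel (Omega dA \<times> Omega dB))"
    and z: "z \<in> Omega dX \<times> Omega dY"
  shows "complex_of_real (measure P {(a, b). (fst z, snd z, a, b) \<in> kappa dX dY dA dB n lam}) =
    (\<Sum>(s, t, a, b)\<in>supp dX dY dA dB n lam. chi2 dX dY n (s, t) z * (LINT w|P. chi2 dA dB n (a, b) w))"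
    (is "complex_of_real (measure P ?F) = (\<Sum>(s, t, a, b)\<in>?S. _ s t a b)")
proof -
  interpret prob_space P by (rule P(1))
  have sp: "space P = Omega dA \<times> Omega dB"
    using sets_eq_imp_space_eq[OF P(2)] by (simp add: space_restrict_space)
  have F: "?F \<in> sets P"
    unfolding kappa_section[OF z] P(2) by (rule clopens_sets[OF cylinder_clopens])
  have "complex_of_real (measure P ?F) = (LINT w|P. complex_of_real (indicator ?F w))"
    using F sets.sets_into_space[OF F] by (simp add: Int_absorb2)
  also have "\<dots> = (LINT w|P. (\<Sum>(s, t, a, b)\<in>?S. chi2 dX dY n (s, t) z * chi2 dA dB n (a, b) w))"
  proof (intro Bochner_Integration.integral_cong refl)
    fix w assume "w \<in> space P"
    then have w: "w \<in> Omega dA \<times> Omega dB" using sp by simp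
    define q where "q = (trunc n (fst z), trunc n (snd z), trunc n (fst w), trunc n (snd w))"
    have "(\<Sum>(s, t, a, b)\<in>?S. chi2 dX dY n (s, t) z * chi2 dA dB n (a, b) w) =
      (\<Sum>r\<in>?S. if r = q then 1 else 0)"
      by (intro sum.cong refl) (auto simp: chi2_Omega[OF z] chi2_Omega[OF w] q_def split: if_splits)
    also have "\<dots> = complex_of_real (indicator ?F w)"
      using finite_supp[of dX dY dA dB n lam] w unfolding kappa_section[OF z]
      by (auto simp: indicator_def q_def)
    finally show "complex_of_real (indicator ?F w) =
      (\<Sum>(s, t, a, b)\<in>?S. chi2 dX dY n (s, t) z * chi2 dA dB n (a, b) w)" by simp
  qed
  also have "\<dots> = (\<Sum>(s, t, a, b)\<in>?S. chi2 dX dY n (s, t) z * (LINT w|P. chi2 dA dB n (a, b) w))"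
    using Cfun_integrable_prob[OF P compact_Times[OF compact_Omega compact_Omega] chi2_Cfun]
    by (simp add: case_prod_unfold Bochner_Integration.integral_sum)
  finally show ?thesis .
qed

text \<open>The kernel disappears: it enters only through integrals of finitely many cylinder
  functions, and these agree almost everywhere with values of \<Gamma>.\<close>

lemma cantor_value_formula:
  assumes fam: "inductive_family dX" "inductive_family dY" "inductive_family dA" "inductive_family dB"
    and C: "cantor_corr dX dY dA dB \<Gamma>"
  shows "complex_of_real (cantor_value dX dY dA dB \<Gamma> (kappa dX dY dA dB n lam)) =
    1 / (of_nat (card (level dX n)) * of_nat (card (level dY n))) *
      (\<Sum>(s, t, a, b)\<in>supp dX dY dA dB n lam. cfin dX dY dA dB n \<Gamma> s t a b)"
proof -
  let ?M = "mu dX \<Otimes>\<^sub>M mu dY" and ?S = "supp dX dY dA dB n lam" and ?K = "Omega dA \<times> Omega dB"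
  note U = C[unfolded cantor_corr_def]
  define p where "p = kernel dX dY dA dB \<Gamma>"
  note spec = kernel_spec[OF fam(3,4) C, folded p_def]
  have sp: "space ?M = Omega dX \<times> Omega dY" by (simp add: space_pair_measure)
  have prob: "prob_space (p z)" and sets: "sets (p z) = sets (restrict_space borel ?K)" if "z \<in> space ?M" for z
    using measurable_space[OF spec(1) that] by (auto simp: space_prob_algebra)
  define h where "h z = measure (p z) {(a, b). (fst z, snd z, a, b) \<in> kappa dX dY dA dB n lam}" for z
  have h: "complex_of_real (h z) = (\<Sum>(s, t, a, b)\<in>?S. chi2 dX dY n (s, t) z * (LINT w|p z. chi2 dA dB n (a, b) w))"
    if "z \<in> space ?M" for z
    unfolding h_def by (rule measure_kappa_section[OF prob[OF that] sets[OF that]]) (use that sp in simp)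
  \<comment> \<open>The integral of a cylinder function is the measure of a cylinder, so
    measurability follows from that of the kernel.\<close>
  have meas1: "(\<lambda>z. LINT w|p z. chi2 dA dB n u w) \<in> borel_measurable ?M" for u
  proof -
    define D where "D = {z\<in>?K. (trunc n (fst z), trunc n (snd z)) \<in> {u}}"
    have "D \<in> sets (restrict_space borel ?K)" unfolding D_def by (rule clopens_sets[OF cylinder_clopens])
    hence "(\<lambda>z. measure (p z) D) \<in> borel_measurable ?M"
      by (rule measurable_compose[OF spec(1) measurable_measure_prob_algebra])
    hence "(\<lambda>z. complex_of_real (measure (p z) D)) \<in> borel_measurable ?M" by measurable
    moreover have "(LINT w|p z. chi2 dA dB n u w) = complex_of_real (measure (p z) D)" if "z \<in> space ?M" for z
      unfolding D_def by (rule integral_chi2_prob[OF prob[OF that] sets[OF that]])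
    ultimately show ?thesis by (subst measurable_cong) auto
  qed
  have meas: "(\<lambda>z. complex_of_real (h z)) \<in> borel_measurable ?M"
    by (subst measurable_cong[OF h], assumption) (auto simp: case_prod_unfold intro!: borel_measurable_sum borel_measurable_times meas1)
  have G: "\<Gamma> (chi2 dA dB n u) \<in> Linf ?M" for u
    by (rule ucp_LinfD(1)[OF U chi2_Cfun])
  hence Gm [measurable]: "\<Gamma> (chi2 dA dB n u) \<in> borel_measurable ?M" for u
    by (simp add: Linf_def)
  note int = integrable_chi2_mult[OF prob_space_mu_pair[OF fam(1,2)] G]
  have "AE z in ?M. \<forall>q\<in>?S. \<Gamma> (chi2 dA dB n (snd (snd q))) z = (LINT w|p z. chi2 dA dB n (snd (snd q)) w)"
    by (intro AE_finite_allI finite_supp spec(2) chi2_Cfun)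
  then have ae: "AE z in ?M. complex_of_real (h z) =
      (\<Sum>(s, t, a, b)\<in>?S. chi2 dX dY n (s, t) z * \<Gamma> (chi2 dA dB n (a, b)) z)"
    using AE_space
  proof eventually_elim
    case (elim z)
    show ?case unfolding h[OF elim(2)]
      by (intro sum.cong refl) (use elim(1) in auto)
  qed
  have "complex_of_real (cantor_value dX dY dA dB \<Gamma> (kappa dX dY dA dB n lam)) = (LINT z|?M. complex_of_real (h z))"
    unfolding cantor_value_def h_def p_def integral_complex_of_real by (simp add: case_prod_unfold)
  also have "\<dots> = (LINT z|?M. (\<Sum>(s, t, a, b)\<in>?S. chi2 dX dY n (s, t) z * \<Gamma> (chi2 dA dB n (a, b)) z))"
    by (rule integral_cong_AE[OF meas _ ae]) (auto simp: case_prod_unfold)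
  also have "\<dots> = (\<Sum>(s, t, a, b)\<in>?S. LINT z|?M. chi2 dX dY n (s, t) z * \<Gamma> (chi2 dA dB n (a, b)) z)"
    using int by (simp add: case_prod_unfold Bochner_Integration.integral_sum)
  also have "\<dots> = (\<Sum>(s, t, a, b)\<in>?S. 1 / (of_nat (card (level dX n)) * of_nat (card (level dY n))) *
      cfin dX dY dA dB n \<Gamma> s t a b)"
    using level_nonempty[OF fam(1), of n] level_nonempty[OF fam(2), of n]
    by (intro sum.cong refl) (auto simp: cfin_def)
  finally show ?thesis by (simp add: sum_distrib_left case_prod_unfold)
qed

text \<open>Serves both directions: with \<open>p\<close> given and \<Gamma> its lift, and with
  \<Gamma> given and \<open>p\<close> its averages.\<close>

lemma cantor_value_eq_fin_value:
  assumes fam: "inductive_family dX" "inductive_family dY" "inductive_family dA" "inductive_family dB"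
    and C: "cantor_corr dX dY dA dB \<Gamma>"
    and p: "\<And>s t a b. s \<in> level dX n \<Longrightarrow> t \<in> level dY n \<Longrightarrow> a \<in> level dA n \<Longrightarrow> b \<in> level dB n \<Longrightarrow>
      cfin dX dY dA dB n \<Gamma> s t a b = complex_of_real (p s t a b)"
  shows "cantor_value dX dY dA dB \<Gamma> (kappa dX dY dA dB n lam) =
    fin_value (level dX n) (level dY n) p (supp dX dY dA dB n lam)"
proof -
  have "(\<Sum>(s, t, a, b)\<in>supp dX dY dA dB n lam. cfin dX dY dA dB n \<Gamma> s t a b) =
    (\<Sum>(s, t, a, b)\<in>supp dX dY dA dB n lam. complex_of_real (p s t a b))"
    by (intro sum.cong refl) (auto simp: supp_def p)
  also have "\<dots> = complex_of_real (\<Sum>(s, t, a, b)\<in>supp dX dY dA dB n lam. p s t a b)"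
    by (simp add: case_prod_unfold)
  finally have "complex_of_real (cantor_value dX dY dA dB \<Gamma> (kappa dX dY dA dB n lam)) =
    complex_of_real (fin_value (level dX n) (level dY n) p (supp dX dY dA dB n lam))"
    unfolding cantor_value_formula[OF fam C] fin_value_def by simp
  thus ?thesis unfolding of_real_eq_iff .
qed

section \<open>States and step maps\<close>

text \<open>The scalar counterpart of \<open>ucp_Linf\<close>, with identities that hold exactly
  instead of almost everywhere. Lifted maps are built from finitely many such functionals.\<close>

definition cp_state :: "'a::topological_space set \<Rightarrow> (('a \<Rightarrow> complex) \<Rightarrow> complex) \<Rightarrow> bool" where
  "cp_state K e \<longleftrightarrow>
     (\<forall>f\<in>Cfun K. \<forall>g\<in>Cfun K. e (\<lambda>a. f a + g a) = e f + e g) \<and>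
     (\<forall>c. \<forall>f\<in>Cfun K. e (\<lambda>a. c * f a) = c * e f) \<and>
     e (\<lambda>_. 1) = 1 \<and>
     (\<forall>m F. (\<forall>i<m. \<forall>j<m. F i j \<in> Cfun K) \<and> (\<forall>a\<in>K. psd m (\<lambda>i j. F i j a)) \<longrightarrow> psd m (\<lambda>i j. e (F i j)))"

lemma cp_stateD:
  assumes "cp_state K e"
  shows "f \<in> Cfun K \<Longrightarrow> g \<in> Cfun K \<Longrightarrow> e (\<lambda>a. f a + g a) = e f + e g"
    and "f \<in> Cfun K \<Longrightarrow> e (\<lambda>a. c * f a) = c * e f"
    and "e (\<lambda>_. 1) = 1"
    and "(\<And>i j. i < m \<Longrightarrow> j < m \<Longrightarrow> F i j \<in> Cfun K) \<Longrightarrow> (\<And>a. a \<in> K \<Longrightarrow> psd m (\<lambda>i j. F i j a)) \<Longrightarrow>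
      psd m (\<lambda>i j. e (F i j))"
proof -
  note e = assms[unfolded cp_state_def]
  show "f \<in> Cfun K \<Longrightarrow> g \<in> Cfun K \<Longrightarrow> e (\<lambda>a. f a + g a) = e f + e g"
    using conjunct1[OF e] by blast
  show "f \<in> Cfun K \<Longrightarrow> e (\<lambda>a. c * f a) = c * e f"
    using conjunct1[OF conjunct2[OF e]] by blast
  show "e (\<lambda>_. 1) = 1"
    using conjunct1[OF conjunct2[OF conjunct2[OF e]]] .
  show "(\<And>i j. i < m \<Longrightarrow> j < m \<Longrightarrow> F i j \<in> Cfun K) \<Longrightarrow> (\<And>a. a \<in> K \<Longrightarrow> psd m (\<lambda>i j. F i j a)) \<Longrightarrow>
      psd m (\<lambda>i j. e (F i j))"
    using conjunct2[OF conjunct2[OF conjunct2[OF e]]] by simp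
qed

lemma integral_nonneg_Reals:
  fixes f :: "'a \<Rightarrow> complex"
  assumes "AE x in M. f x \<in> \<real>\<^sub>\<ge>\<^sub>0"
  shows "(LINT x|M. f x) \<in> \<real>\<^sub>\<ge>\<^sub>0"
proof (cases "integrable M f")
  case True
  have "(LINT x|M. f x) = (LINT x|M. complex_of_real (Re (f x)))"
    by (rule integral_cong_AE) (use True assms in \<open>auto simp: complex_nonneg_Reals_iff complex_eq_iff elim!: eventually_mono\<close>)
  also have "\<dots> = complex_of_real (LINT x|M. Re (f x))" by simp
  also have "\<dots> \<in> \<real>\<^sub>\<ge>\<^sub>0"
    unfolding nonneg_Reals_of_real_iff
    by (rule integral_nonneg_AE) (use assms in \<open>auto simp: complex_nonneg_Reals_iff elim!: eventually_mono\<close>)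
  finally show ?thesis .
\<comment> \<open>The integral of a non-integrable function is 0 by convention.\<close>
qed (simp add: not_integrable_integral_eq)

text \<open>For a nonnegative density \<open>w\<close>, the quadratic form of the matrix of
  integrals is the integral of \<open>w\<close> times the pointwise quadratic forms.\<close>

lemma cp_state_integral:
  assumes sp: "space N = K" and int: "\<And>f. f \<in> Cfun K \<Longrightarrow> integrable N f"
    and w: "w \<in> Cfun K" "\<And>x. x \<in> K \<Longrightarrow> w x \<in> \<real>\<^sub>\<ge>\<^sub>0" "(LINT x|N. w x) = 1"
  shows "cp_state K (\<lambda>f. LINT x|N. w x * f x)"
proof -
  have wf: "integrable N (\<lambda>x. w x * f x)" if "f \<in> Cfun K" for f
    by (rule int) (use w(1) that in \<open>auto simp: Cfun_def intro!: continuous_intros\<close>)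
  show ?thesis
    unfolding cp_state_def
  proof (intro conjI ballI allI impI)
    show "(LINT x|N. w x * (f x + g x)) = (LINT x|N. w x * f x) + (LINT x|N. w x * g x)"
      if "f \<in> Cfun K" "g \<in> Cfun K" for f g
      using wf that by (simp add: distrib_left)
    show "(LINT x|N. w x * (c * f x)) = c * (LINT x|N. w x * f x)" for c f
      by (simp add: mult.left_commute[of _ c])
    show "(LINT x|N. w x * 1) = 1" using w(3) by simp
    fix m F assume *: "(\<forall>i<m. \<forall>j<m. F i j \<in> Cfun K) \<and> (\<forall>a\<in>K. psd m (\<lambda>i j. F i j a))"
    show "psd m (\<lambda>i j. LINT x|N. w x * F i j x)"
      unfolding psd_def
    proof
      fix c :: "nat \<Rightarrow> complex"
      have "(\<Sum>i<m. \<Sum>j<m. cnj (c i) * (LINT x|N. w x * F i j x) * c j) =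
        (LINT x|N. (\<Sum>i<m. \<Sum>j<m. cnj (c i) * (w x * F i j x) * c j))"
      proof -
        have "(LINT x|N. (\<Sum>i<m. \<Sum>j<m. cnj (c i) * (w x * F i j x) * c j)) =
          (\<Sum>i<m. LINT x|N. (\<Sum>j<m. cnj (c i) * (w x * F i j x) * c j))"
          by (rule Bochner_Integration.integral_sum) (use * wf in \<open>auto intro!: Bochner_Integration.integrable_sum\<close>)
        also have "\<dots> = (\<Sum>i<m. \<Sum>j<m. LINT x|N. cnj (c i) * (w x * F i j x) * c j)"
          by (intro sum.cong refl Bochner_Integration.integral_sum) (use * wf in simp)
        finally show ?thesis by simp
      qed
      also have "\<dots> = (LINT x|N. w x * (\<Sum>i<m. \<Sum>j<m. cnj (c i) * F i j x * c j))"
        by (simp add: sum_distrib_left mult_ac)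
      also have "\<dots> \<in> \<real>\<^sub>\<ge>\<^sub>0"
        by (intro integral_nonneg_Reals AE_I2 nonneg_Reals_mult_I w)
           (use * sp in \<open>auto simp: psd_def\<close>)
      finally show "(\<Sum>i<m. \<Sum>j<m. cnj (c i) * (LINT x|N. w x * F i j x) * c j) \<in> \<real>\<^sub>\<ge>\<^sub>0" .
    qed
  qed
qed

text \<open>At each point \<Phi> is a convex combination of states, so every condition holds
  pointwise; weights in [0, 1] give the bound.\<close>

lemma ucp_Linf_step:
  assumes U: "finite U" and e: "\<And>u. u \<in> U \<Longrightarrow> cp_state K (e u)"
    and meas: "\<And>u. u \<in> U \<Longrightarrow> (\<lambda>x. complex_of_real (w x u)) \<in> borel_measurable M"
    and w0: "\<And>x u. x \<in> space M \<Longrightarrow> u \<in> U \<Longrightarrow> 0 \<le> w x u"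
    and w1: "\<And>x. x \<in> space M \<Longrightarrow> (\<Sum>u\<in>U. w x u) = 1"
    and \<Phi>: "\<And>f x. x \<in> space M \<Longrightarrow> f \<in> Cfun K \<Longrightarrow> \<Phi> f x = (\<Sum>u\<in>U. complex_of_real (w x u) * e u f)"
  shows "ucp_Linf K M \<Phi>"
  unfolding ucp_Linf_def
proof (intro conjI ballI allI impI)
  fix f assume f: "f \<in> Cfun K"
  show "\<Phi> f \<in> Linf M"
    unfolding Linf_def mem_Collect_eq
  proof (intro conjI)
    show "\<Phi> f \<in> borel_measurable M"
      by (subst measurable_cong[OF \<Phi>[OF _ f]], assumption) (auto intro!: borel_measurable_sum borel_measurable_times meas)
    have "cmod (\<Phi> f x) \<le> (\<Sum>u\<in>U. cmod (e u f))" if x: "x \<in> space M" for x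
      unfolding \<Phi>[OF x f]
    proof (rule sum_norm_le)
      fix u assume u: "u \<in> U"
      have "w x u \<le> 1" using member_le_sum[of u U "w x"] w0[OF x] w1[OF x] u U by simp
      then show "cmod (complex_of_real (w x u) * e u f) \<le> cmod (e u f)"
        using w0[OF x u] by (simp add: norm_mult mult_left_le_one_le)
    qed
    then show "\<exists>C. AE x in M. cmod (\<Phi> f x) \<le> C" by blast
  qed
  show "AE x in M. \<Phi> (\<lambda>a. c * f a) x = c * \<Phi> f x" for c
    by (rule AE_I2) (simp add: \<Phi> f Cfun_scale cp_stateD(2)[OF e f] sum_distrib_left mult_ac)
  show "AE x in M. \<Phi> (\<lambda>a. f a + g a) x = \<Phi> f x + \<Phi> g x" if "g \<in> Cfun K" for g
    by (rule AE_I2) (simp add: \<Phi> f that Cfun_add cp_stateD(1)[OF e f that] sum.distrib distrib_left)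
next
  show "AE x in M. \<Phi> (\<lambda>_. 1) x = 1"
  proof (rule AE_I2)
    fix x assume x: "x \<in> space M"
    have "\<Phi> (\<lambda>_. 1) x = complex_of_real (\<Sum>u\<in>U. w x u)"
      using \<Phi>[OF x, of "\<lambda>_. 1"] cp_stateD(3)[OF e] by simp
    then show "\<Phi> (\<lambda>_. 1) x = 1" using w1[OF x] by simp
  qed
next
  fix m F assume *: "(\<forall>i<m. \<forall>j<m. F i j \<in> Cfun K) \<and> (\<forall>a\<in>K. psd m (\<lambda>i j. F i j a))"
  show "AE x in M. psd m (\<lambda>i j. \<Phi> (F i j) x)"
  proof (rule AE_I2)
    fix x assume x: "x \<in> space M"
    have "psd m (\<lambda>i j. \<Sum>u\<in>U. complex_of_real (w x u) * e u (F i j))"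
      by (rule psd_weighted_sum[OF w0[OF x] cp_stateD(4)[OF e]]) (use * in auto)
    then show "psd m (\<lambda>i j. \<Phi> (F i j) x)"
      unfolding psd_def using \<Phi>[OF x] * by simp
  qed
qed

section \<open>Conditional expectations as states\<close>

lemma expect_chi: "expect d n f a = of_nat (card (level d n)) * (LINT \<omega>|mu d. chi d n a \<omega> * f \<omega>)"
  unfolding expect_def set_lebesgue_integral_def
  by (intro arg_cong2[where f = "(*)"] refl Bochner_Integration.integral_cong) 
     (simp_all add: chi_Omega_cyl indicator_def)

lemma expect_scale: "expect d n (\<lambda>\<omega>. c * f \<omega>) a = c * expect d n f a"
  unfolding expect_chi by (simp add: mult.left_commute[of _ c])

lemma chi_nonneg: "chi d n a \<omega> \<in> \<real>\<^sub>\<ge>\<^sub>0"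
  by (simp add: chi_def)

lemma cp_state_expect:
  assumes "inductive_family d" "a \<in> level d n"
  shows "cp_state (Omega d) (\<lambda>f. expect d n f a)"
proof -
  have "cp_state (Omega d) (\<lambda>f. LINT \<omega>|mu d. (of_nat (card (level d n)) * chi d n a \<omega>) * f \<omega>)"
  proof (rule cp_state_integral)
    show "(LINT \<omega>|mu d. of_nat (card (level d n)) * chi d n a \<omega>) = 1"
      using integral_chi[OF assms] level_nonempty[OF assms(1), of n] by simp
  qed (auto intro: integrable_Cfun assms Cfun_scale chi_Cfun chi_nonneg nonneg_Reals_mult_I)
  moreover have "(\<lambda>f. LINT \<omega>|mu d. (of_nat (card (level d n)) * chi d n a \<omega>) * f \<omega>) = (\<lambda>f. expect d n f a)"
    by (simp add: expect_chi mult.assoc mult.left_commute[of _ "complex_of_nat (card (level d' n))"])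
  ultimately show ?thesis by simp
qed

text \<open>Fubini turns the iterated expectation into one integral with a product density, to which
  \<open>cp_state_integral\<close> applies on the product space.\<close>

lemma tensor_expect:
  assumes "inductive_family d" "inductive_family d'" "f \<in> Cfun (Omega d \<times> Omega d')"
  shows "tensor_map (expect d n) (expect d' n) f u =
    (LINT z|(mu d \<Otimes>\<^sub>M mu d'). (of_nat (card (level d n)) * of_nat (card (level d' n))) * chi2 d d' n u z * f z)"
proof -
  interpret A: prob_space "mu d" by (rule prob_space_mu[OF assms(1)])
  interpret B: prob_space "mu d'" by (rule prob_space_mu[OF assms(2)])
  interpret pair_sigma_finite "mu d" "mu d'" ..
  have int: "integrable (mu d \<Otimes>\<^sub>M mu d') (\<lambda>z. chi2 d d' n u z * f z)"
    by (rule integrable_Cfun_pair[OF assms(1,2)])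
       (use assms(3) chi2_Cfun[of d d' n u "Omega d" "Omega d'"] in \<open>auto simp: Cfun_def intro!: continuous_intros\<close>)
  obtain a b where u: "u = (a, b)" by (cases u)
  have "(LINT \<beta>|mu d'. chi2 d d' n u (\<alpha>, \<beta>) * f (\<alpha>, \<beta>)) =
      chi d n a \<alpha> * (LINT \<beta>|mu d'. chi d' n b \<beta> * f (\<alpha>, \<beta>))" for \<alpha>
    by (simp add: u chi2_def tens_def mult.assoc)
  then have "(LINT \<alpha>|mu d. chi d n a \<alpha> * (LINT \<beta>|mu d'. chi d' n b \<beta> * f (\<alpha>, \<beta>))) =
      (LINT z|(mu d \<Otimes>\<^sub>M mu d'). chi2 d d' n u z * f z)"
    using integral_fst'[OF int] by simp
  then show ?thesis
    by (simp add: u tensor_map_def expect_scale) (simp add: expect_chi mult.assoc mult.left_commute[of _ "complex_of_nat (card (level d' n))"])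
qed

text \<open>The integral formula \<open>tensor_expect\<close> is an identity for continuous
  functions only, so states have to be comparable on \<open>Cfun K\<close>.\<close>

lemma cp_state_cong:
  assumes "cp_state K e" "\<And>f. f \<in> Cfun K \<Longrightarrow> e' f = e f"
  shows "cp_state K e'"
proof -
  have "psd m (\<lambda>i j. e' (F i j))" if "\<forall>i<m. \<forall>j<m. F i j \<in> Cfun K" "\<forall>a\<in>K. psd m (\<lambda>i j. F i j a)" for m F
    using cp_stateD(4)[OF assms(1), of m F] that by (simp add: psd_def assms(2))
  then show ?thesis
    unfolding cp_state_def
    by (auto simp: assms(2) Cfun_add Cfun_scale cp_stateD(1-3)[OF assms(1)])
qed

lemma cp_state_tensor_expect:
  assumes "inductive_family d" "inductive_family d'" "u \<in> level d n \<times> level d' n"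
  shows "cp_state (Omega d \<times> Omega d') (\<lambda>f. tensor_map (expect d n) (expect d' n) f u)"
proof (rule cp_state_cong[OF _ tensor_expect[OF assms(1,2)]])
  show "cp_state (Omega d \<times> Omega d') (\<lambda>f. LINT z|(mu d \<Otimes>\<^sub>M mu d').
      (of_nat (card (level d n)) * of_nat (card (level d' n))) * chi2 d d' n u z * f z)"
  proof (rule cp_state_integral)
    show "(LINT z|(mu d \<Otimes>\<^sub>M mu d'). of_nat (card (level d n)) * of_nat (card (level d' n)) * chi2 d d' n u z) = 1"
      using integral_chi_pair[OF assms(1) _ assms(2), of "fst u" n "snd u"] assms(3)
        level_nonempty[OF assms(1), of n] level_nonempty[OF assms(2), of n]
      by (simp add: chi2_def mem_Times_iff)
  qed (auto intro!: integrable_Cfun_pair assms Cfun_scale chi2_Cfun nonneg_Reals_mult_I simp: space_pair_measure chi2_Omega)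
qed

section \<open>The lift as a step map\<close>

lemma iota_Omega: "\<omega> \<in> Omega d \<Longrightarrow> iota d n h \<omega> = h (trunc n \<omega>)"
  unfolding iota_def cyl_eq_chi[where f = h] by (simp add: chi_Omega_cyl)

text \<open>Brings the lift into the shape of \<open>ucp_Linf_step\<close>: weights depending on the
  truncations of \<open>z\<close>, and states independent of \<open>z\<close>.\<close>

lemma lift_corr_eq:
  assumes "z \<in> Omega dX \<times> Omega dY"
  shows "lift_corr dX dY dA dB n p f z = (\<Sum>u\<in>level dA n \<times> level dB n.
    complex_of_real (p (trunc n (fst z)) (trunc n (snd z)) (fst u) (snd u)) *
    tensor_map (expect dA n) (expect dB n) f u)"
proof -
  have z: "fst z \<in> Omega dX" "snd z \<in> Omega dY" using assms by auto
  show ?thesis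
    unfolding lift_corr_def comp_def tensor_map_def[of "iota dX n"] fin_map_def
    by (simp add: case_prod_unfold iota_Omega[OF z(1)] iota_Omega[OF z(2)])
qed

lemma measurable_trunc_pair: "(\<lambda>z. f (trunc n (fst z)) (trunc n (snd z)) :: complex) \<in> borel_measurable (mu d \<Otimes>\<^sub>M mu d')"
proof -
  have "(\<lambda>z. \<Sum>u\<in>level d n \<times> level d' n. f (fst u) (snd u) * chi2 d d' n u z) \<in> borel_measurable (mu d \<Otimes>\<^sub>M mu d')"
    by measurable
  then show ?thesis
    by (subst measurable_cong[where g = "\<lambda>z. \<Sum>u\<in>level d n \<times> level d' n. f (fst u) (snd u) * chi2 d d' n u z"])
       (auto simp: space_pair_measure sum_chi2)
qed

lemma measurable_trunc: "(\<lambda>\<omega>. f (trunc n \<omega>) :: complex) \<in> borel_measurable (mu d)"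
  by (subst measurable_cong[OF cyl_eq_chi[where f = f and n = n and d = d]]) auto

lemma lift_cantor_corr:
  assumes fam: "inductive_family dA" "inductive_family dB"
    and p: "fin_corr (level dX n) (level dY n) (level dA n) (level dB n) p"
  shows "cantor_corr dX dY dA dB (lift_corr dX dY dA dB n p)"
  unfolding cantor_corr_def
proof (rule ucp_Linf_step[where U = "level dA n \<times> level dB n" and
      w = "\<lambda>z u. p (trunc n (fst z)) (trunc n (snd z)) (fst u) (snd u)" and
      e = "\<lambda>u f. tensor_map (expect dA n) (expect dB n) f u"])
  fix z assume z: "z \<in> space (mu dX \<Otimes>\<^sub>M mu dY)"
  then have t: "(trunc n (fst z), trunc n (snd z)) \<in> level dX n \<times> level dY n"
    by (auto simp: space_pair_measure trunc_in_level)
  note p' = p[unfolded fin_corr_def cond_dist_def, rule_format, OF t]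
  show "0 \<le> p (trunc n (fst z)) (trunc n (snd z)) (fst u) (snd u)" if "u \<in> level dA n \<times> level dB n" for u
    using p' that by (auto simp: case_prod_unfold)
  show "(\<Sum>u\<in>level dA n \<times> level dB n. p (trunc n (fst z)) (trunc n (snd z)) (fst u) (snd u)) = 1"
    using p' by (simp add: case_prod_unfold)
  show "lift_corr dX dY dA dB n p f z = (\<Sum>u\<in>level dA n \<times> level dB n.
    complex_of_real (p (trunc n (fst z)) (trunc n (snd z)) (fst u) (snd u)) *
    tensor_map (expect dA n) (expect dB n) f u)" for f
    by (rule lift_corr_eq) (use z in \<open>simp add: space_pair_measure\<close>)
next
  show "(\<lambda>z. complex_of_real (p (trunc n (fst z)) (trunc n (snd z)) (fst u) (snd u)))
    \<in> borel_measurable (mu dX \<Otimes>\<^sub>M mu dY)" for u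
    by (rule measurable_trunc_pair)
qed (use cp_state_tensor_expect[OF fam] in auto)

lemma tensor_expect_tens:
  "tensor_map (expect d n) (expect d' n) (tens f g) u = expect d n f (fst u) * expect d' n g (snd u)"
proof (cases u)
  case (Pair a b)
  have "expect d n (\<lambda>\<alpha>. f \<alpha> * expect d' n g b) a = expect d n f a * expect d' n g b"
    using expect_scale[of d n "expect d' n g b" f a] by (simp add: mult.commute)
  then show ?thesis by (simp add: Pair tensor_map_def tens_def expect_scale)
qed

lemma expect_chi_self:
  assumes "inductive_family d" "a \<in> level d n"
  shows "expect d n (chi d n a') a = (if a = a' then 1 else 0)"
proof -
  have "(LINT \<omega>|mu d. chi d n a \<omega> * chi d n a' \<omega>) = (LINT \<omega>|mu d. (if a = a' then 1 else 0) * chi d n a \<omega>)"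
    by (intro Bochner_Integration.integral_cong refl) (simp add: chi_def)
  then show ?thesis
    using integral_chi[OF assms] level_nonempty[OF assms(1), of n] by (simp add: expect_chi)
qed

text \<open>Lifting followed by averaging is the identity: \<open>expect\<close> and
  \<open>chi\<close> are biorthogonal, so on the cylinder of \<open>(s, t)\<close> the lift of the
  cylinder function of \<open>(a, b)\<close> is the constant \<open>p s t a b\<close>.\<close>

lemma cfin_lift:
  assumes fam: "inductive_family dX" "inductive_family dY" "inductive_family dA" "inductive_family dB"
    and st: "s \<in> level dX n" "t \<in> level dY n" "a \<in> level dA n" "b \<in> level dB n"
  shows "cfin dX dY dA dB n (lift_corr dX dY dA dB n p) s t a b = complex_of_real (p s t a b)"
proof -
  have "(LINT z|(mu dX \<Otimes>\<^sub>M mu dY). chi2 dX dY n (s, t) z * lift_corr dX dY dA dB n p (chi2 dA dB n (a, b)) z) =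
    (LINT z|(mu dX \<Otimes>\<^sub>M mu dY). complex_of_real (p s t a b) * chi2 dX dY n (s, t) z)"
  proof (intro Bochner_Integration.integral_cong refl)
    fix z assume "z \<in> space (mu dX \<Otimes>\<^sub>M mu dY)"
    then have z: "z \<in> Omega dX \<times> Omega dY" by (simp add: space_pair_measure)
    have "lift_corr dX dY dA dB n p (chi2 dA dB n (a, b)) z = (\<Sum>u\<in>level dA n \<times> level dB n.
      if u = (a, b) then complex_of_real (p (trunc n (fst z)) (trunc n (snd z)) (fst u) (snd u)) else 0)"
      unfolding lift_corr_eq[OF z]
      by (intro sum.cong refl)
         (auto simp: chi2_def tensor_expect_tens expect_chi_self[OF fam(3)] expect_chi_self[OF fam(4)]
          split: if_splits)
    also have "\<dots> = complex_of_real (p (trunc n (fst z)) (trunc n (snd z)) a b)"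
      using st by (subst sum.delta) auto
    finally show "chi2 dX dY n (s, t) z * lift_corr dX dY dA dB n p (chi2 dA dB n (a, b)) z =
      complex_of_real (p s t a b) * chi2 dX dY n (s, t) z"
      by (simp add: chi2_Omega[OF z])
  qed
  also have "\<dots> = complex_of_real (p s t a b) / (of_nat (card (level dX n)) * of_nat (card (level dY n)))"
    using integral_chi_pair[OF fam(1) st(1) fam(2) st(2)] by (simp add: chi2_def)
  finally show ?thesis
    unfolding cfin_def using level_nonempty[OF fam(1), of n] level_nonempty[OF fam(2), of n] by simp
qed

lemma lift_tens:
  assumes "z \<in> Omega dX \<times> Omega dY"
  shows "lift_corr dX dY dA dB n p (tens f g) z = (\<Sum>a\<in>level dA n. \<Sum>b\<in>level dB n.
    complex_of_real (p (trunc n (fst z)) (trunc n (snd z)) a b) * (expect dA n f a * expect dB n g b))"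
  unfolding lift_corr_eq[OF assms] tensor_expect_tens sum.cartesian_product
  by (simp add: case_prod_unfold)

section \<open>Tensor products of operators\<close>

lemma ell2_section:
  assumes "\<xi> \<in> ell2 (J \<times> K)"
  shows "(\<lambda>b. \<xi> (a, b)) \<in> ell2 K" and "a \<notin> J \<Longrightarrow> (\<lambda>b. \<xi> (a, b)) = (\<lambda>_. 0)"
    and "(\<lambda>a. (l2norm (\<lambda>b. \<xi> (a, b)))\<^sup>2) summable_on UNIV"
proof -
  have s: "(\<lambda>z. (cmod (\<xi> z))\<^sup>2) summable_on UNIV \<times> UNIV" using ell2_summable[OF assms] by simp
  have "(\<lambda>z. (cmod (\<xi> z))\<^sup>2) summable_on Pair a ` UNIV"
    by (rule summable_on_subset_banach[OF s]) auto
  hence "(\<lambda>b. (cmod (\<xi> (a, b)))\<^sup>2) summable_on UNIV"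
    by (subst (asm) summable_on_reindex) (auto simp: inj_on_def comp_def)
  thus "(\<lambda>b. \<xi> (a, b)) \<in> ell2 K" using ell2_outside[OF assms] by (auto simp: ell2_def)
  show "a \<notin> J \<Longrightarrow> (\<lambda>b. \<xi> (a, b)) = (\<lambda>_. 0)" using ell2_outside[OF assms] by (auto simp: fun_eq_iff)
  show "(\<lambda>a. (l2norm (\<lambda>b. \<xi> (a, b)))\<^sup>2) summable_on UNIV"
    unfolding l2norm_power2
    by (rule summable_on_Sigma_banach) (use s in \<open>simp add: case_prod_unfold\<close>)
qed

text \<open>This is the vector to which \<open>tensor_map\<close> applies its outer operator. Its
  entries are dominated by a multiple of the norms of the sections of \<xi>, whose squares are
  summable.\<close>

lemma tensor_inner_ell2:
  assumes T': "bounded_op K T'" and \<xi>: "\<xi> \<in> ell2 (J \<times> K)"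
  shows "(\<lambda>a. T' (\<lambda>b. \<xi> (a, b)) y) \<in> ell2 J"
proof -
  obtain C where C: "0 \<le> C" "\<And>v. v \<in> ell2 K \<Longrightarrow> l2norm (T' v) \<le> C * l2norm v"
    using bounded_op_bound[OF T'] by blast
  note sec = ell2_section[OF \<xi>]
  have "(cmod (T' (\<lambda>b. \<xi> (a, b)) y))\<^sup>2 \<le> C\<^sup>2 * (l2norm (\<lambda>b. \<xi> (a, b)))\<^sup>2" for a
    using order_trans[OF cmod_le_l2norm[OF bounded_opD(1)[OF T' sec(1)]] C(2)[OF sec(1)]]
    by (metis norm_ge_zero power_mono power_mult_distrib)
  then have "(\<lambda>a. (cmod (T' (\<lambda>b. \<xi> (a, b)) y))\<^sup>2) summable_on UNIV"
    by (intro summable_on_comparison_test[OF summable_on_cmult_right[OF sec(3)]]) auto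
  moreover have "T' (\<lambda>b. \<xi> (a, b)) y = 0" if "a \<notin> J" for a
    using sec(2)[OF that] bounded_op_zero[OF T'] by simp
  ultimately show ?thesis by (simp add: ell2_def)
qed

text \<open>Factors through the intermediate vector obtained from \<open>T'\<close> alone: the
  square norms of its rows \<open>\<eta> y\<close> add up to at most \<open>C'\<^sup>2 * B\<close>,
  and \<open>T\<close> acts on every row with bound \<open>C\<close>.\<close>

lemma tensor_map_ell2:
  assumes T: "bounded_op J T" and T': "bounded_op K T'" and \<xi>: "\<xi> \<in> ell2 (J \<times> K)"
  shows "tensor_map T T' \<xi> \<in> ell2 (J \<times> K)"
proof -
  obtain C where C: "0 \<le> C" "\<And>v. v \<in> ell2 J \<Longrightarrow> l2norm (T v) \<le> C * l2norm v"
    using bounded_op_bound[OF T] by blast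
  obtain C' where C': "0 \<le> C'" "\<And>v. v \<in> ell2 K \<Longrightarrow> l2norm (T' v) \<le> C' * l2norm v"
    using bounded_op_bound[OF T'] by blast
  note sec = ell2_section[OF \<xi>]
  define N where "N a = (l2norm (\<lambda>b. \<xi> (a, b)))\<^sup>2" for a
  define B where "B = (\<Sum>\<^sub>\<infinity>a. N a)"
  have N: "N summable_on UNIV" using sec(3) by (simp add: N_def[abs_def])
  have NB: "sum N A \<le> B" if "finite A" for A
    unfolding B_def by (rule finite_sum_le_infsum[OF N that]) (auto simp: N_def)
  have B0: "0 \<le> B" unfolding B_def by (rule infsum_nonneg) (simp add: N_def)
  define \<eta> where "\<eta> y = (\<lambda>a. T' (\<lambda>b. \<xi> (a, b)) y)" for y
  have \<eta>: "\<eta> y \<in> ell2 J" for y unfolding \<eta>_def by (rule tensor_inner_ell2[OF T' \<xi>])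
  have \<eta>sum: "(\<Sum>y\<in>Y. (l2norm (\<eta> y))\<^sup>2) \<le> C'\<^sup>2 * B" if Y: "finite Y" for Y
  proof (rule tendsto_upperbound)
    \<comment> \<open>Each row is an infinite sum. For a finite set \<open>A\<close> of columns the
      order of summation can be exchanged, and the resulting bound does not depend on
      \<open>A\<close>.\<close>
    show "((\<lambda>A. \<Sum>y\<in>Y. \<Sum>a\<in>A. (cmod (\<eta> y a))\<^sup>2) \<longlongrightarrow> (\<Sum>y\<in>Y. (l2norm (\<eta> y))\<^sup>2)) (finite_subsets_at_top UNIV)"
      unfolding l2norm_power2 by (intro tendsto_sum infsum_tendsto ell2_summable[OF \<eta>])
    show "\<forall>\<^sub>F A in finite_subsets_at_top UNIV. (\<Sum>y\<in>Y. \<Sum>a\<in>A. (cmod (\<eta> y a))\<^sup>2) \<le> C'\<^sup>2 * B"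
    proof (rule eventually_finite_subsets_at_top_weakI)
      fix A :: "'a set" assume A: "finite A"
      have "(\<Sum>y\<in>Y. \<Sum>a\<in>A. (cmod (\<eta> y a))\<^sup>2) = (\<Sum>a\<in>A. \<Sum>y\<in>Y. (cmod (T' (\<lambda>b. \<xi> (a, b)) y))\<^sup>2)"
        unfolding \<eta>_def by (rule sum.swap)
      also have "\<dots> \<le> (\<Sum>a\<in>A. C'\<^sup>2 * N a)"
      proof (rule sum_mono)
        fix a
        have "(\<Sum>y\<in>Y. (cmod (T' (\<lambda>b. \<xi> (a, b)) y))\<^sup>2) \<le> (l2norm (T' (\<lambda>b. \<xi> (a, b))))\<^sup>2"
          by (rule sum_le_l2norm[OF bounded_opD(1)[OF T' sec(1)] Y])
        also have "\<dots> \<le> (C' * l2norm (\<lambda>b. \<xi> (a, b)))\<^sup>2"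
          by (intro power_mono C'(2)[OF sec(1)]) simp
        finally show "(\<Sum>y\<in>Y. (cmod (T' (\<lambda>b. \<xi> (a, b)) y))\<^sup>2) \<le> C'\<^sup>2 * N a"
          by (simp add: N_def power_mult_distrib)
      qed
      also have "\<dots> \<le> C'\<^sup>2 * B"
        unfolding sum_distrib_left[symmetric] by (intro mult_left_mono NB A) simp
      finally show "(\<Sum>y\<in>Y. \<Sum>a\<in>A. (cmod (\<eta> y a))\<^sup>2) \<le> C'\<^sup>2 * B" .
    qed
  qed simp
  show ?thesis
  proof (rule ell2_bounded_sums(1)[where B = "C * (C' * sqrt B)"])
    show "0 \<le> C * (C' * sqrt B)" using C C' B0 by simp
    fix z :: "'a \<times> 'b" assume z: "z \<notin> J \<times> K"
    obtain x y where xy: "z = (x, y)" by (cases z)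
    show "tensor_map T T' \<xi> z = 0"
    proof (cases "x \<in> J")
      case False
      then show ?thesis using ell2_outside[OF bounded_opD(1)[OF T \<eta>[of y]]]
        by (simp add: xy tensor_map_def \<eta>_def)
    next
      case True
      then have "y \<notin> K" using z xy by simp
      then have "\<eta> y = (\<lambda>_. 0)"
        unfolding \<eta>_def using ell2_outside[OF bounded_opD(1)[OF T' sec(1)]] by blast
      then show ?thesis using bounded_op_zero[OF T] by (simp add: xy tensor_map_def \<eta>_def)
    qed
  next
    fix S :: "('a \<times> 'b) set" assume S: "finite S"
    \<comment> \<open>A finite set of pairs is enlarged to the rectangle of its projections, where
      the sum can be organised by rows.\<close>
    have "(\<Sum>z\<in>S. (cmod (tensor_map T T' \<xi> z))\<^sup>2) \<le>
        (\<Sum>z\<in>fst ` S \<times> snd ` S. (cmod (tensor_map T T' \<xi> z))\<^sup>2)"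
      using S by (intro sum_mono2) (auto simp: image_iff, force+)
    also have "\<dots> = (\<Sum>x\<in>fst ` S. \<Sum>y\<in>snd ` S. (cmod (tensor_map T T' \<xi> (x, y)))\<^sup>2)"
      by (simp add: sum.cartesian_product)
    also have "\<dots> = (\<Sum>y\<in>snd ` S. \<Sum>x\<in>fst ` S. (cmod (T (\<eta> y) x))\<^sup>2)"
      by (subst sum.swap) (simp add: tensor_map_def \<eta>_def)
    also have "\<dots> \<le> (\<Sum>y\<in>snd ` S. C\<^sup>2 * (l2norm (\<eta> y))\<^sup>2)"
    proof (rule sum_mono)
      fix y
      have "(\<Sum>x\<in>fst ` S. (cmod (T (\<eta> y) x))\<^sup>2) \<le> (l2norm (T (\<eta> y)))\<^sup>2"
        by (rule sum_le_l2norm[OF bounded_opD(1)[OF T \<eta>]]) (use S in simp)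
      also have "\<dots> \<le> (C * l2norm (\<eta> y))\<^sup>2" by (intro power_mono C(2)[OF \<eta>]) simp
      finally show "(\<Sum>x\<in>fst ` S. (cmod (T (\<eta> y) x))\<^sup>2) \<le> C\<^sup>2 * (l2norm (\<eta> y))\<^sup>2"
        by (simp add: power_mult_distrib)
    qed
    also have "\<dots> \<le> C\<^sup>2 * (C'\<^sup>2 * B)"
      unfolding sum_distrib_left[symmetric] by (intro mult_left_mono \<eta>sum) (use S in auto)
    also have "\<dots> = (C * (C' * sqrt B))\<^sup>2" using B0 by (simp add: power_mult_distrib)
    finally show "(\<Sum>z\<in>S. (cmod (tensor_map T T' \<xi> z))\<^sup>2) \<le> (C * (C' * sqrt B))\<^sup>2" .
  qed
qed

lemma bounded_op_lincomb:
  assumes T: "bounded_op J T" and v: "\<And>k. k \<in> A \<Longrightarrow> v k \<in> ell2 J"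
  shows "T (\<lambda>i. \<Sum>k\<in>A. c k * v k i) = (\<lambda>i. \<Sum>k\<in>A. c k * T (v k) i)"
proof -
  have "T (\<lambda>i. \<Sum>k\<in>A. c k * v k i) = (\<lambda>i. \<Sum>k\<in>A. T (\<lambda>i. c k * v k i) i)"
    by (rule bounded_op_sum[OF T]) (use v l2norm_scale(1) in blast)
  also have "\<dots> = (\<lambda>i. \<Sum>k\<in>A. c k * T (v k) i)"
    using bounded_opD(3)[OF T v] by simp
  finally show ?thesis .
qed

text \<open>Linearity in the first factor is pointwise. In the second it relies on
  \<open>tensor_inner_ell2\<close>: operators are linear only on \<open>ell2 J\<close>, so the inner
  vectors must lie there.\<close>

lemma tensor_map_combination:
  fixes \<xi> :: "'a \<times> 'b \<Rightarrow> complex"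
  assumes T: "\<And>k. k \<in> A \<Longrightarrow> bounded_op J (T k)" and T': "\<And>l. l \<in> B \<Longrightarrow> bounded_op K (T' l)"
    and \<xi>: "\<xi> \<in> ell2 (J \<times> K)"
  shows "tensor_map (\<lambda>v i. \<Sum>k\<in>A. c k * T k v i) (\<lambda>w j. \<Sum>l\<in>B. c' l * T' l w j) \<xi> =
    (\<lambda>z. \<Sum>k\<in>A. \<Sum>l\<in>B. c k * c' l * tensor_map (T k) (T' l) \<xi> z)"
proof
  fix z :: "'a \<times> 'b"
  obtain x y where z: "z = (x, y)" by (cases z)
  have "T k (\<lambda>a. \<Sum>l\<in>B. c' l * T' l (\<lambda>b. \<xi> (a, b)) y) =
      (\<lambda>x. \<Sum>l\<in>B. c' l * T k (\<lambda>a. T' l (\<lambda>b. \<xi> (a, b)) y) x)" if "k \<in> A" for k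
    by (rule bounded_op_lincomb[OF T[OF that]]) (rule tensor_inner_ell2[OF T' \<xi>])
  then show "tensor_map (\<lambda>v i. \<Sum>k\<in>A. c k * T k v i) (\<lambda>w j. \<Sum>l\<in>B. c' l * T' l w j) \<xi> z =
    (\<Sum>k\<in>A. \<Sum>l\<in>B. c k * c' l * tensor_map (T k) (T' l) \<xi> z)"
    by (simp add: z tensor_map_def sum_distrib_left mult.assoc)
qed

lemma ip_tensor_combination:
  fixes \<xi> :: "'a \<times> 'b \<Rightarrow> complex"
  assumes T: "\<And>k. k \<in> A \<Longrightarrow> bounded_op J (T k)" and T': "\<And>l. l \<in> B \<Longrightarrow> bounded_op K (T' l)"
    and \<xi>: "\<xi> \<in> ell2 (J \<times> K)"
  shows "ip (tensor_map (\<lambda>v i. \<Sum>k\<in>A. c k * T k v i) (\<lambda>w j. \<Sum>l\<in>B. c' l * T' l w j) \<xi>) \<xi> =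
    (\<Sum>k\<in>A. \<Sum>l\<in>B. c k * c' l * ip (tensor_map (T k) (T' l) \<xi>) \<xi>)"
proof -
  have t: "(\<lambda>z. c k * c' l * tensor_map (T k) (T' l) \<xi> z) \<in> ell2 (J \<times> K)" if "k \<in> A" "l \<in> B" for k l
    by (rule l2norm_scale(1)[OF tensor_map_ell2[OF T[OF that(1)] T'[OF that(2)] \<xi>]])
  have "ip (\<lambda>z. \<Sum>k\<in>A. \<Sum>l\<in>B. c k * c' l * tensor_map (T k) (T' l) \<xi> z) \<xi> =
    (\<Sum>k\<in>A. ip (\<lambda>z. \<Sum>l\<in>B. c k * c' l * tensor_map (T k) (T' l) \<xi> z) \<xi>)"
    by (rule ip_sum_left[OF _ \<xi>]) (rule ell2_sum[OF t])
  also have "\<dots> = (\<Sum>k\<in>A. \<Sum>l\<in>B. ip (\<lambda>z. c k * c' l * tensor_map (T k) (T' l) \<xi> z) \<xi>)"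
    by (intro sum.cong refl ip_sum_left[OF _ \<xi>] t)
  also have "(\<lambda>z. \<Sum>k\<in>A. \<Sum>l\<in>B. c k * c' l * tensor_map (T k) (T' l) \<xi> z) =
      tensor_map (\<lambda>v i. \<Sum>k\<in>A. c k * T k v i) (\<lambda>w j. \<Sum>l\<in>B. c' l * T' l w j) \<xi>"
    by (rule tensor_map_combination[OF T T' \<xi>, symmetric])
  finally show ?thesis
    unfolding ip_scale_left .
qed

section \<open>Lifting local and no-signalling correlations\<close>

lemma Linf_trunc: "(\<lambda>\<omega>. H (trunc n \<omega>)) \<in> Linf (mu d)"
proof -
  have "cmod (H (trunc n \<omega>)) \<le> (\<Sum>s\<in>level d n. cmod (H s))" if "\<omega> \<in> Omega d" for \<omega>
    using member_le_sum[of "trunc n \<omega>" "level d n" "\<lambda>s. cmod (H s)"] trunc_in_level[OF that] by simp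
  then show ?thesis
    unfolding Linf_def by (intro CollectI conjI measurable_trunc exI AE_I2) simp
qed

lemma ucp_Linf_step_expect:
  assumes fam: "inductive_family d'" and q: "cond_dist (level d n) (level d' n) q"
  shows "ucp_Linf (Omega d') (mu d) (\<lambda>f \<omega>. \<Sum>a\<in>level d' n. complex_of_real (q (trunc n \<omega>) a) * expect d' n f a)"
proof (rule ucp_Linf_step[where U = "level d' n" and w = "\<lambda>\<omega>. q (trunc n \<omega>)" and e = "\<lambda>a f. expect d' n f a"])
  fix \<omega> assume "\<omega> \<in> space (mu d)"
  then have "trunc n \<omega> \<in> level d n" using trunc_in_level by simp
  note q' = q[unfolded cond_dist_def, rule_format, OF this]
  show "0 \<le> q (trunc n \<omega>) a" if "a \<in> level d' n" for a using q' that by blast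
  show "(\<Sum>a\<in>level d' n. q (trunc n \<omega>) a) = 1" using q' by blast
qed (use cp_state_expect[OF fam] measurable_trunc in auto)

text \<open>Lifting is linear in \<open>p\<close>, and a product distribution lifts to a product of
  one-party step maps; the weights \<open>c\<close> are kept.\<close>

lemma lift_loc:
  assumes fam: "inductive_family dA" "inductive_family dB"
    and p: "fin_loc (level dX n) (level dY n) (level dA n) (level dB n) p"
  shows "cantor_loc dX dY dA dB (lift_corr dX dY dA dB n p)"
proof -
  obtain m c p1 p2 where
    pc: "\<forall>k<(m::nat). 0 \<le> c k \<and> cond_dist (level dX n) (level dA n) (p1 k) \<and> cond_dist (level dY n) (level dB n) (p2 k)"
    and c1: "(\<Sum>k<m. c k) = 1"
    and pe: "\<forall>s\<in>level dX n. \<forall>t\<in>level dY n. \<forall>u\<in>level dA n. \<forall>v\<in>level dB n. p s t u v = (\<Sum>k<m. c k * p1 k s u * p2 k t v)"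
    using p unfolding fin_loc_def by blast
  define \<Phi> where "\<Phi> k f \<omega> = (\<Sum>a\<in>level dA n. complex_of_real (p1 k (trunc n \<omega>) a) * expect dA n f a)" for k f \<omega>
  define \<Psi> where "\<Psi> k f \<omega> = (\<Sum>a\<in>level dB n. complex_of_real (p2 k (trunc n \<omega>) a) * expect dB n f a)" for k f \<omega>
  have ucp: "ucp_Linf (Omega dA) (mu dX) (\<Phi> k) \<and> ucp_Linf (Omega dB) (mu dY) (\<Psi> k)" if "k < m" for k
    unfolding \<Phi>_def \<Psi>_def using pc that by (intro conjI ucp_Linf_step_expect fam) auto
  have "lift_corr dX dY dA dB n p (tens f g) z = (\<Sum>k<m. complex_of_real (c k) * tens (\<Phi> k f) (\<Psi> k g) z)"
    if z: "z \<in> Omega dX \<times> Omega dY" for f g z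
  proof -
    define s t where "s = trunc n (fst z)" and "t = trunc n (snd z)"
    have st: "s \<in> level dX n" "t \<in> level dY n" using z trunc_in_level by (auto simp: s_def t_def)
    have "lift_corr dX dY dA dB n p (tens f g) z = (\<Sum>a\<in>level dA n. \<Sum>b\<in>level dB n.
        complex_of_real (\<Sum>k<m. c k * p1 k s a * p2 k t b) * (expect dA n f a * expect dB n g b))"
      unfolding lift_tens[OF z] s_def[symmetric] t_def[symmetric]
      using pe st by (intro sum.cong refl) simp
    also have "\<dots> = (\<Sum>a\<in>level dA n. \<Sum>b\<in>level dB n. \<Sum>k<m. complex_of_real (c k) *
        ((complex_of_real (p1 k s a) * expect dA n f a) * (complex_of_real (p2 k t b) * expect dB n g b)))"
      by (simp add: sum_distrib_left sum_distrib_right mult_ac)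
    also have "\<dots> = (\<Sum>a\<in>level dA n. \<Sum>k<m. \<Sum>b\<in>level dB n. complex_of_real (c k) *
        ((complex_of_real (p1 k s a) * expect dA n f a) * (complex_of_real (p2 k t b) * expect dB n g b)))"
      by (intro sum.cong refl sum.swap)
    also have "\<dots> = (\<Sum>k<m. \<Sum>a\<in>level dA n. \<Sum>b\<in>level dB n. complex_of_real (c k) *
        ((complex_of_real (p1 k s a) * expect dA n f a) * (complex_of_real (p2 k t b) * expect dB n g b)))"
      by (rule sum.swap)
    also have "\<dots> = (\<Sum>k<m. complex_of_real (c k) * tens (\<Phi> k f) (\<Psi> k g) z)"
      by (simp add: tens_def \<Phi>_def \<Psi>_def case_prod_unfold s_def t_def sum_product)
         (simp add: sum_distrib_left)
    finally show ?thesis .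
  qed
  then show ?thesis
    unfolding cantor_loc_def using pc c1 ucp
    by (intro exI[of _ m] exI[of _ c] exI[of _ \<Phi>] exI[of _ \<Psi>] conjI allI impI ballI AE_I2)
       (auto simp: space_pair_measure)
qed

lemma expect_one: "inductive_family d \<Longrightarrow> a \<in> level d n \<Longrightarrow> expect d n (\<lambda>_. 1) a = 1"
  by (rule cp_stateD(3)[OF cp_state_expect])

lemma lift_ns:
  assumes fam: "inductive_family dX" "inductive_family dY" "inductive_family dA" "inductive_family dB"
    and p: "fin_ns (level dX n) (level dY n) (level dA n) (level dB n) p"
  shows "cantor_ns dX dY dA dB (lift_corr dX dY dA dB n p)"
proof -
  \<comment> \<open>Reference questions, the word of ones in either family. As a marginal does not
    depend on the other party's question, it may be evaluated there, which makes it a function of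
    one variable.\<close>
  define s0 t0 where "s0 = trunc n (\<lambda>_. 1::nat)" and "t0 = trunc n (\<lambda>_. 1::nat)"
  have s0: "s0 \<in> level dX n" "t0 \<in> level dY n"
    using trunc_in_level[OF Omega_nonempty] fam by (auto simp: s0_def t0_def)
  note ns = p[unfolded fin_ns_def]
  show ?thesis
    unfolding cantor_ns_def
  proof (intro conjI ballI)
    fix f assume "f \<in> Cfun (Omega dA)"
    show "\<exists>h\<in>Linf (mu dX). AE z in mu dX \<Otimes>\<^sub>M mu dY. lift_corr dX dY dA dB n p (tens f (\<lambda>_. 1)) z = tens h (\<lambda>_. 1) z"
    proof (intro bexI AE_I2)
      show "(\<lambda>\<omega>. (\<lambda>s. \<Sum>a\<in>level dA n. complex_of_real (\<Sum>b\<in>level dB n. p s t0 a b) * expect dA n f a) (trunc n \<omega>)) \<in> Linf (mu dX)"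
        by (rule Linf_trunc)
      fix z assume "z \<in> space (mu dX \<Otimes>\<^sub>M mu dY)"
      then have z: "z \<in> Omega dX \<times> Omega dY" by (simp add: space_pair_measure)
      then have st: "trunc n (fst z) \<in> level dX n" "trunc n (snd z) \<in> level dY n" using trunc_in_level by auto
      have "lift_corr dX dY dA dB n p (tens f (\<lambda>_. 1)) z =
        (\<Sum>a\<in>level dA n. complex_of_real (\<Sum>b\<in>level dB n. p (trunc n (fst z)) (trunc n (snd z)) a b) * expect dA n f a)"
        unfolding lift_tens[OF z] by (simp add: expect_one[OF fam(4)] sum_distrib_right)
      also have "\<dots> = (\<Sum>a\<in>level dA n. complex_of_real (\<Sum>b\<in>level dB n. p (trunc n (fst z)) t0 a b) * expect dA n f a)"
        by (rule sum.cong[OF refl])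
           (simp only: conjunct1[OF ns, rule_format, OF st s0(2)])
      finally show "lift_corr dX dY dA dB n p (tens f (\<lambda>_. 1)) z =
        tens (\<lambda>\<omega>. (\<lambda>s. \<Sum>a\<in>level dA n. complex_of_real (\<Sum>b\<in>level dB n. p s t0 a b) * expect dA n f a) (trunc n \<omega>)) (\<lambda>_. 1) z"
        by (simp add: tens_def case_prod_unfold)
    qed
  next
    fix f assume "f \<in> Cfun (Omega dB)"
    show "\<exists>h\<in>Linf (mu dY). AE z in mu dX \<Otimes>\<^sub>M mu dY. lift_corr dX dY dA dB n p (tens (\<lambda>_. 1) f) z = tens (\<lambda>_. 1) h z"
    proof (intro bexI AE_I2)
      show "(\<lambda>\<omega>. (\<lambda>t. \<Sum>b\<in>level dB n. complex_of_real (\<Sum>a\<in>level dA n. p s0 t a b) * expect dB n f b) (trunc n \<omega>)) \<in> Linf (mu dY)"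
        by (rule Linf_trunc)
      fix z assume "z \<in> space (mu dX \<Otimes>\<^sub>M mu dY)"
      then have z: "z \<in> Omega dX \<times> Omega dY" by (simp add: space_pair_measure)
      then have st: "trunc n (fst z) \<in> level dX n" "trunc n (snd z) \<in> level dY n" using trunc_in_level by auto
      have "lift_corr dX dY dA dB n p (tens (\<lambda>_. 1) f) z =
        (\<Sum>b\<in>level dB n. complex_of_real (\<Sum>a\<in>level dA n. p (trunc n (fst z)) (trunc n (snd z)) a b) * expect dB n f b)"
        unfolding lift_tens[OF z] by (subst sum.swap) (simp add: expect_one[OF fam(3)] sum_distrib_right)
      also have "\<dots> = (\<Sum>b\<in>level dB n. complex_of_real (\<Sum>a\<in>level dA n. p s0 (trunc n (snd z)) a b) * expect dB n f b)"
        by (rule sum.cong[OF refl])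
           (simp only: conjunct2[OF ns, rule_format, OF st(1) s0(1) st(2)])
      finally show "lift_corr dX dY dA dB n p (tens (\<lambda>_. 1) f) z =
        tens (\<lambda>_. 1) (\<lambda>\<omega>. (\<lambda>t. \<Sum>b\<in>level dB n. complex_of_real (\<Sum>a\<in>level dA n. p s0 t a b) * expect dB n f b) (trunc n \<omega>)) z"
        by (simp add: tens_def case_prod_unfold)
    qed
  qed
qed

section \<open>Quantum models\<close>

text \<open>The body of \<open>fin_qs\<close> with its witnesses as arguments and free index types,
  so that a given model can be moved to other Hilbert spaces.\<close>

definition qs_model where
  "qs_model J K \<xi> P Q S T U V p \<longleftrightarrow>
     \<xi> \<in> ell2 (J \<times> K) \<and> l2norm \<xi> = 1 \<and>
     (\<forall>s\<in>S. povm J U (P s)) \<and> (\<forall>t\<in>T. povm K V (Q t)) \<and>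
     (\<forall>s\<in>S. \<forall>t\<in>T. \<forall>u\<in>U. \<forall>v\<in>V.
        complex_of_real (p s t u v) = ip (tensor_map (P s u) (Q t v) \<xi>) \<xi>)"

definition qc_model where
  "qc_model J \<xi> P Q S T U V p \<longleftrightarrow>
     \<xi> \<in> ell2 J \<and> l2norm \<xi> = 1 \<and>
     (\<forall>s\<in>S. povm J U (P s)) \<and> (\<forall>t\<in>T. povm J V (Q t)) \<and>
     (\<forall>s\<in>S. \<forall>t\<in>T. \<forall>u\<in>U. \<forall>v\<in>V.
        (\<forall>w\<in>ell2 J. P s u (Q t v w) = Q t v (P s u w)) \<and>
        complex_of_real (p s t u v) = ip (P s u (Q t v \<xi>)) \<xi>)"

lemma fin_qs_iff: "fin_qs TYPE('i) S T U V p \<longleftrightarrow>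
    (\<exists>(J :: 'i set) (K :: 'i set) \<xi> P Q. qs_model J K \<xi> P Q S T U V p)"
  unfolding fin_qs_def qs_model_def ..

lemma fin_qc_iff: "fin_qc TYPE('i) S T U V p \<longleftrightarrow>
    (\<exists>(J :: 'i set) \<xi> P Q. qc_model J \<xi> P Q S T U V p)"
  unfolding fin_qc_def qc_model_def ..

lemma povmD:
  assumes "povm J U P"
  shows "u \<in> U \<Longrightarrow> bounded_op J (P u)" and "u \<in> U \<Longrightarrow> v \<in> ell2 J \<Longrightarrow> ip (P u v) v \<in> \<real>\<^sub>\<ge>\<^sub>0"
    and "v \<in> ell2 J \<Longrightarrow> (\<lambda>i. \<Sum>u\<in>U. P u v i) = v"
  using assms unfolding povm_def by blast+

text \<open>The operator version of the weighted sums in \<open>ucp_Linf_step\<close>: the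
  probability weights are replaced by the POVM belonging to the cylinder of \<omega>.\<close>

definition step_field :: "nat \<Rightarrow> 'u set \<Rightarrow> ('u \<Rightarrow> ('a \<Rightarrow> complex) \<Rightarrow> complex) \<Rightarrow>
    ((nat \<Rightarrow> nat) \<Rightarrow> 'u \<Rightarrow> (nat \<Rightarrow> complex) \<Rightarrow> nat \<Rightarrow> complex) \<Rightarrow>
    ('a \<Rightarrow> complex) \<Rightarrow> (nat \<Rightarrow> nat) \<Rightarrow> (nat \<Rightarrow> complex) \<Rightarrow> nat \<Rightarrow> complex" where
  "step_field n U e P f \<omega> v = (\<lambda>i. \<Sum>u\<in>U. e u f * P (trunc n \<omega>) u v i)"

text \<open>The field is constant on each of finitely many cylinders. Hence it already lies in the
  algebraic tensor product and is its own approximant in the weak closure.\<close>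

lemma step_field_vn_tensor:
  assumes U: "finite U" and P: "\<And>s. s \<in> level d n \<Longrightarrow> povm J U (P s)"
  shows "step_field n U e P f \<in> vn_tensor (mu d) J"
proof -
  have tl: "trunc n \<omega> \<in> level d n" if "\<omega> \<in> space (mu d)" for \<omega>
    using trunc_in_level that by simp
  define R where "R s = (\<lambda>v i. \<Sum>u\<in>U. e u f * P s u v i)" for s
  have step: "step_field n U e P f \<omega> = R (trunc n \<omega>)" for \<omega>
    by (simp add: R_def step_field_def fun_eq_iff)
  have Rb: "bounded_op J (R s)" "\<exists>C. \<forall>v\<in>ell2 J. l2norm (R s v) \<le> C * l2norm v"
    if "s \<in> level d n" for s
    unfolding R_def by (rule bounded_op_combination[OF U], rule povmD(1)[OF P[OF that]], assumption)+
  obtain C where C: "\<And>s v. s \<in> level d n \<Longrightarrow> v \<in> ell2 J \<Longrightarrow> l2norm (R s v) \<le> C s * l2norm v"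
    using Rb(2) by metis
  have op: "step_field n U e P f \<in> opfield (mu d) J"
    unfolding opfield_def mem_Collect_eq
  proof (intro conjI ballI)
    show "bounded_op J (step_field n U e P f \<omega>)" if "\<omega> \<in> space (mu d)" for \<omega>
      unfolding step by (rule Rb(1)[OF tl[OF that]])
    show "(\<lambda>\<omega>. ip (step_field n U e P f \<omega> v) w) \<in> borel_measurable (mu d)" for v w
      unfolding step by (rule measurable_trunc[where f = "\<lambda>s. ip (R s v) w"])
    show "\<exists>C. AE \<omega> in mu d. \<forall>v\<in>ell2 J. l2norm (step_field n U e P f \<omega> v) \<le> C * l2norm v"
    proof (intro exI AE_I2 ballI)
      fix \<omega> v assume \<omega>: "\<omega> \<in> space (mu d)" and v: "v \<in> ell2 J"
      have "C (trunc n \<omega>) \<le> (\<Sum>s\<in>level d n. \<bar>C s\<bar>)"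
        using member_le_sum[of "trunc n \<omega>" "level d n" "\<lambda>s. \<bar>C s\<bar>"] tl[OF \<omega>] by simp
      then show "l2norm (step_field n U e P f \<omega> v) \<le> (\<Sum>s\<in>level d n. \<bar>C s\<bar>) * l2norm v"
        unfolding step using order_trans[OF C[OF tl[OF \<omega>] v] mult_right_mono] by simp
    qed
  qed
  \<comment> \<open>\<open>alg_tensor\<close> indexes its summands by an initial segment of the
    naturals, so the words of level \<open>n\<close> are enumerated.\<close>
  obtain b where b: "bij_betw b {..<card (level d n)} (level d n)"
    using ex_bij_betw_nat_finite[of "level d n"] by (auto simp: lessThan_atLeast0)
  have bl: "b k \<in> level d n" if "k < card (level d n)" for k using bij_betwE[OF b] that by simp
  have "step_field n U e P f \<in> alg_tensor (mu d) J"
    unfolding alg_tensor_def mem_Collect_eq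
  proof (intro conjI op exI AE_I2 allI impI ballI)
    fix k assume k: "k < card (level d n)"
    show "bounded_op J (R (b k))" by (rule Rb(1)[OF bl[OF k]])
    show "(\<lambda>\<omega>. (\<lambda>s. if s = b k then 1 else 0) (trunc n \<omega>)) \<in> Linf (mu d)" by (rule Linf_trunc)
  next
    fix \<omega> v assume \<omega>: "\<omega> \<in> space (mu d)"
    show "step_field n U e P f \<omega> v =
      (\<lambda>i. \<Sum>k<card (level d n). (\<lambda>s. if s = b k then 1 else 0) (trunc n \<omega>) * R (b k) v i)"
    proof
      fix i
      have "(\<Sum>k<card (level d n). (if trunc n \<omega> = b k then 1 else 0) * R (b k) v i) =
        (\<Sum>s\<in>level d n. (if trunc n \<omega> = s then 1 else 0) * R s v i)"
        by (rule sum.reindex_bij_betw[OF b])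
      also have "\<dots> = (\<Sum>s\<in>level d n. if trunc n \<omega> = s then R s v i else 0)"
        by (intro sum.cong) auto
      also have "\<dots> = R (trunc n \<omega>) v i" using tl[OF \<omega>] by simp
      finally show "step_field n U e P f \<omega> v i =
        (\<Sum>k<card (level d n). (\<lambda>s. if s = b k then 1 else 0) (trunc n \<omega>) * R (b k) v i)"
        by (simp add: step)
    qed
  qed
  then show ?thesis
    unfolding vn_tensor_def using op by (auto intro!: bexI[of _ "step_field n U e P f"])
qed

text \<open>For each answer \<open>u\<close>, the positivity test sums the entrywise product of the
  matrix of \<open>e u (F i j)\<close> with that of \<open>ip (P s u (v j)) (v i)\<close>. Both are
  positive semidefinite, so \<open>psd_schur_sum\<close> applies.\<close>

lemma ucp_vn_step:
  assumes U: "finite U" and e: "\<And>u. u \<in> U \<Longrightarrow> cp_state K (e u)"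
    and P: "\<And>s. s \<in> level d n \<Longrightarrow> povm J U (P s)"
  shows "ucp_vn K (mu d) J (step_field n U e P)"
  unfolding ucp_vn_def
proof (intro conjI ballI allI impI)
  fix f assume f: "f \<in> Cfun K"
  show "step_field n U e P f \<in> vn_tensor (mu d) J" by (rule step_field_vn_tensor[OF U P])
  show "AE x in mu d. \<forall>v\<in>ell2 J. step_field n U e P (\<lambda>a. f a + g a) x v =
      (\<lambda>i. step_field n U e P f x v i + step_field n U e P g x v i)" if "g \<in> Cfun K" for g
    by (rule AE_I2) (simp add: step_field_def cp_stateD(1)[OF e f that] sum.distrib distrib_right)
  show "AE x in mu d. \<forall>v\<in>ell2 J. step_field n U e P (\<lambda>a. c * f a) x v =
      (\<lambda>i. c * step_field n U e P f x v i)" for c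
    by (rule AE_I2) (simp add: step_field_def cp_stateD(2)[OF e f] sum_distrib_left mult.assoc)
next
  show "AE x in mu d. \<forall>v\<in>ell2 J. step_field n U e P (\<lambda>_. 1) x v = v"
  proof (rule AE_I2, rule ballI)
    fix x v assume x: "x \<in> space (mu d)" and v: "v \<in> ell2 J"
    have "trunc n x \<in> level d n" using x trunc_in_level by simp
    from povmD(3)[OF P[OF this] v] show "step_field n U e P (\<lambda>_. 1) x v = v"
      by (simp add: step_field_def cp_stateD(3)[OF e])
  qed
next
  fix m F assume F: "(\<forall>i<m. \<forall>j<m. F i j \<in> Cfun K) \<and> (\<forall>a\<in>K. psd m (\<lambda>i j. F i j a))"
  show "AE x in mu d. psd_op J m (\<lambda>i j. step_field n U e P (F i j) x)"
  proof (rule AE_I2)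
    fix x assume x: "x \<in> space (mu d)"
    define s where "s = trunc n x"
    have s: "s \<in> level d n" using x trunc_in_level by (simp add: s_def)
    note P' = povmD[OF P[OF s]]
    show "psd_op J m (\<lambda>i j. step_field n U e P (F i j) x)"
      unfolding psd_op_def
    proof (intro allI impI)
      fix v :: "nat \<Rightarrow> nat \<Rightarrow> complex" assume "\<forall>i<m. v i \<in> ell2 J"
      then have v: "v i \<in> ell2 J" if "i < m" for i using that by simp
      have "ip (step_field n U e P (F i j) x (v j)) (v i) = (\<Sum>u\<in>U. e u (F i j) * ip (P s u (v j)) (v i))"
        if ij: "i < m" "j < m" for i j
      proof -
        have "ip (\<lambda>k. \<Sum>u\<in>U. e u (F i j) * P s u (v j) k) (v i) = (\<Sum>u\<in>U. ip (\<lambda>k. e u (F i j) * P s u (v j) k) (v i))"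
          by (rule ip_sum_left[OF _ v[OF ij(1)]])
             (rule l2norm_scale(1)[OF bounded_opD(1)[OF P'(1) v[OF ij(2)]]])
        then show ?thesis by (simp add: step_field_def ip_scale_left s_def)
      qed
      then have "(\<Sum>i<m. \<Sum>j<m. ip (step_field n U e P (F i j) x (v j)) (v i)) =
          (\<Sum>i<m. \<Sum>j<m. \<Sum>u\<in>U. e u (F i j) * ip (P s u (v j)) (v i))"
        by simp
      also have "\<dots> = (\<Sum>i<m. \<Sum>u\<in>U. \<Sum>j<m. e u (F i j) * ip (P s u (v j)) (v i))"
        by (intro sum.cong refl sum.swap)
      also have "\<dots> = (\<Sum>u\<in>U. \<Sum>i<m. \<Sum>j<m. e u (F i j) * ip (P s u (v j)) (v i))"
        by (rule sum.swap)
      also have "\<dots> \<in> \<real>\<^sub>\<ge>\<^sub>0"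
      proof (rule nonneg_Reals_sum_I, rule psd_schur_sum)
        fix u assume u: "u \<in> U"
        show "psd m (\<lambda>i j. e u (F i j))" by (rule cp_stateD(4)[OF e[OF u]]) (use F in auto)
        show "psd m (\<lambda>i j. ip (P s u (v j)) (v i))"
          by (rule psd_positive_op[OF P'(1)[OF u] _ v]) (use P'(2)[OF u] in auto)
      qed
      finally show "(\<Sum>i<m. \<Sum>j<m. ip (step_field n U e P (F i j) x (v j)) (v i)) \<in> \<real>\<^sub>\<ge>\<^sub>0" .
    qed
  qed
qed

section \<open>Slices of step fields and pairings with the lift\<close>

lemma integrable_times_chi:
  assumes "integrable (mu d) g"
  shows "integrable (mu d) (\<lambda>\<omega>. g \<omega> * chi d n s \<omega>)"
proof (rule Bochner_Integration.integrable_bound[OF assms])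
  have "g \<in> borel_measurable (mu d)" using assms by simp
  then show "(\<lambda>\<omega>. g \<omega> * chi d n s \<omega>) \<in> borel_measurable (mu d)" by measurable
qed (auto simp: chi_def)

lemma integral_trunc:
  assumes "integrable (mu d) g"
  shows "(LINT \<omega>|mu d. g \<omega> * H (trunc n \<omega>)) = (\<Sum>s\<in>level d n. (LINT \<omega>|mu d. g \<omega> * chi d n s \<omega>) * H s)"
proof -
  have "(LINT \<omega>|mu d. g \<omega> * H (trunc n \<omega>)) = (LINT \<omega>|mu d. (\<Sum>s\<in>level d n. (g \<omega> * chi d n s \<omega>) * H s))"
  proof (intro Bochner_Integration.integral_cong refl)
    fix \<omega> assume "\<omega> \<in> space (mu d)"
    then have "H (trunc n \<omega>) = (\<Sum>s\<in>level d n. H s * chi d n s \<omega>)" by (intro cyl_eq_chi) simp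
    then show "g \<omega> * H (trunc n \<omega>) = (\<Sum>s\<in>level d n. (g \<omega> * chi d n s \<omega>) * H s)"
      by (simp add: sum_distrib_left mult_ac)
  qed
  also have "\<dots> = (\<Sum>s\<in>level d n. (LINT \<omega>|mu d. (g \<omega> * chi d n s \<omega>) * H s))"
    using integrable_times_chi[OF assms] by (intro Bochner_Integration.integral_sum) auto
  finally show ?thesis by simp
qed

lemma product_integral:
  fixes f :: "'a \<Rightarrow> complex" and g :: "'b \<Rightarrow> complex"
  assumes "sigma_finite_measure M" "sigma_finite_measure N" and f: "integrable M f" and g: "integrable N g"
  shows "integrable (M \<Otimes>\<^sub>M N) (tens f g)" "(LINT z|(M \<Otimes>\<^sub>M N). tens f g z) = (LINT x|M. f x) * (LINT y|N. g y)"
proof -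
  interpret pair_sigma_finite M N using assms(1,2) by (simp add: pair_sigma_finite_def)
  have [measurable]: "f \<in> borel_measurable M" "g \<in> borel_measurable N" using f g by auto
  show int: "integrable (M \<Otimes>\<^sub>M N) (tens f g)"
  proof (rule Fubini_integrable)
    show "tens f g \<in> borel_measurable (M \<Otimes>\<^sub>M N)" unfolding tens_def by measurable
    show "integrable M (\<lambda>x. LINT y|N. cmod (tens f g (x, y)))"
      using f by (simp add: tens_def norm_mult)
    show "AE x in M. integrable N (\<lambda>y. tens f g (x, y))"
      using g by (simp add: tens_def)
  qed
  show "(LINT z|(M \<Otimes>\<^sub>M N). tens f g z) = (LINT x|M. f x) * (LINT y|N. g y)"
    using integral_fst'[OF int] by (simp add: tens_def)
qed

text \<open>A slice of a step field is a finite combination of POVM elements. Question and answer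
  form one index, as \<open>ip_tensor_combination\<close> requires.\<close>

lemma slice_step:
  assumes "integrable (mu d) g"
  shows "slice (mu d) g (step_field n U e P f) v =
    (\<lambda>i. \<Sum>k\<in>level d n \<times> U. ((LINT \<omega>|mu d. g \<omega> * chi d n (fst k) \<omega>) * e (snd k) f) * P (fst k) (snd k) v i)"
proof
  fix i
  show "slice (mu d) g (step_field n U e P f) v i =
    (\<Sum>k\<in>level d n \<times> U. ((LINT \<omega>|mu d. g \<omega> * chi d n (fst k) \<omega>) * e (snd k) f) * P (fst k) (snd k) v i)"
    unfolding slice_def step_field_def
      integral_trunc[OF assms, of "\<lambda>s. \<Sum>u\<in>U. e u f * P s u v i"]
    by (simp add: sum.cartesian_product[symmetric] sum_distrib_left mult.assoc case_prod_unfold)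
       (simp add: sum.cartesian_product case_prod_unfold)
qed

text \<open>Arranged with the coefficients of \<open>slice_step\<close>, so that
  \<open>lift_qs\<close> and \<open>lift_qc\<close> reduce to a comparison term by term.\<close>

lemma integral_lift_tens:
  assumes fam: "inductive_family dX" "inductive_family dY"
    and g: "integrable (mu dX) g1" "integrable (mu dY) g2"
  shows "(LINT z|(mu dX \<Otimes>\<^sub>M mu dY). tens g1 g2 z * lift_corr dX dY dA dB n p (tens f1 f2) z) =
    (\<Sum>k\<in>level dX n \<times> level dA n. \<Sum>l\<in>level dY n \<times> level dB n.
      ((LINT \<omega>|mu dX. g1 \<omega> * chi dX n (fst k) \<omega>) * expect dA n f1 (snd k)) *
      ((LINT \<omega>|mu dY. g2 \<omega> * chi dY n (fst l) \<omega>) * expect dB n f2 (snd l)) *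
      complex_of_real (p (fst k) (fst l) (snd k) (snd l)))"
proof -
  interpret X: prob_space "mu dX" by (rule prob_space_mu[OF fam(1)])
  interpret Y: prob_space "mu dY" by (rule prob_space_mu[OF fam(2)])
  define L where "L s t = (\<Sum>a\<in>level dA n. \<Sum>b\<in>level dB n.
    complex_of_real (p s t a b) * (expect dA n f1 a * expect dB n f2 b))" for s t
  define G1 where "G1 s = (LINT \<omega>|mu dX. g1 \<omega> * chi dX n s \<omega>)" for s
  define G2 where "G2 t = (LINT \<omega>|mu dY. g2 \<omega> * chi dY n t \<omega>)" for t
  define h where "h u = tens (\<lambda>\<omega>. g1 \<omega> * chi dX n (fst u) \<omega>) (\<lambda>\<omega>. g2 \<omega> * chi dY n (snd u) \<omega>)" for u
  have h: "integrable (mu dX \<Otimes>\<^sub>M mu dY) (h u)" "(LINT z|(mu dX \<Otimes>\<^sub>M mu dY). h u z) = G1 (fst u) * G2 (snd u)" for u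
    unfolding h_def G1_def G2_def
    by (intro product_integral integrable_times_chi g X.sigma_finite_measure_axioms Y.sigma_finite_measure_axioms)+
  have "(LINT z|(mu dX \<Otimes>\<^sub>M mu dY). tens g1 g2 z * lift_corr dX dY dA dB n p (tens f1 f2) z) =
    (LINT z|(mu dX \<Otimes>\<^sub>M mu dY). (\<Sum>u\<in>level dX n \<times> level dY n. L (fst u) (snd u) * h u z))"
  proof (intro Bochner_Integration.integral_cong refl)
    fix z assume "z \<in> space (mu dX \<Otimes>\<^sub>M mu dY)"
    then have z: "z \<in> Omega dX \<times> Omega dY" by (simp add: space_pair_measure)
    have "lift_corr dX dY dA dB n p (tens f1 f2) z = L (trunc n (fst z)) (trunc n (snd z))"
      unfolding L_def by (rule lift_tens[OF z])
    also have "\<dots> = (\<Sum>u\<in>level dX n \<times> level dY n. L (fst u) (snd u) * chi2 dX dY n u z)"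
      using sum_chi2[OF z, of "\<lambda>u. L (fst u) (snd u)" n] by simp
    finally show "tens g1 g2 z * lift_corr dX dY dA dB n p (tens f1 f2) z =
      (\<Sum>u\<in>level dX n \<times> level dY n. L (fst u) (snd u) * h u z)"
      by (simp add: sum_distrib_left h_def chi2_def tens_def case_prod_unfold mult_ac)
  qed
  also have "\<dots> = (\<Sum>u\<in>level dX n \<times> level dY n. L (fst u) (snd u) * (G1 (fst u) * G2 (snd u)))"
    using h by (subst Bochner_Integration.integral_sum) auto
  also have "\<dots> = (\<Sum>s\<in>level dX n. \<Sum>t\<in>level dY n. L s t * (G1 s * G2 t))"
    by (simp add: sum.cartesian_product case_prod_unfold)
  also have "\<dots> = (\<Sum>s\<in>level dX n. \<Sum>t\<in>level dY n. \<Sum>a\<in>level dA n. \<Sum>b\<in>level dB n.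
      (G1 s * expect dA n f1 a) * (G2 t * expect dB n f2 b) * complex_of_real (p s t a b))"
    unfolding L_def by (simp add: sum_distrib_left sum_distrib_right mult_ac)
  also have "\<dots> = (\<Sum>s\<in>level dX n. \<Sum>a\<in>level dA n. \<Sum>t\<in>level dY n. \<Sum>b\<in>level dB n.
      (G1 s * expect dA n f1 a) * (G2 t * expect dB n f2 b) * complex_of_real (p s t a b))"
    by (intro sum.cong refl sum.swap)
  also have "\<dots> = (\<Sum>k\<in>level dX n \<times> level dA n. \<Sum>l\<in>level dY n \<times> level dB n.
      (G1 (fst k) * expect dA n f1 (snd k)) * (G2 (fst l) * expect dB n f2 (snd l)) *
      complex_of_real (p (fst k) (fst l) (snd k) (snd l)))"
    by (simp add: sum.cartesian_product')
  finally show ?thesis unfolding G1_def G2_def .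
qed

lemma lift_qs:
  fixes J K :: "nat set"
  assumes fam: "inductive_family dX" "inductive_family dY" "inductive_family dA" "inductive_family dB"
    and m: "qs_model J K \<xi> P Q (level dX n) (level dY n) (level dA n) (level dB n) p"
  shows "cantor_qs dX dY dA dB (lift_corr dX dY dA dB n p)"
proof -
  have \<xi>: "\<xi> \<in> ell2 (J \<times> K)" "l2norm \<xi> = 1"
    and P: "\<And>s. s \<in> level dX n \<Longrightarrow> povm J (level dA n) (P s)"
    and Q: "\<And>t. t \<in> level dY n \<Longrightarrow> povm K (level dB n) (Q t)"
    and p: "\<And>s t u v. s \<in> level dX n \<Longrightarrow> t \<in> level dY n \<Longrightarrow> u \<in> level dA n \<Longrightarrow> v \<in> level dB n \<Longrightarrow>
      complex_of_real (p s t u v) = ip (tensor_map (P s u) (Q t v) \<xi>) \<xi>"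
    using m unfolding qs_model_def by blast+
  define \<Phi> where "\<Phi> = step_field n (level dA n) (\<lambda>a f. expect dA n f a) P"
  define \<Psi> where "\<Psi> = step_field n (level dB n) (\<lambda>a f. expect dB n f a) Q"
  have 1: "ucp_vn (Omega dA) (mu dX) J \<Phi>"
    unfolding \<Phi>_def by (rule ucp_vn_step[OF finite_level cp_state_expect[OF fam(3)] P])
  have 2: "ucp_vn (Omega dB) (mu dY) K \<Psi>"
    unfolding \<Psi>_def by (rule ucp_vn_step[OF finite_level cp_state_expect[OF fam(4)] Q])
  have 3: "(LINT z|(mu dX \<Otimes>\<^sub>M mu dY). tens g1 g2 z * lift_corr dX dY dA dB n p (tens f1 f2) z) =
           ip (tensor_map (slice (mu dX) g1 (\<Phi> f1)) (slice (mu dY) g2 (\<Psi> f2)) \<xi>) \<xi>"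
    if g: "integrable (mu dX) g1" "integrable (mu dY) g2" for f1 f2 g1 g2
  proof -
    let ?A = "level dX n \<times> level dA n" and ?B = "level dY n \<times> level dB n"
    define c where "c k = (LINT \<omega>|mu dX. g1 \<omega> * chi dX n (fst k) \<omega>) * expect dA n f1 (snd k)" for k
    define c' where "c' l = (LINT \<omega>|mu dY. g2 \<omega> * chi dY n (fst l) \<omega>) * expect dB n f2 (snd l)" for l
    have s1: "slice (mu dX) g1 (\<Phi> f1) = (\<lambda>v i. \<Sum>k\<in>?A. c k * P (fst k) (snd k) v i)"
      unfolding \<Phi>_def c_def by (rule ext, rule slice_step[OF g(1)])
    have s2: "slice (mu dY) g2 (\<Psi> f2) = (\<lambda>v i. \<Sum>k\<in>?B. c' k * Q (fst k) (snd k) v i)"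
      unfolding \<Psi>_def c'_def by (rule ext, rule slice_step[OF g(2)])
    have "ip (tensor_map (slice (mu dX) g1 (\<Phi> f1)) (slice (mu dY) g2 (\<Psi> f2)) \<xi>) \<xi> =
      (\<Sum>k\<in>?A. \<Sum>l\<in>?B. c k * c' l * ip (tensor_map (P (fst k) (snd k)) (Q (fst l) (snd l)) \<xi>) \<xi>)"
      unfolding s1 s2
      by (rule ip_tensor_combination[OF _ _ \<xi>(1)]) (auto intro: povmD(1)[OF P] povmD(1)[OF Q])
    also have "\<dots> = (\<Sum>k\<in>?A. \<Sum>l\<in>?B. c k * c' l * complex_of_real (p (fst k) (fst l) (snd k) (snd l)))"
      by (intro sum.cong refl) (auto simp: p)
    finally show ?thesis
      unfolding integral_lift_tens[OF fam(1,2) g] c_def c'_def by simp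
  qed
  show ?thesis
    unfolding cantor_qs_def
    using \<xi> 1 2 3 by (intro exI[of _ J] exI[of _ K] exI[of _ \<xi>] exI[of _ \<Phi>] exI[of _ \<Psi>] conjI) auto
qed

lemma lift_qc:
  fixes J :: "nat set"
  assumes fam: "inductive_family dX" "inductive_family dY" "inductive_family dA" "inductive_family dB"
    and m: "qc_model J \<xi> P Q (level dX n) (level dY n) (level dA n) (level dB n) p"
  shows "cantor_qc dX dY dA dB (lift_corr dX dY dA dB n p)"
proof -
  have \<xi>: "\<xi> \<in> ell2 J" "l2norm \<xi> = 1"
    and P: "\<And>s. s \<in> level dX n \<Longrightarrow> povm J (level dA n) (P s)"
    and Q: "\<And>t. t \<in> level dY n \<Longrightarrow> povm J (level dB n) (Q t)"
    and comm: "\<And>s t u v w. s \<in> level dX n \<Longrightarrow> t \<in> level dY n \<Longrightarrow> u \<in> level dA n \<Longrightarrow> v \<in> level dB n \<Longrightarrow>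
      w \<in> ell2 J \<Longrightarrow> P s u (Q t v w) = Q t v (P s u w)"
    and p: "\<And>s t u v. s \<in> level dX n \<Longrightarrow> t \<in> level dY n \<Longrightarrow> u \<in> level dA n \<Longrightarrow> v \<in> level dB n \<Longrightarrow>
      complex_of_real (p s t u v) = ip (P s u (Q t v \<xi>)) \<xi>"
    using m unfolding qc_model_def by blast+
  define \<Phi> where "\<Phi> = step_field n (level dA n) (\<lambda>a f. expect dA n f a) P"
  define \<Psi> where "\<Psi> = step_field n (level dB n) (\<lambda>a f. expect dB n f a) Q"
  have 1: "ucp_vn (Omega dA) (mu dX) J \<Phi>"
    unfolding \<Phi>_def by (rule ucp_vn_step[OF finite_level cp_state_expect[OF fam(3)] P])
  have 2: "ucp_vn (Omega dB) (mu dY) J \<Psi>"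
    unfolding \<Psi>_def by (rule ucp_vn_step[OF finite_level cp_state_expect[OF fam(4)] Q])
  have 3: "(LINT z|(mu dX \<Otimes>\<^sub>M mu dY). tens g1 g2 z * lift_corr dX dY dA dB n p (tens f1 f2) z) =
           ip (slice (mu dX) g1 (\<Phi> f1) (slice (mu dY) g2 (\<Psi> f2) \<xi>)) \<xi>"
    if g: "integrable (mu dX) g1" "integrable (mu dY) g2" for f1 f2 g1 g2
  proof -
    let ?A = "level dX n \<times> level dA n" and ?B = "level dY n \<times> level dB n"
    define c where "c k = (LINT \<omega>|mu dX. g1 \<omega> * chi dX n (fst k) \<omega>) * expect dA n f1 (snd k)" for k
    define c' where "c' l = (LINT \<omega>|mu dY. g2 \<omega> * chi dY n (fst l) \<omega>) * expect dB n f2 (snd l)" for l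
    define T where "T k = P (fst k) (snd k)" for k
    define T' where "T' l = Q (fst l) (snd l)" for l
    have Tb: "bounded_op J (T k)" if "k \<in> ?A" for k
      unfolding T_def using that by (intro povmD(1)[OF P]) auto
    have T'b: "bounded_op J (T' l)" if "l \<in> ?B" for l
      unfolding T'_def using that by (intro povmD(1)[OF Q]) auto
    have TT: "T k (T' l \<xi>) \<in> ell2 J" if "k \<in> ?A" "l \<in> ?B" for k l
      by (intro bounded_opD(1)[OF Tb[OF that(1)]] bounded_opD(1)[OF T'b[OF that(2)]] \<xi>(1))
    have s1: "slice (mu dX) g1 (\<Phi> f1) = (\<lambda>v i. \<Sum>k\<in>?A. c k * T k v i)"
      unfolding \<Phi>_def c_def T_def by (rule ext, rule slice_step[OF g(1)])
    have s2: "slice (mu dY) g2 (\<Psi> f2) = (\<lambda>v i. \<Sum>k\<in>?B. c' k * T' k v i)"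
      unfolding \<Psi>_def c'_def T'_def by (rule ext, rule slice_step[OF g(2)])
    have "T k (\<lambda>i. \<Sum>l\<in>?B. c' l * T' l \<xi> i) = (\<lambda>i. \<Sum>l\<in>?B. c' l * T k (T' l \<xi>) i)" if "k \<in> ?A" for k
      by (rule bounded_op_lincomb[OF Tb[OF that]]) (rule bounded_opD(1)[OF T'b \<xi>(1)])
    then have "slice (mu dX) g1 (\<Phi> f1) (slice (mu dY) g2 (\<Psi> f2) \<xi>) =
        (\<lambda>i. \<Sum>k\<in>?A. \<Sum>l\<in>?B. c k * (c' l * T k (T' l \<xi>) i))"
      unfolding s1 s2 by (simp add: sum_distrib_left)
    then have "ip (slice (mu dX) g1 (\<Phi> f1) (slice (mu dY) g2 (\<Psi> f2) \<xi>)) \<xi> =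
      ip (\<lambda>i. \<Sum>k\<in>?A. \<Sum>l\<in>?B. c k * (c' l * T k (T' l \<xi>) i)) \<xi>" by simp
    also have "\<dots> = (\<Sum>k\<in>?A. ip (\<lambda>i. \<Sum>l\<in>?B. c k * (c' l * T k (T' l \<xi>) i)) \<xi>)"
      by (intro ip_sum_left[OF _ \<xi>(1)] ell2_sum l2norm_scale(1) TT)
    also have "\<dots> = (\<Sum>k\<in>?A. \<Sum>l\<in>?B. ip (\<lambda>i. c k * (c' l * T k (T' l \<xi>) i)) \<xi>)"
      by (intro sum.cong refl ip_sum_left[OF _ \<xi>(1)] l2norm_scale(1) TT)
    also have "\<dots> = (\<Sum>k\<in>?A. \<Sum>l\<in>?B. c k * c' l * complex_of_real (p (fst k) (fst l) (snd k) (snd l)))"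
      by (intro sum.cong refl) (auto simp: p ip_scale_left T_def T'_def)
    finally show ?thesis
      unfolding integral_lift_tens[OF fam(1,2) g] c_def c'_def by simp
  qed
  have 4: "\<Phi> f x (\<Psi> g y v) = \<Psi> g y (\<Phi> f x v)"
    if x: "x \<in> Omega dX" and y: "y \<in> Omega dY" and v: "v \<in> ell2 J" for f g x y v
  proof -
    define s t where "s = trunc n x" and "t = trunc n y"
    have st: "s \<in> level dX n" "t \<in> level dY n" using trunc_in_level x y by (auto simp: s_def t_def)
    have Qv: "Q t b v \<in> ell2 J" if "b \<in> level dB n" for b by (rule bounded_opD(1)[OF povmD(1)[OF Q[OF st(2)] that] v])
    have Pv: "P s a v \<in> ell2 J" if "a \<in> level dA n" for a by (rule bounded_opD(1)[OF povmD(1)[OF P[OF st(1)] that] v])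
    have lin1: "P s a (\<lambda>i. \<Sum>b\<in>level dB n. c b * Q t b v i) = (\<lambda>i. \<Sum>b\<in>level dB n. c b * P s a (Q t b v) i)"
      if "a \<in> level dA n" for a c
      by (rule bounded_op_lincomb[OF povmD(1)[OF P[OF st(1)] that]]) (rule Qv)
    have lin2: "Q t b (\<lambda>i. \<Sum>a\<in>level dA n. c a * P s a v i) = (\<lambda>i. \<Sum>a\<in>level dA n. c a * Q t b (P s a v) i)"
      if "b \<in> level dB n" for b c
      by (rule bounded_op_lincomb[OF povmD(1)[OF Q[OF st(2)] that]]) (rule Pv)
    have "\<Phi> f x (\<Psi> g y v) = (\<lambda>i. \<Sum>a\<in>level dA n. expect dA n f a * (\<Sum>b\<in>level dB n. expect dB n g b * P s a (Q t b v) i))"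
      unfolding \<Phi>_def \<Psi>_def step_field_def s_def[symmetric] t_def[symmetric]
      by (simp add: lin1)
    also have "\<dots> = (\<lambda>i. \<Sum>b\<in>level dB n. expect dB n g b * (\<Sum>a\<in>level dA n. expect dA n f a * P s a (Q t b v) i))"
    proof
      fix i
      have "(\<Sum>a\<in>level dA n. expect dA n f a * (\<Sum>b\<in>level dB n. expect dB n g b * P s a (Q t b v) i)) =
        (\<Sum>a\<in>level dA n. \<Sum>b\<in>level dB n. expect dB n g b * (expect dA n f a * P s a (Q t b v) i))"
        by (simp add: sum_distrib_left mult.left_commute)
      also have "\<dots> = (\<Sum>b\<in>level dB n. \<Sum>a\<in>level dA n. expect dB n g b * (expect dA n f a * P s a (Q t b v) i))"
        by (rule sum.swap)
      finally show "(\<Sum>a\<in>level dA n. expect dA n f a * (\<Sum>b\<in>level dB n. expect dB n g b * P s a (Q t b v) i)) =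
        (\<Sum>b\<in>level dB n. expect dB n g b * (\<Sum>a\<in>level dA n. expect dA n f a * P s a (Q t b v) i))"
        by (simp add: sum_distrib_left)
    qed
    also have "\<dots> = (\<lambda>i. \<Sum>b\<in>level dB n. expect dB n g b * (\<Sum>a\<in>level dA n. expect dA n f a * Q t b (P s a v) i))"
      using comm[OF st _ _ v] by simp
    also have "\<dots> = \<Psi> g y (\<Phi> f x v)"
      unfolding \<Phi>_def \<Psi>_def step_field_def s_def[symmetric] t_def[symmetric]
      by (simp add: lin2)
    finally show ?thesis .
  qed
  have 5: "AE (x, y) in mu dX \<Otimes>\<^sub>M mu dY. \<forall>v\<in>ell2 J. \<Phi> f x (\<Psi> g y v) = \<Psi> g y (\<Phi> f x v)" for f g
    by (rule AE_I2) (auto simp: space_pair_measure 4)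
  show ?thesis
    unfolding cantor_qc_def
    using \<xi> 1 2 3 5 by (intro exI[of _ J] exI[of _ \<xi>] exI[of _ \<Phi>] exI[of _ \<Psi>] conjI) auto
qed

section \<open>Changing the index set of a Hilbert space\<close>

text \<open>For \<open>h\<close> injective on \<open>J\<close>, the unitary that renames basis
  vectors; \<open>pull\<close> is its inverse and \<open>transport\<close> is conjugation by
  it.\<close>

definition push :: "('a \<Rightarrow> 'b) \<Rightarrow> 'a set \<Rightarrow> ('a \<Rightarrow> complex) \<Rightarrow> 'b \<Rightarrow> complex" where
  "push h J v i = (if i \<in> h ` J then v (inv_into J h i) else 0)"

definition pull :: "('a \<Rightarrow> 'b) \<Rightarrow> 'a set \<Rightarrow> ('b \<Rightarrow> complex) \<Rightarrow> 'a \<Rightarrow> complex" where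
  "pull h J w i = (if i \<in> J then w (h i) else 0)"

definition transport :: "('a \<Rightarrow> 'b) \<Rightarrow> 'a set \<Rightarrow> (('a \<Rightarrow> complex) \<Rightarrow> 'a \<Rightarrow> complex) \<Rightarrow>
    ('b \<Rightarrow> complex) \<Rightarrow> 'b \<Rightarrow> complex" where
  "transport h J T w = push h J (T (pull h J w))"

lemma push_apply: "inj_on h J \<Longrightarrow> i \<in> J \<Longrightarrow> push h J v (h i) = v i"
  by (simp add: push_def)

lemma push_outside: "i \<notin> h ` J \<Longrightarrow> push h J v i = 0"
  by (simp add: push_def)

lemma pull_push: "inj_on h J \<Longrightarrow> v \<in> ell2 J \<Longrightarrow> pull h J (push h J v) = v"
  by (rule ext) (simp add: pull_def push_apply ell2_outside)

lemma push_pull: "inj_on h J \<Longrightarrow> w \<in> ell2 (h ` J) \<Longrightarrow> push h J (pull h J w) = w"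
  by (rule ext) (auto simp: pull_def push_def ell2_outside f_inv_into_f inv_into_into)

lemma summable_on_push_iff:
  assumes "inj_on h J" "\<And>i. i \<notin> J \<Longrightarrow> v i = 0"
  shows "(\<lambda>i. (cmod (push h J v i))\<^sup>2) summable_on UNIV \<longleftrightarrow> (\<lambda>i. (cmod (v i))\<^sup>2) summable_on UNIV"
proof -
  have "(\<lambda>i. (cmod (push h J v i))\<^sup>2) summable_on UNIV \<longleftrightarrow> (\<lambda>i. (cmod (push h J v i))\<^sup>2) summable_on h ` J"
    by (rule summable_on_cong_neutral) (auto simp: push_outside)
  also have "\<dots> \<longleftrightarrow> (\<lambda>i. (cmod (push h J v (h i)))\<^sup>2) summable_on J"
    using summable_on_reindex[OF assms(1)] by (simp add: comp_def)
  also have "\<dots> \<longleftrightarrow> (\<lambda>i. (cmod (v i))\<^sup>2) summable_on UNIV"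
    by (rule summable_on_cong_neutral) (auto simp: assms(2) push_apply[OF assms(1)])
  finally show ?thesis .
qed

lemma ip_push:
  assumes "inj_on h J" "v \<in> ell2 J"
  shows "ip (push h J v) (push h J w) = ip v w"
proof -
  have "ip (push h J v) (push h J w) = (\<Sum>\<^sub>\<infinity>i\<in>h ` J. push h J v i * cnj (push h J w i))"
    unfolding ip_def by (rule infsum_cong_neutral) (auto simp: push_outside)
  also have "\<dots> = (\<Sum>\<^sub>\<infinity>i\<in>J. push h J v (h i) * cnj (push h J w (h i)))"
    using infsum_reindex[OF assms(1)] by (simp add: comp_def)
  also have "\<dots> = ip v w"
    unfolding ip_def
    by (rule infsum_cong_neutral) (auto simp: ell2_outside[OF assms(2)] push_apply[OF assms(1)])
  finally show ?thesis .
qed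

lemma l2norm_eq_ip: "v \<in> ell2 J \<Longrightarrow> complex_of_real ((l2norm v)\<^sup>2) = ip v v"
proof -
  assume v: "v \<in> ell2 J"
  have "ip v v = (\<Sum>\<^sub>\<infinity>i. complex_of_real ((cmod (v i))\<^sup>2))"
    unfolding ip_def complex_norm_square ..
  also have "\<dots> = complex_of_real (\<Sum>\<^sub>\<infinity>i. (cmod (v i))\<^sup>2)"
    by (rule infsumI[OF has_sum_of_real[OF has_sum_infsum[OF ell2_summable[OF v]]]])
  finally show ?thesis by (simp add: l2norm_power2)
qed

lemma push_ell2:
  assumes "inj_on h J" "v \<in> ell2 J"
  shows "push h J v \<in> ell2 (h ` J)" "l2norm (push h J v) = l2norm v"
proof -
  show e: "push h J v \<in> ell2 (h ` J)"
    using summable_on_push_iff[OF assms(1), of v] ell2_outside[OF assms(2)] ell2_summable[OF assms(2)]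
    by (auto simp: ell2_def push_outside)
  have "complex_of_real ((l2norm (push h J v))\<^sup>2) = complex_of_real ((l2norm v)\<^sup>2)"
    unfolding l2norm_eq_ip[OF e] l2norm_eq_ip[OF assms(2)] by (rule ip_push[OF assms])
  then show "l2norm (push h J v) = l2norm v"
    unfolding of_real_eq_iff by (rule power2_eq_imp_eq) simp_all
qed

lemma pull_ell2:
  assumes "inj_on h J" "w \<in> ell2 (h ` J)"
  shows "pull h J w \<in> ell2 J" "l2norm (pull h J w) = l2norm w"
proof -
  have "(\<lambda>i. (cmod (pull h J w i))\<^sup>2) summable_on UNIV"
    using summable_on_push_iff[OF assms(1), of "pull h J w"] ell2_summable[OF assms(2)]
    unfolding push_pull[OF assms] by (simp add: pull_def)
  then show *: "pull h J w \<in> ell2 J" by (simp add: ell2_def pull_def)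
  show "l2norm (pull h J w) = l2norm w"
    using push_ell2(2)[OF assms(1) *] unfolding push_pull[OF assms] by simp
qed

lemma push_zero: "push h J (\<lambda>_. 0) = (\<lambda>_. 0)"
  by (simp add: push_def fun_eq_iff)

lemma transport_bounded_op:
  assumes h: "inj_on h J" and T: "bounded_op J T"
  shows "bounded_op (h ` J) (transport h J T)"
proof -
  obtain C where C: "0 \<le> C" "\<And>v. v \<in> ell2 J \<Longrightarrow> l2norm (T v) \<le> C * l2norm v"
    using bounded_op_bound[OF T] by blast
  have pull_add: "pull h J (\<lambda>i. v i + w i) = (\<lambda>i. pull h J v i + pull h J w i)" for v w
    by (simp add: pull_def fun_eq_iff)
  have pull_scale: "pull h J (\<lambda>i. c * v i) = (\<lambda>i. c * pull h J v i)" for v c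
    by (simp add: pull_def fun_eq_iff)
  show ?thesis
    unfolding bounded_op_def
  proof (intro conjI ballI allI exI)
    fix v assume v: "v \<in> ell2 (h ` J)"
    note v' = pull_ell2[OF h v]
    show "transport h J T v \<in> ell2 (h ` J)"
      unfolding transport_def by (rule push_ell2(1)[OF h bounded_opD(1)[OF T v'(1)]])
    show "l2norm (transport h J T v) \<le> C * l2norm v"
      unfolding transport_def push_ell2(2)[OF h bounded_opD(1)[OF T v'(1)]]
      using C(2)[OF v'(1)] v'(2) by simp
    show "transport h J T (\<lambda>i. c * v i) = (\<lambda>i. c * transport h J T v i)" for c
      unfolding transport_def pull_scale bounded_opD(3)[OF T v'(1)] by (simp add: push_def fun_eq_iff)
    show "transport h J T (\<lambda>i. v i + w i) = (\<lambda>i. transport h J T v i + transport h J T w i)"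
      if "w \<in> ell2 (h ` J)" for w
      unfolding transport_def pull_add bounded_opD(2)[OF T v'(1) pull_ell2(1)[OF h that]]
      by (simp add: push_def fun_eq_iff)
  qed
qed

lemma transport_povm:
  assumes h: "inj_on h J" and P: "povm J U P"
  shows "povm (h ` J) U (\<lambda>u. transport h J (P u))"
  unfolding povm_def
proof (intro conjI ballI)
  fix u assume u: "u \<in> U"
  show "bounded_op (h ` J) (transport h J (P u))" by (rule transport_bounded_op[OF h povmD(1)[OF P u]])
  fix v assume v: "v \<in> ell2 (h ` J)"
  note v' = pull_ell2[OF h v]
  have "ip (transport h J (P u) v) v = ip (push h J (P u (pull h J v))) (push h J (pull h J v))"
    unfolding transport_def push_pull[OF h v] ..
  also have "\<dots> = ip (P u (pull h J v)) (pull h J v)"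
    by (rule ip_push[OF h bounded_opD(1)[OF povmD(1)[OF P u] v'(1)]])
  finally show "ip (transport h J (P u) v) v \<in> \<real>\<^sub>\<ge>\<^sub>0" using povmD(2)[OF P u v'(1)] by simp
next
  fix v assume v: "v \<in> ell2 (h ` J)"
  have "(\<lambda>i. \<Sum>u\<in>U. transport h J (P u) v i) = push h J (\<lambda>i. \<Sum>u\<in>U. P u (pull h J v) i)"
    by (simp add: transport_def push_def fun_eq_iff)
  then show "(\<lambda>i. \<Sum>u\<in>U. transport h J (P u) v i) = v"
    unfolding povmD(3)[OF P pull_ell2(1)[OF h v]] push_pull[OF h v] .
qed

lemma transport_qc_model:
  assumes h: "inj_on h J" and m: "qc_model J \<xi> P Q S T U V p"
  shows "qc_model (h ` J) (push h J \<xi>) (\<lambda>s u. transport h J (P s u)) (\<lambda>t v. transport h J (Q t v)) S T U V p"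
proof -
  have \<xi>: "\<xi> \<in> ell2 J" "l2norm \<xi> = 1"
    and P: "\<And>s. s \<in> S \<Longrightarrow> povm J U (P s)"
    and Q: "\<And>t. t \<in> T \<Longrightarrow> povm J V (Q t)"
    and comm: "\<And>s t u v w. s \<in> S \<Longrightarrow> t \<in> T \<Longrightarrow> u \<in> U \<Longrightarrow> v \<in> V \<Longrightarrow>
      w \<in> ell2 J \<Longrightarrow> P s u (Q t v w) = Q t v (P s u w)"
    and p: "\<And>s t u v. s \<in> S \<Longrightarrow> t \<in> T \<Longrightarrow> u \<in> U \<Longrightarrow> v \<in> V \<Longrightarrow>
      complex_of_real (p s t u v) = ip (P s u (Q t v \<xi>)) \<xi>"
    using m unfolding qc_model_def by blast+
  have two: "transport h J A (transport h J B w) = push h J (A (B (pull h J w)))"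
    if "bounded_op J B" "w \<in> ell2 (h ` J)" for A B w
    unfolding transport_def pull_push[OF h bounded_opD(1)[OF that(1) pull_ell2(1)[OF h that(2)]]] ..
  show ?thesis
    unfolding qc_model_def
  proof (intro conjI ballI)
    show "push h J \<xi> \<in> ell2 (h ` J)" "l2norm (push h J \<xi>) = 1" using push_ell2[OF h \<xi>(1)] \<xi>(2) by simp_all
    show "povm (h ` J) U (\<lambda>u. transport h J (P s u))" if "s \<in> S" for s by (rule transport_povm[OF h P[OF that]])
    show "povm (h ` J) V (\<lambda>v. transport h J (Q t v))" if "t \<in> T" for t by (rule transport_povm[OF h Q[OF that]])
    fix s t u v assume i: "s \<in> S" "t \<in> T" "u \<in> U" "v \<in> V"
    note Pb = povmD(1)[OF P[OF i(1)] i(3)] and Qb = povmD(1)[OF Q[OF i(2)] i(4)]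
    show "transport h J (P s u) (transport h J (Q t v) w) = transport h J (Q t v) (transport h J (P s u) w)"
      if w: "w \<in> ell2 (h ` J)" for w
      unfolding two[OF Qb w] two[OF Pb w] comm[OF i pull_ell2(1)[OF h w]] ..
    have "ip (transport h J (P s u) (transport h J (Q t v) (push h J \<xi>))) (push h J \<xi>) = ip (P s u (Q t v \<xi>)) \<xi>"
      unfolding two[OF Qb push_ell2(1)[OF h \<xi>(1)]] pull_push[OF h \<xi>(1)]
      by (rule ip_push[OF h bounded_opD(1)[OF Pb bounded_opD(1)[OF Qb \<xi>(1)]]])
    then show "complex_of_real (p s t u v) =
      ip (transport h J (P s u) (transport h J (Q t v) (push h J \<xi>))) (push h J \<xi>)"
      using p[OF i] by simp
  qed
qed

text \<open>Off the image rectangle both sides vanish; for a second coordinate outside the image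
  this is because the inner family is 0 and \<open>T\<close> maps 0 to 0. On the rectangle each
  \<open>pull\<close> undoes a \<open>push\<close>.\<close>

lemma tensor_map_transport:
  fixes h :: "'a \<Rightarrow> 'b" and k :: "'c \<Rightarrow> 'd"
  assumes h: "inj_on h J" and k: "inj_on k K"
    and T: "bounded_op J T" and T': "bounded_op K T'" and \<xi>: "\<xi> \<in> ell2 (J \<times> K)"
  shows "tensor_map (transport h J T) (transport k K T') (push (map_prod h k) (J \<times> K) \<xi>) =
    push (map_prod h k) (J \<times> K) (tensor_map T T' \<xi>)" (is "tensor_map _ _ ?\<xi> = ?R")
proof
  fix z :: "'b \<times> 'd"
  obtain x' y' where z: "z = (x', y')" by (cases z)
  have hk: "inj_on (map_prod h k) (J \<times> K)" by (rule map_prod_inj_on[OF h k])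
  have L: "tensor_map (transport h J T) (transport k K T') ?\<xi> z =
    push h J (T (pull h J (\<lambda>a'. push k K (T' (pull k K (\<lambda>b'. ?\<xi> (a', b')))) y'))) x'"
    by (simp add: z tensor_map_def transport_def)
  have im: "map_prod h k ` (J \<times> K) = h ` J \<times> k ` K" by (rule map_prod_surj_on) simp_all
  show "tensor_map (transport h J T) (transport k K T') ?\<xi> z = ?R z"
  proof (cases "x' \<in> h ` J \<and> y' \<in> k ` K")
    case False
    have "pull h J (\<lambda>a'. push k K (T' (pull k K (\<lambda>b'. ?\<xi> (a', b')))) y') = (\<lambda>_. 0)" if "y' \<notin> k ` K"
      by (simp add: push_outside[OF that] pull_def fun_eq_iff)
    then have "tensor_map (transport h J T) (transport k K T') ?\<xi> z = 0"
      unfolding L using False bounded_op_zero[OF T] by (cases "y' \<in> k ` K") (simp_all add: push_zero push_outside)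
    moreover have "?R z = 0" using False by (intro push_outside) (simp add: im z)
    ultimately show ?thesis by simp
  next
    case True
    then obtain x y where x: "x' = h x" "x \<in> J" and y: "y' = k y" "y \<in> K" by blast
    have in1: "pull k K (\<lambda>b'. ?\<xi> (h a, b')) = (\<lambda>b. \<xi> (a, b))" if a: "a \<in> J" for a
    proof
      fix b
      show "pull k K (\<lambda>b'. ?\<xi> (h a, b')) b = \<xi> (a, b)"
        using push_apply[OF hk, of "(a, b)" \<xi>] a ell2_outside[OF \<xi>, of "(a, b)"] by (simp add: pull_def)
    qed
    \<comment> \<open>For \<open>a\<close> outside \<open>J\<close> the section of \<xi> is 0, which
      matches the value 0 that \<open>pull\<close> assigns there.\<close>
    have in2: "T' (\<lambda>b. \<xi> (a, b)) y = 0" if "a \<notin> J" for a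
      using ell2_section(2)[OF \<xi> that] bounded_op_zero[OF T'] by simp
    have "pull h J (\<lambda>a'. push k K (T' (pull k K (\<lambda>b'. ?\<xi> (a', b')))) y') = (\<lambda>a. T' (\<lambda>b. \<xi> (a, b)) y)"
      unfolding y(1) push_apply[OF k y(2)]
    proof
      fix a
      show "pull h J (\<lambda>a'. T' (pull k K (\<lambda>b'. ?\<xi> (a', b'))) y) a = T' (\<lambda>b. \<xi> (a, b)) y"
        unfolding pull_def[of h] using in1[of a] in2[of a] by (cases "a \<in> J") simp_all
    qed
    then have "tensor_map (transport h J T) (transport k K T') ?\<xi> z = T (\<lambda>a. T' (\<lambda>b. \<xi> (a, b)) y) x"
      unfolding L x(1) push_apply[OF h x(2)] by simp
    also have "\<dots> = ?R z"
      using push_apply[OF hk, of "(x, y)" "tensor_map T T' \<xi>"] x y by (simp add: z tensor_map_def)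
    finally show ?thesis .
  qed
qed

lemma transport_qs_model:
  assumes h: "inj_on h J" and k: "inj_on k K" and m: "qs_model J K \<xi> P Q S T U V p"
  shows "qs_model (h ` J) (k ` K) (push (map_prod h k) (J \<times> K) \<xi>)
    (\<lambda>s u. transport h J (P s u)) (\<lambda>t v. transport k K (Q t v)) S T U V p"
proof -
  have \<xi>: "\<xi> \<in> ell2 (J \<times> K)" "l2norm \<xi> = 1"
    and P: "\<And>s. s \<in> S \<Longrightarrow> povm J U (P s)"
    and Q: "\<And>t. t \<in> T \<Longrightarrow> povm K V (Q t)"
    and p: "\<And>s t u v. s \<in> S \<Longrightarrow> t \<in> T \<Longrightarrow> u \<in> U \<Longrightarrow> v \<in> V \<Longrightarrow>
      complex_of_real (p s t u v) = ip (tensor_map (P s u) (Q t v) \<xi>) \<xi>"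
    using m unfolding qs_model_def by blast+
  have hk: "inj_on (map_prod h k) (J \<times> K)" by (rule map_prod_inj_on[OF h k])
  have im: "map_prod h k ` (J \<times> K) = h ` J \<times> k ` K" by (rule map_prod_surj_on) simp_all
  show ?thesis
    unfolding qs_model_def
  proof (intro conjI ballI)
    show "push (map_prod h k) (J \<times> K) \<xi> \<in> ell2 (h ` J \<times> k ` K)" "l2norm (push (map_prod h k) (J \<times> K) \<xi>) = 1"
      using push_ell2[OF hk \<xi>(1)] \<xi>(2) by (simp_all add: im)
    show "povm (h ` J) U (\<lambda>u. transport h J (P s u))" if "s \<in> S" for s by (rule transport_povm[OF h P[OF that]])
    show "povm (k ` K) V (\<lambda>v. transport k K (Q t v))" if "t \<in> T" for t by (rule transport_povm[OF k Q[OF that]])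
    fix s t u v assume i: "s \<in> S" "t \<in> T" "u \<in> U" "v \<in> V"
    note Pb = povmD(1)[OF P[OF i(1)] i(3)] and Qb = povmD(1)[OF Q[OF i(2)] i(4)]
    show "complex_of_real (p s t u v) = ip (tensor_map (transport h J (P s u)) (transport k K (Q t v))
        (push (map_prod h k) (J \<times> K) \<xi>)) (push (map_prod h k) (J \<times> K) \<xi>)"
      unfolding tensor_map_transport[OF h k Pb Qb \<xi>(1)] ip_push[OF hk tensor_map_ell2[OF Pb Qb \<xi>(1)]]
      by (rule p[OF i])
  qed
qed

section \<open>Reduction to separable Hilbert spaces\<close>

lemma ell2_countable_support: "v \<in> ell2 J \<Longrightarrow> countable {i. v i \<noteq> 0}"
  using summable_countable_real[OF ell2_summable, of v J] by simp

text \<open>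
  An operator has countably many nonzero matrix entries in each column, so closing a countable
  set of indices under the columns of countably many operators keeps it countable.
\<close>

lemma countable_invariant_index_set:
  assumes ops: "countable \<T>" "\<forall>T\<in>\<T>. bounded_op J T"
    and S: "countable S" "S \<subseteq> J"
  shows "\<exists>J0. countable J0 \<and> S \<subseteq> J0 \<and> J0 \<subseteq> J \<and> (\<forall>T\<in>\<T>. \<forall>v\<in>ell2 J0. T v \<in> ell2 J0)"
proof -
  define step where "step A = A \<union> (\<Union>T\<in>\<T>. \<Union>j\<in>A. {i. T (bvec j) i \<noteq> 0})" for A
  define A where "A k = (step ^^ k) S" for k
  have A0: "A 0 = S" and AS: "A (Suc k) = step (A k)" for k by (simp_all add: A_def)
  have A: "countable (A k) \<and> A k \<subseteq> J" for k
  proof (induction k)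
    case (Suc k)
    have col: "T (bvec j) \<in> ell2 J" if "T \<in> \<T>" "j \<in> A k" for T j
      using bounded_opD(1)[OF ops(2)[rule_format, OF that(1)] bvec_ell2] Suc that by blast
    have "countable (\<Union>T\<in>\<T>. \<Union>j\<in>A k. {i. T (bvec j) i \<noteq> 0})"
      using Suc col ell2_countable_support by (intro countable_UN ops(1)) auto
    moreover have "(\<Union>T\<in>\<T>. \<Union>j\<in>A k. {i. T (bvec j) i \<noteq> 0}) \<subseteq> J"
      using ell2_outside[OF col] by blast
    ultimately show ?case using Suc unfolding AS step_def by simp
  qed (use S A0 in simp)
  define J0 where "J0 = (\<Union>k. A k)"
  show ?thesis
  proof (intro exI[of _ J0] conjI ballI)
    show "countable J0" "J0 \<subseteq> J" using A by (auto simp: J0_def)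
    show "S \<subseteq> J0" using A0 by (auto simp: J0_def)
    fix T v assume T: "T \<in> \<T>" and v: "v \<in> ell2 J0"
    note Tb = ops(2)[rule_format, OF T]
    have vJ: "v \<in> ell2 J" using ell2_mono[OF v \<open>J0 \<subseteq> J\<close>] .
    \<comment> \<open>Every term of the matrix expansion vanishes: for \<open>j\<close> in
      \<open>J0\<close> since \<open>J0\<close> is closed under columns, for the other
      \<open>j\<close> since \<open>v j = 0\<close>.\<close>
    have "T v i = 0" if i: "i \<notin> J0" for i
    proof -
      have "v j * T (bvec j) i = 0" for j
      proof (cases "j \<in> J0")
        case True
        then obtain k where "j \<in> A k" by (auto simp: J0_def)
        then have "T (bvec j) i = 0" using i AS[of k] T unfolding J0_def step_def by blast
        then show ?thesis by simp
      qed (use ell2_outside[OF v] in simp)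
      then show ?thesis using has_sum_unique[OF bounded_op_has_sum[OF Tb vJ, of i] has_sum_0] by blast
    qed
    then show "T v \<in> ell2 J0" using bounded_opD(1)[OF Tb vJ] by (simp add: ell2_def)
  qed
qed

lemma bounded_op_subset:
  assumes "bounded_op J T" "J0 \<subseteq> J" "\<And>v. v \<in> ell2 J0 \<Longrightarrow> T v \<in> ell2 J0"
  shows "bounded_op J0 T"
proof -
  have sub: "v \<in> ell2 J" if "v \<in> ell2 J0" for v by (rule ell2_mono[OF that assms(2)])
  obtain C where "\<And>v. v \<in> ell2 J \<Longrightarrow> l2norm (T v) \<le> C * l2norm v"
    using bounded_op_bound[OF assms(1)] by blast
  then have "\<exists>C. \<forall>v\<in>ell2 J0. l2norm (T v) \<le> C * l2norm v" using sub by blast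
  then show ?thesis
    unfolding bounded_op_def
    using assms(3) bounded_opD(2)[OF assms(1) sub sub] bounded_opD(3)[OF assms(1) sub] by blast
qed

text \<open>Positivity and summation to the identity are tested on vectors, so both restrict to an
  invariant subspace.\<close>

lemma povm_subset:
  assumes P: "povm J U P" and J0: "J0 \<subseteq> J" "\<And>u v. u \<in> U \<Longrightarrow> v \<in> ell2 J0 \<Longrightarrow> P u v \<in> ell2 J0"
  shows "povm J0 U P"
  unfolding povm_def
  using bounded_op_subset[OF povmD(1)[OF P] J0(1)] J0(2) povmD(2)[OF P _ ell2_mono[OF _ J0(1)]]
    povmD(3)[OF P ell2_mono[OF _ J0(1)]] by blast

lemma ell2_support: "v \<in> ell2 J \<Longrightarrow> (\<And>i. v i \<noteq> 0 \<Longrightarrow> i \<in> J0) \<Longrightarrow> v \<in> ell2 J0"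
  by (auto simp: ell2_def)

text \<open>The closure starts from the support of \<xi>, so the state survives. It is taken under
  the operators of both parties at once, as they share one space; commutation is tested on fewer
  vectors than before.\<close>

lemma separable_qc_model:
  assumes fin: "finite S" "finite T" "finite U" "finite V"
    and m: "qc_model (J :: 'i set) \<xi> P Q S T U V p"
  obtains J' :: "nat set" and \<xi>' P' Q' where "qc_model J' \<xi>' P' Q' S T U V p"
proof -
  have \<xi>: "\<xi> \<in> ell2 J" "l2norm \<xi> = 1"
    and P: "\<And>s. s \<in> S \<Longrightarrow> povm J U (P s)"
    and Q: "\<And>t. t \<in> T \<Longrightarrow> povm J V (Q t)"
    and p: "\<And>s t u v. s \<in> S \<Longrightarrow> t \<in> T \<Longrightarrow> u \<in> U \<Longrightarrow> v \<in> V \<Longrightarrow>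
      (\<forall>w\<in>ell2 J. P s u (Q t v w) = Q t v (P s u w)) \<and>
      complex_of_real (p s t u v) = ip (P s u (Q t v \<xi>)) \<xi>"
    using m unfolding qc_model_def by blast+
  define \<T> where "\<T> = (\<Union>s\<in>S. P s ` U) \<union> (\<Union>t\<in>T. Q t ` V)"
  have c: "countable \<T>" unfolding \<T>_def using fin by (intro countable_finite) auto
  have b: "\<forall>X\<in>\<T>. bounded_op J X"
    using povmD(1)[OF P] povmD(1)[OF Q] unfolding \<T>_def by blast
  have s: "{i. \<xi> i \<noteq> 0} \<subseteq> J" using ell2_outside[OF \<xi>(1)] by blast
  obtain J0 where J0: "countable J0" "{i. \<xi> i \<noteq> 0} \<subseteq> J0" "J0 \<subseteq> J"
    "\<forall>X\<in> \<T>. \<forall>v\<in>ell2 J0. X v \<in> ell2 J0"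
    using countable_invariant_index_set[OF c b ell2_countable_support[OF \<xi>(1)] s]
    by (elim exE conjE) (rule that)
  have "\<xi> \<in> ell2 J0" by (rule ell2_support[OF \<xi>(1)]) (use J0(2) in blast)
  moreover have "povm J0 U (P s)" if "s \<in> S" for s
    by (rule povm_subset[OF P[OF that] J0(3)]) (use J0(4) that in \<open>unfold \<T>_def, blast\<close>)
  moreover have "povm J0 V (Q t)" if "t \<in> T" for t
    by (rule povm_subset[OF Q[OF that] J0(3)]) (use J0(4) that in \<open>unfold \<T>_def, blast\<close>)
  ultimately have "qc_model J0 \<xi> P Q S T U V p"
    unfolding qc_model_def using \<xi>(2) p ell2_mono[OF _ J0(3)] by blast
  moreover obtain h :: "'i \<Rightarrow> nat" where "inj_on h J0" using J0(1) by (auto simp: countable_def)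
  ultimately show ?thesis using that transport_qc_model by blast
qed

text \<open>The two factors are reduced independently, each from the projection of the support of
  \<xi> and under one party's operators; the product of the two index sets still contains that
  support.\<close>

lemma separable_qs_model:
  assumes fin: "finite S" "finite T" "finite U" "finite V"
    and m: "qs_model (J :: 'i set) (K :: 'i set) \<xi> P Q S T U V p"
  obtains J' K' :: "nat set" and \<xi>' P' Q' where "qs_model J' K' \<xi>' P' Q' S T U V p"
proof -
  have \<xi>: "\<xi> \<in> ell2 (J \<times> K)" "l2norm \<xi> = 1"
    and P: "\<And>s. s \<in> S \<Longrightarrow> povm J U (P s)"
    and Q: "\<And>t. t \<in> T \<Longrightarrow> povm K V (Q t)"
    and p: "\<And>s t u v. s \<in> S \<Longrightarrow> t \<in> T \<Longrightarrow> u \<in> U \<Longrightarrow> v \<in> V \<Longrightarrow>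
      complex_of_real (p s t u v) = ip (tensor_map (P s u) (Q t v) \<xi>) \<xi>"
    using m unfolding qs_model_def by blast+
  have supp: "countable {z. \<xi> z \<noteq> 0}" "{z. \<xi> z \<noteq> 0} \<subseteq> J \<times> K"
    using ell2_countable_support[OF \<xi>(1)] ell2_outside[OF \<xi>(1)] by blast+
  have c: "countable (\<Union>s\<in>S. P s ` U)" using fin by (intro countable_finite) auto
  have b: "\<forall>X\<in>(\<Union>s\<in>S. P s ` U). bounded_op J X" using povmD(1)[OF P] by blast
  have s: "fst ` {z. \<xi> z \<noteq> 0} \<subseteq> J" using supp(2) by auto
  obtain J0 where J0: "countable J0" "fst ` {z. \<xi> z \<noteq> 0} \<subseteq> J0" "J0 \<subseteq> J"
    "\<forall>X\<in> (\<Union>s\<in>S. P s ` U). \<forall>v\<in>ell2 J0. X v \<in> ell2 J0"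
    using countable_invariant_index_set[OF c b countable_image[OF supp(1)] s]
    by (elim exE conjE) (rule that)
  have c': "countable (\<Union>t\<in>T. Q t ` V)" using fin by (intro countable_finite) auto
  have b': "\<forall>X\<in>(\<Union>t\<in>T. Q t ` V). bounded_op K X" using povmD(1)[OF Q] by blast
  have s': "snd ` {z. \<xi> z \<noteq> 0} \<subseteq> K" using supp(2) by auto
  obtain K0 where K0: "countable K0" "snd ` {z. \<xi> z \<noteq> 0} \<subseteq> K0" "K0 \<subseteq> K"
    "\<forall>X\<in> (\<Union>t\<in>T. Q t ` V). \<forall>v\<in>ell2 K0. X v \<in> ell2 K0"
    using countable_invariant_index_set[OF c' b' countable_image[OF supp(1)] s']
    by (elim exE conjE) (rule that)
  have "\<xi> \<in> ell2 (J0 \<times> K0)"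
  proof (rule ell2_support[OF \<xi>(1)])
    fix z assume "\<xi> z \<noteq> 0"
    then have "fst z \<in> fst ` {z. \<xi> z \<noteq> 0}" "snd z \<in> snd ` {z. \<xi> z \<noteq> 0}" by blast+
    then show "z \<in> J0 \<times> K0" using J0(2) K0(2) by (auto simp: mem_Times_iff)
  qed
  moreover have "povm J0 U (P s)" if "s \<in> S" for s
    by (rule povm_subset[OF P[OF that] J0(3)]) (use J0(4) that in auto)
  moreover have "povm K0 V (Q t)" if "t \<in> T" for t
    by (rule povm_subset[OF Q[OF that] K0(3)]) (use K0(4) that in auto)
  ultimately have "qs_model J0 K0 \<xi> P Q S T U V p"
    unfolding qs_model_def using \<xi>(2) p by blast
  moreover obtain h k :: "'i \<Rightarrow> nat" where "inj_on h J0" "inj_on k K0"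
    using J0(1) K0(1) by (auto simp: countable_def)
  ultimately show ?thesis using that transport_qs_model by blast
qed

lemma lift_cantor_class:
  assumes fam: "inductive_family dX" "inductive_family dY" "inductive_family dA" "inductive_family dB"
    and p: "p \<in> fin_class TYPE('i) t (level dX n) (level dY n) (level dA n) (level dB n)"
  shows "lift_corr dX dY dA dB n p \<in> cantor_class t dX dY dA dB"
proof -
  have "cantor_corr dX dY dA dB (lift_corr dX dY dA dB n p)"
    using p by (intro lift_cantor_corr fam) (simp add: fin_class_def)
  moreover have "case t of Loc \<Rightarrow> cantor_loc dX dY dA dB (lift_corr dX dY dA dB n p)
      | QS \<Rightarrow> cantor_qs dX dY dA dB (lift_corr dX dY dA dB n p)
      | QC \<Rightarrow> cantor_qc dX dY dA dB (lift_corr dX dY dA dB n p)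
      | NS \<Rightarrow> cantor_ns dX dY dA dB (lift_corr dX dY dA dB n p)"
  proof (cases t)
    case Loc
    then show ?thesis using p lift_loc[OF fam(3,4)] by (simp add: fin_class_def)
  next
    case QS
    then have "fin_qs TYPE('i) (level dX n) (level dY n) (level dA n) (level dB n) p"
      using p by (simp add: fin_class_def)
    then obtain J K :: "nat set" and \<xi> P Q where
      "qs_model J K \<xi> P Q (level dX n) (level dY n) (level dA n) (level dB n) p"
      unfolding fin_qs_iff by (elim exE) (erule separable_qs_model[rotated 4], simp_all)
    then show ?thesis using QS lift_qs[OF fam] by simp
  next
    case QC
    then have "fin_qc TYPE('i) (level dX n) (level dY n) (level dA n) (level dB n) p"
      using p by (simp add: fin_class_def)
    then obtain J :: "nat set" and \<xi> P Q where
      "qc_model J \<xi> P Q (level dX n) (level dY n) (level dA n) (level dB n) p"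
      unfolding fin_qc_iff by (elim exE) (erule separable_qc_model[rotated 4], simp_all)
    then show ?thesis using QC lift_qc[OF fam] by simp
  next
    case NS
    then show ?thesis using p lift_ns[OF fam] by (simp add: fin_class_def)
  qed
  ultimately show ?thesis by (simp add: cantor_class_def)
qed

section \<open>Averaging a Cantor correlation over cylinders\<close>

lemma sum_chi2_all:
  assumes "inductive_family d" "inductive_family d'"
  shows "(\<Sum>u\<in>level d n \<times> level d' n. chi2 d d' n u z) = 1"
proof (cases z)
  case (Pair x y)
  have "(\<Sum>u\<in>level d n \<times> level d' n. chi2 d d' n u z) = (\<Sum>a\<in>level d n. chi d n a x) * (\<Sum>b\<in>level d' n. chi d' n b y)"
    by (simp add: sum.cartesian_product' chi2_def tens_def Pair sum_product)
  then show ?thesis by (simp add: sum_chi[OF assms(1)] sum_chi[OF assms(2)])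
qed

lemma sum_chi2_right:
  assumes "inductive_family d'"
  shows "(\<Sum>u\<in>{a} \<times> level d' n. chi2 d d' n u z) = tens (chi d n a) (\<lambda>_. 1) z"
  by (cases z) (simp add: sum.cartesian_product' chi2_def tens_def sum_distrib_left[symmetric] sum_chi[OF assms])

lemma sum_chi2_left:
  assumes "inductive_family d"
  shows "(\<Sum>u\<in>level d n \<times> {b}. chi2 d d' n u z) = tens (\<lambda>_. 1) (chi d' n b) z"
  by (cases z) (simp add: sum.cartesian_product' chi2_def tens_def sum_distrib_right[symmetric] sum_chi[OF assms])

text \<open>Taking for \<open>U\<close> the full rectangle, a row or a column of words yields the
  total mass and the two marginals. The equation for \<open>f\<close> is required at all points
  because additivity of \<Gamma> speaks about functions on the whole type.\<close>

lemma cfin_sum: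
  assumes fam: "inductive_family dX" "inductive_family dY"
    and C: "cantor_corr dX dY dA dB \<Gamma>" and U: "finite U"
    and f: "\<And>w. (\<Sum>u\<in>U. chi2 dA dB n u w) = f w"
  shows "(\<Sum>u\<in>U. cfin dX dY dA dB n \<Gamma> s t (fst u) (snd u)) =
    of_nat (card (level dX n)) * of_nat (card (level dY n)) *
     (LINT z|(mu dX \<Otimes>\<^sub>M mu dY). chi2 dX dY n (s, t) z * \<Gamma> f z)"
proof -
  note ucp = C[unfolded cantor_corr_def]
  note L = ucp_LinfD(1)[OF ucp]
  note int = integrable_chi2_mult[OF prob_space_mu_pair[OF fam] L]
  have f': "f = (\<lambda>w. \<Sum>u\<in>U. 1 * chi2 dA dB n u w)" by (simp add: f)
  have fC: "f \<in> Cfun (Omega dA \<times> Omega dB)" unfolding f' by (intro Cfun_sum Cfun_scale chi2_Cfun)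
  have ae: "AE z in mu dX \<Otimes>\<^sub>M mu dY. \<Gamma> f z = (\<Sum>u\<in>U. 1 * \<Gamma> (chi2 dA dB n u) z)"
    unfolding f' by (rule ucp_sum[OF ucp U chi2_Cfun])
  have "(LINT z|(mu dX \<Otimes>\<^sub>M mu dY). chi2 dX dY n (s, t) z * \<Gamma> f z) =
    (LINT z|(mu dX \<Otimes>\<^sub>M mu dY). (\<Sum>u\<in>U. chi2 dX dY n (s, t) z * \<Gamma> (chi2 dA dB n u) z))"
  proof (rule integral_cong_AE)
    show "(\<lambda>z. chi2 dX dY n (s, t) z * \<Gamma> f z) \<in> borel_measurable (mu dX \<Otimes>\<^sub>M mu dY)"
      using int[OF fC] by simp
    show "(\<lambda>z. \<Sum>u\<in>U. chi2 dX dY n (s, t) z * \<Gamma> (chi2 dA dB n u) z) \<in> borel_measurable (mu dX \<Otimes>\<^sub>M mu dY)"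
      using int[OF chi2_Cfun] by (intro borel_measurable_sum) simp
    show "AE z in mu dX \<Otimes>\<^sub>M mu dY. chi2 dX dY n (s, t) z * \<Gamma> f z =
      (\<Sum>u\<in>U. chi2 dX dY n (s, t) z * \<Gamma> (chi2 dA dB n u) z)"
      using ae by eventually_elim (simp add: sum_distrib_left)
  qed
  also have "\<dots> = (\<Sum>u\<in>U. LINT z|(mu dX \<Otimes>\<^sub>M mu dY). chi2 dX dY n (s, t) z * \<Gamma> (chi2 dA dB n u) z)"
    by (rule Bochner_Integration.integral_sum) (rule int[OF chi2_Cfun])
  finally show ?thesis by (simp add: cfin_def sum_distrib_left)
qed

lemma cfin_nonneg:
  assumes C: "cantor_corr dX dY dA dB \<Gamma>"
  shows "cfin dX dY dA dB n \<Gamma> s t a b \<in> \<real>\<^sub>\<ge>\<^sub>0"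
proof -
  have "AE z in mu dX \<Otimes>\<^sub>M mu dY. \<Gamma> (chi2 dA dB n (a, b)) z \<in> \<real>\<^sub>\<ge>\<^sub>0"
    by (rule ucp_positive[OF C[unfolded cantor_corr_def] chi2_Cfun]) (simp add: chi2_Omega)
  then have "AE z in mu dX \<Otimes>\<^sub>M mu dY. chi2 dX dY n (s, t) z * \<Gamma> (chi2 dA dB n (a, b)) z \<in> \<real>\<^sub>\<ge>\<^sub>0"
    using AE_space by eventually_elim (auto simp: space_pair_measure chi2_Omega)
  then show ?thesis
    unfolding cfin_def by (intro nonneg_Reals_mult_I integral_nonneg_Reals) simp_all
qed

lemma cfin_of_real:
  "cantor_corr dX dY dA dB \<Gamma> \<Longrightarrow>
    complex_of_real (Re (cfin dX dY dA dB n \<Gamma> s t a b)) = cfin dX dY dA dB n \<Gamma> s t a b"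
  using cfin_nonneg by (auto simp: complex_nonneg_Reals_iff complex_eq_iff)

lemma cfin_total:
  assumes fam: "inductive_family dX" "inductive_family dY" "inductive_family dA" "inductive_family dB"
    and C: "cantor_corr dX dY dA dB \<Gamma>" and st: "s \<in> level dX n" "t \<in> level dY n"
  shows "(\<Sum>u\<in>level dA n \<times> level dB n. cfin dX dY dA dB n \<Gamma> s t (fst u) (snd u)) = 1"
proof -
  note ucp = C[unfolded cantor_corr_def]
  note int = integrable_chi2_mult[OF prob_space_mu_pair[OF fam(1,2)] ucp_LinfD(1)[OF ucp]]
  have "(LINT z|(mu dX \<Otimes>\<^sub>M mu dY). chi2 dX dY n (s, t) z * \<Gamma> (\<lambda>_. 1) z) =
    (LINT z|(mu dX \<Otimes>\<^sub>M mu dY). chi2 dX dY n (s, t) z)"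
    by (rule integral_cong_AE) (use int[OF Cfun_const] ucp_LinfD(4)[OF ucp] in \<open>auto elim: eventually_mono\<close>)
  also have "\<dots> = 1 / (of_nat (card (level dX n)) * of_nat (card (level dY n)))"
    using integral_chi_pair[OF fam(1) st(1) fam(2) st(2)] by (simp add: chi2_def)
  finally show ?thesis
    using cfin_sum[OF fam(1,2) C _ sum_chi2_all[OF fam(3,4)], where s = s and t = t]
      level_nonempty[OF fam(1), of n] level_nonempty[OF fam(2), of n] by simp
qed

lemma cfin_fin_corr:
  assumes fam: "inductive_family dX" "inductive_family dY" "inductive_family dA" "inductive_family dB"
    and C: "cantor_corr dX dY dA dB \<Gamma>"
  shows "fin_corr (level dX n) (level dY n) (level dA n) (level dB n)
    (\<lambda>s t a b. Re (cfin dX dY dA dB n \<Gamma> s t a b))"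
  unfolding fin_corr_def cond_dist_def
proof (intro ballI conjI)
  fix st assume "st \<in> level dX n \<times> level dY n"
  then obtain s t where st: "st = (s, t)" "s \<in> level dX n" "t \<in> level dY n" by blast
  show "0 \<le> (case st of (s, t) \<Rightarrow> \<lambda>(u, v). Re (cfin dX dY dA dB n \<Gamma> s t u v)) u" for u
    using cfin_nonneg[OF C, of n s t "fst u" "snd u"] by (simp add: st(1) case_prod_unfold complex_nonneg_Reals_iff)
  have "Re (\<Sum>u\<in>level dA n \<times> level dB n. cfin dX dY dA dB n \<Gamma> s t (fst u) (snd u)) = 1"
    unfolding cfin_total[OF fam C st(2,3)] by simp
  then show "(\<Sum>u\<in>level dA n \<times> level dB n. (case st of (s, t) \<Rightarrow> \<lambda>(u, v). Re (cfin dX dY dA dB n \<Gamma> s t u v)) u) = 1"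
    by (simp add: st(1) case_prod_unfold)
qed

lemma Linf_times_chi:
  assumes "inductive_family d" "h \<in> Linf (mu d)"
  shows "integrable (mu d) (\<lambda>\<omega>. h \<omega> * chi d n s \<omega>)"
  by (rule integrable_times_chi[OF Linf_integrable[OF prob_space_mu[OF assms(1)] assms(2)]])

lemma integral_chi2_tens:
  assumes fam: "inductive_family d" "inductive_family d'"
    and h: "h \<in> Linf (mu d)" "h' \<in> Linf (mu d')"
  shows "integrable (mu d \<Otimes>\<^sub>M mu d') (\<lambda>z. chi2 d d' n (s, t) z * tens h h' z)"
    and "(LINT z|(mu d \<Otimes>\<^sub>M mu d'). chi2 d d' n (s, t) z * tens h h' z) =
    (LINT x|mu d. h x * chi d n s x) * (LINT y|mu d'. h' y * chi d' n t y)"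
proof -
  have eq: "(\<lambda>z. chi2 d d' n (s, t) z * tens h h' z) = tens (\<lambda>x. h x * chi d n s x) (\<lambda>y. h' y * chi d' n t y)"
    by (auto simp: chi2_def tens_def fun_eq_iff)
  note sf = prob_space_imp_sigma_finite[OF prob_space_mu[OF fam(1)]] prob_space_imp_sigma_finite[OF prob_space_mu[OF fam(2)]]
  show "integrable (mu d \<Otimes>\<^sub>M mu d') (\<lambda>z. chi2 d d' n (s, t) z * tens h h' z)"
    "(LINT z|(mu d \<Otimes>\<^sub>M mu d'). chi2 d d' n (s, t) z * tens h h' z) =
    (LINT x|mu d. h x * chi d n s x) * (LINT y|mu d'. h' y * chi d' n t y)"
    unfolding eq by (rule product_integral[OF sf Linf_times_chi[OF fam(1) h(1)] Linf_times_chi[OF fam(2) h(2)]])+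
qed

lemma Linf_one: "(\<lambda>_. 1) \<in> Linf M"
  unfolding Linf_def by auto

text \<open>If \<Gamma> sends a one-party cylinder function to a function \<open>h\<close> of that
  party's variable, the integral over the cylinder of \<open>(s, t)\<close> factorises. The other
  party contributes only the measure of its cylinder, which cancels against the
  normalisation.\<close>

lemma cfin_ns:
  assumes fam: "inductive_family dX" "inductive_family dY" "inductive_family dA" "inductive_family dB"
    and C: "cantor_corr dX dY dA dB \<Gamma>" and ns: "cantor_ns dX dY dA dB \<Gamma>"
  shows "fin_ns (level dX n) (level dY n) (level dA n) (level dB n) (\<lambda>s t a b. Re (cfin dX dY dA dB n \<Gamma> s t a b))"
proof -
  let ?M = "mu dX \<Otimes>\<^sub>M mu dY"
  note ucp = C[unfolded cantor_corr_def]
  note int = integrable_chi2_mult[OF prob_space_mu_pair[OF fam(1,2)] ucp_LinfD(1)[OF ucp]]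
  note nz = level_nonempty[OF fam(1), of n] level_nonempty[OF fam(2), of n]
  have A: "\<exists>r. \<forall>s\<in>level dX n. \<forall>t\<in>level dY n. (\<Sum>b\<in>level dB n. cfin dX dY dA dB n \<Gamma> s t a b) = r s" for a
  proof -
    obtain h where h: "h \<in> Linf (mu dX)" "AE z in ?M. \<Gamma> (tens (chi dA n a) (\<lambda>_. 1)) z = tens h (\<lambda>_. 1) z"
      using ns chi_Cfun unfolding cantor_ns_def by blast
    have "(\<Sum>b\<in>level dB n. cfin dX dY dA dB n \<Gamma> s t a b) =
      of_nat (card (level dX n)) * (LINT x|mu dX. h x * chi dX n s x)"
      if st: "s \<in> level dX n" "t \<in> level dY n" for s t
    proof -
      have "(LINT z|?M. chi2 dX dY n (s, t) z * \<Gamma> (tens (chi dA n a) (\<lambda>_. 1)) z) =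
        (LINT z|?M. chi2 dX dY n (s, t) z * tens h (\<lambda>_. 1) z)"
        by (rule integral_cong_AE)
           (use int[OF Cfun_tens[OF chi_Cfun Cfun_const]] integral_chi2_tens(1)[OF fam(1,2) h(1) Linf_one] h(2)
             in \<open>auto elim: eventually_mono\<close>)
      also have "\<dots> = (LINT x|mu dX. h x * chi dX n s x) / of_nat (card (level dY n))"
        unfolding integral_chi2_tens(2)[OF fam(1,2) h(1) Linf_one] using integral_chi[OF fam(2) st(2)] by simp
      finally have "(\<Sum>u\<in>{a} \<times> level dB n. cfin dX dY dA dB n \<Gamma> s t (fst u) (snd u)) =
        of_nat (card (level dX n)) * (LINT x|mu dX. h x * chi dX n s x)"
        using cfin_sum[OF fam(1,2) C _ sum_chi2_right[OF fam(4), where d = dA and n = n and a = a], where s = s and t = t] nz by simp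
      then show ?thesis by (simp add: sum.cartesian_product')
    qed
    then show ?thesis
      by (intro exI[of _ "\<lambda>s. of_nat (card (level dX n)) * (LINT x|mu dX. h x * chi dX n s x)"] ballI)
  qed
  have B: "\<exists>r. \<forall>s\<in>level dX n. \<forall>t\<in>level dY n. (\<Sum>a\<in>level dA n. cfin dX dY dA dB n \<Gamma> s t a b) = r t" for b
  proof -
    obtain h where h: "h \<in> Linf (mu dY)" "AE z in ?M. \<Gamma> (tens (\<lambda>_. 1) (chi dB n b)) z = tens (\<lambda>_. 1) h z"
      using ns chi_Cfun unfolding cantor_ns_def by blast
    have "(\<Sum>a\<in>level dA n. cfin dX dY dA dB n \<Gamma> s t a b) =
      of_nat (card (level dY n)) * (LINT y|mu dY. h y * chi dY n t y)"
      if st: "s \<in> level dX n" "t \<in> level dY n" for s t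
    proof -
      have "(LINT z|?M. chi2 dX dY n (s, t) z * \<Gamma> (tens (\<lambda>_. 1) (chi dB n b)) z) =
        (LINT z|?M. chi2 dX dY n (s, t) z * tens (\<lambda>_. 1) h z)"
        by (rule integral_cong_AE)
           (use int[OF Cfun_tens[OF Cfun_const chi_Cfun]] integral_chi2_tens(1)[OF fam(1,2) Linf_one h(1)] h(2)
             in \<open>auto elim: eventually_mono\<close>)
      also have "\<dots> = (LINT y|mu dY. h y * chi dY n t y) / of_nat (card (level dX n))"
        unfolding integral_chi2_tens(2)[OF fam(1,2) Linf_one h(1)] using integral_chi[OF fam(1) st(1)] by simp
      finally have "(\<Sum>u\<in>level dA n \<times> {b}. cfin dX dY dA dB n \<Gamma> s t (fst u) (snd u)) =
        of_nat (card (level dY n)) * (LINT y|mu dY. h y * chi dY n t y)"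
        using cfin_sum[OF fam(1,2) C _ sum_chi2_left[OF fam(3), where d' = dB and n = n and b = b], where s = s and t = t] nz by simp
      then show ?thesis by (simp add: sum.cartesian_product')
    qed
    then show ?thesis
      by (intro exI[of _ "\<lambda>t. of_nat (card (level dY n)) * (LINT y|mu dY. h y * chi dY n t y)"] ballI)
  qed
  show ?thesis
    unfolding fin_ns_def Re_sum[symmetric]
  proof (intro conjI ballI)
    fix s t t' a assume "s \<in> level dX n" "t \<in> level dY n" "t' \<in> level dY n"
    then show "Re (\<Sum>b\<in>level dB n. cfin dX dY dA dB n \<Gamma> s t a b) = Re (\<Sum>b\<in>level dB n. cfin dX dY dA dB n \<Gamma> s t' a b)"
      using A[of a] by (auto simp del: Re_sum)
  next
    fix s s' t b assume "s \<in> level dX n" "s' \<in> level dX n" "t \<in> level dY n"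
    then show "Re (\<Sum>a\<in>level dA n. cfin dX dY dA dB n \<Gamma> s t a b) = Re (\<Sum>a\<in>level dA n. cfin dX dY dA dB n \<Gamma> s' t a b)"
      using B[of b] by (auto simp del: Re_sum)
  qed
qed

section \<open>One-party averages and local correlations\<close>

definition cond_avg :: "(nat \<Rightarrow> nat) \<Rightarrow> (nat \<Rightarrow> nat) \<Rightarrow> nat \<Rightarrow>
    (((nat \<Rightarrow> nat) \<Rightarrow> complex) \<Rightarrow> (nat \<Rightarrow> nat) \<Rightarrow> complex) \<Rightarrow> (nat \<Rightarrow> nat) \<Rightarrow> (nat \<Rightarrow> nat) \<Rightarrow> complex" where
  "cond_avg dX dA n \<Phi> s a = of_nat (card (level dX n)) * (LINT x|mu dX. \<Phi> (chi dA n a) x * chi dX n s x)"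

lemma cond_avg_props:
  assumes fam: "inductive_family dX" "inductive_family dA" and U: "ucp_Linf (Omega dA) (mu dX) \<Phi>"
  shows "cond_avg dX dA n \<Phi> s a \<in> \<real>\<^sub>\<ge>\<^sub>0"
    and "s \<in> level dX n \<Longrightarrow> (\<Sum>a\<in>level dA n. cond_avg dX dA n \<Phi> s a) = 1"
proof -
  have "AE x in mu dX. \<Phi> (chi dA n a) x \<in> \<real>\<^sub>\<ge>\<^sub>0"
    by (rule ucp_positive[OF U chi_Cfun chi_nonneg])
  then have "AE x in mu dX. \<Phi> (chi dA n a) x * chi dX n s x \<in> \<real>\<^sub>\<ge>\<^sub>0"
    by eventually_elim (intro nonneg_Reals_mult_I chi_nonneg)
  then show "cond_avg dX dA n \<Phi> s a \<in> \<real>\<^sub>\<ge>\<^sub>0"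
    unfolding cond_avg_def by (intro nonneg_Reals_mult_I integral_nonneg_Reals) simp_all
  assume s: "s \<in> level dX n"
  note int = Linf_times_chi[OF fam(1) ucp_LinfD(1)[OF U chi_Cfun]]
  have one: "(\<lambda>w. \<Sum>a\<in>level dA n. 1 * chi dA n a w) = (\<lambda>_. 1)" by (simp add: sum_chi[OF fam(2)])
  have ae: "AE x in mu dX. \<Phi> (\<lambda>_. 1) x = (\<Sum>a\<in>level dA n. 1 * \<Phi> (chi dA n a) x)"
    unfolding one[symmetric] by (rule ucp_sum[OF U finite_level chi_Cfun])
  have "(\<Sum>a\<in>level dA n. LINT x|mu dX. \<Phi> (chi dA n a) x * chi dX n s x) =
    (LINT x|mu dX. (\<Sum>a\<in>level dA n. \<Phi> (chi dA n a) x * chi dX n s x))"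
    by (rule Bochner_Integration.integral_sum[symmetric]) (rule int)
  also have "\<dots> = (LINT x|mu dX. chi dX n s x)"
  proof (rule integral_cong_AE)
    show "(\<lambda>x. \<Sum>a\<in>level dA n. \<Phi> (chi dA n a) x * chi dX n s x) \<in> borel_measurable (mu dX)"
      using int by (intro borel_measurable_sum) simp
    show "AE x in mu dX. (\<Sum>a\<in>level dA n. \<Phi> (chi dA n a) x * chi dX n s x) = chi dX n s x"
      using ae ucp_LinfD(4)[OF U] by eventually_elim (simp add: sum_distrib_right[symmetric])
  qed simp
  finally show "(\<Sum>a\<in>level dA n. cond_avg dX dA n \<Phi> s a) = 1"
    using integral_chi[OF fam(1) s] level_nonempty[OF fam(1), of n]
    by (simp add: cond_avg_def sum_distrib_left[symmetric])
qed

lemma cond_avg_cond_dist: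
  assumes "inductive_family dX" "inductive_family dA" "ucp_Linf (Omega dA) (mu dX) \<Phi>"
  shows "cond_dist (level dX n) (level dA n) (\<lambda>s a. Re (cond_avg dX dA n \<Phi> s a))"
  unfolding cond_dist_def
  using cond_avg_props[OF assms] by (auto simp: complex_nonneg_Reals_iff Re_sum[symmetric] simp del: Re_sum)

text \<open>Integration over a product cylinder factorises on each term
  \<open>\<Phi> k \<otimes> \<Psi> k\<close>, so the convex combination keeps its weights and its
  factors become one-party averages.\<close>

lemma cfin_loc:
  assumes fam: "inductive_family dX" "inductive_family dY" "inductive_family dA" "inductive_family dB"
    and C: "cantor_corr dX dY dA dB \<Gamma>" and loc: "cantor_loc dX dY dA dB \<Gamma>"
  shows "fin_loc (level dX n) (level dY n) (level dA n) (level dB n) (\<lambda>s t a b. Re (cfin dX dY dA dB n \<Gamma> s t a b))"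
proof -
  let ?M = "mu dX \<Otimes>\<^sub>M mu dY"
  obtain m c \<Phi> \<Psi> where
    k: "\<And>k. k < (m::nat) \<Longrightarrow> 0 \<le> c k \<and> ucp_Linf (Omega dA) (mu dX) (\<Phi> k) \<and> ucp_Linf (Omega dB) (mu dY) (\<Psi> k)"
    and c1: "(\<Sum>k<m. c k) = 1"
    and ae: "\<forall>f\<in>Cfun (Omega dA). \<forall>g\<in>Cfun (Omega dB). AE z in ?M.
           \<Gamma> (tens f g) z = (\<Sum>k<m. complex_of_real (c k) * tens (\<Phi> k f) (\<Psi> k g) z)"
    using loc unfolding cantor_loc_def by blast
  note ucp = C[unfolded cantor_corr_def]
  note int = integrable_chi2_mult[OF prob_space_mu_pair[OF fam(1,2)] ucp_LinfD(1)[OF ucp chi2_Cfun]]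
  have "cfin dX dY dA dB n \<Gamma> s t a b =
    (\<Sum>k<m. complex_of_real (c k) * cond_avg dX dA n (\<Phi> k) s a * cond_avg dY dB n (\<Psi> k) t b)" for s t a b
  proof -
    have L: "\<Phi> k (chi dA n a) \<in> Linf (mu dX)" "\<Psi> k (chi dB n b) \<in> Linf (mu dY)" if "k < m" for k
      using k[OF that] ucp_LinfD(1) chi_Cfun by blast+
    note int' = integral_chi2_tens[OF fam(1,2) L(1) L(2)]
    have "(LINT z|?M. chi2 dX dY n (s, t) z * \<Gamma> (chi2 dA dB n (a, b)) z) =
      (LINT z|?M. (\<Sum>k<m. complex_of_real (c k) * (chi2 dX dY n (s, t) z * tens (\<Phi> k (chi dA n a)) (\<Psi> k (chi dB n b)) z)))"
    proof (rule integral_cong_AE)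
      show "(\<lambda>z. chi2 dX dY n (s, t) z * \<Gamma> (chi2 dA dB n (a, b)) z) \<in> borel_measurable ?M"
        using int by simp
      show "(\<lambda>z. \<Sum>k<m. complex_of_real (c k) * (chi2 dX dY n (s, t) z * tens (\<Phi> k (chi dA n a)) (\<Psi> k (chi dB n b)) z))
        \<in> borel_measurable ?M"
        using int'(1) by (intro borel_measurable_sum borel_measurable_integrable integrable_mult_right) auto
      have "AE z in ?M. \<Gamma> (tens (chi dA n a) (chi dB n b)) z =
          (\<Sum>k<m. complex_of_real (c k) * tens (\<Phi> k (chi dA n a)) (\<Psi> k (chi dB n b)) z)"
        using ae chi_Cfun by blast
      then show "AE z in ?M. chi2 dX dY n (s, t) z * \<Gamma> (chi2 dA dB n (a, b)) z =
        (\<Sum>k<m. complex_of_real (c k) * (chi2 dX dY n (s, t) z * tens (\<Phi> k (chi dA n a)) (\<Psi> k (chi dB n b)) z))"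
        by eventually_elim (simp add: chi2_def[of dA] sum_distrib_left mult.left_commute)
    qed
    also have "\<dots> = (\<Sum>k<m. LINT z|?M. complex_of_real (c k) * (chi2 dX dY n (s, t) z * tens (\<Phi> k (chi dA n a)) (\<Psi> k (chi dB n b)) z))"
      using int'(1) by (intro Bochner_Integration.integral_sum integrable_mult_right) auto
    also have "\<dots> = (\<Sum>k<m. complex_of_real (c k) *
        ((LINT x|mu dX. \<Phi> k (chi dA n a) x * chi dX n s x) * (LINT y|mu dY. \<Psi> k (chi dB n b) y * chi dY n t y)))"
      by (intro sum.cong refl) (simp add: int'(2))
    finally show ?thesis
      by (simp add: cfin_def cond_avg_def sum_distrib_left mult_ac)
  qed
  moreover have "complex_of_real (Re (cond_avg dX dA n (\<Phi> k) s a)) = cond_avg dX dA n (\<Phi> k) s a"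
    "complex_of_real (Re (cond_avg dY dB n (\<Psi> k) t b)) = cond_avg dY dB n (\<Psi> k) t b" if "k < m" for k s t a b
    using cond_avg_props(1)[OF fam(1,3)] cond_avg_props(1)[OF fam(2,4)] k[OF that]
    by (auto simp: complex_nonneg_Reals_iff complex_eq_iff)
  ultimately have eq: "complex_of_real (Re (cfin dX dY dA dB n \<Gamma> s t a b)) = complex_of_real
    (\<Sum>k<m. c k * Re (cond_avg dX dA n (\<Phi> k) s a) * Re (cond_avg dY dB n (\<Psi> k) t b))" for s t a b
    unfolding cfin_of_real[OF C] by simp
  show ?thesis
    unfolding fin_loc_def
  proof (intro exI conjI allI impI ballI)
    show "(\<Sum>k<m. c k) = 1" by (rule c1)
    show "Re (cfin dX dY dA dB n \<Gamma> s t a b) =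
      (\<Sum>k<m. c k * (\<lambda>k s a. Re (cond_avg dX dA n (\<Phi> k) s a)) k s a * (\<lambda>k t b. Re (cond_avg dY dB n (\<Psi> k) t b)) k t b)"
      for s t a b using eq unfolding of_real_eq_iff .
  qed (use k cond_avg_cond_dist fam in auto)
qed

section \<open>Slices of operator fields\<close>

lemma opfieldD:
  assumes "F \<in> opfield M J"
  shows "x \<in> space M \<Longrightarrow> bounded_op J (F x)"
    and "v \<in> ell2 J \<Longrightarrow> w \<in> ell2 J \<Longrightarrow> (\<lambda>x. ip (F x v) w) \<in> borel_measurable M"
  using assms unfolding opfield_def by blast+

lemma opfield_bound:
  assumes "F \<in> opfield M J"
  obtains C where "0 \<le> C" "AE x in M. \<forall>v\<in>ell2 J. l2norm (F x v) \<le> C * l2norm v"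
proof -
  obtain C where C: "AE x in M. \<forall>v\<in>ell2 J. l2norm (F x v) \<le> C * l2norm v"
    using assms unfolding opfield_def by blast
  have le: "l2norm u \<le> max C 0 * l2norm v" if "l2norm u \<le> C * l2norm v" for u v :: "nat \<Rightarrow> complex"
    using that mult_right_mono[of C "max C 0" "l2norm v"] by simp
  have "AE x in M. \<forall>v\<in>ell2 J. l2norm (F x v) \<le> max C 0 * l2norm v"
    using C by eventually_elim (use le in blast)
  then show ?thesis using that[of "max C 0"] by simp
qed

lemma opfield_coord_measurable:
  assumes F: "F \<in> opfield M J" and v: "v \<in> ell2 J"
  shows "(\<lambda>x. F x v i) \<in> borel_measurable M"
proof (cases "i \<in> J")
  case True
  then show ?thesis using opfieldD(2)[OF F v bvec_ell2[OF True]] by (simp add: ip_bvec)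
next
  case False
  then have "F x v i = 0" if "x \<in> space M" for x
    using ell2_outside[OF bounded_opD(1)[OF opfieldD(1)[OF F that] v]] by simp
  then show ?thesis by (subst measurable_cong[where g = "\<lambda>_. 0"]) auto
qed

lemma slice_integrable:
  assumes F: "F \<in> opfield M J" and v: "v \<in> ell2 J" and g: "integrable M g"
  shows "integrable M (\<lambda>x. g x * F x v i)"
proof -
  obtain C where C: "0 \<le> C" "AE x in M. \<forall>v\<in>ell2 J. l2norm (F x v) \<le> C * l2norm v"
    by (rule opfield_bound[OF F])
  have "integrable M (\<lambda>x. complex_of_real (C * l2norm v) * g x)" using g by simp
  then show ?thesis
  proof (rule Bochner_Integration.integrable_bound)
    show "(\<lambda>x. g x * F x v i) \<in> borel_measurable M"
      using g by (intro borel_measurable_times opfield_coord_measurable[OF F v]) simp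
    show "AE x in M. norm (g x * F x v i) \<le> norm (complex_of_real (C * l2norm v) * g x)"
      using C(2) AE_space
    proof eventually_elim
      case (elim x)
      have "cmod (F x v i) \<le> l2norm (F x v)"
        by (rule cmod_le_l2norm[OF bounded_opD(1)[OF opfieldD(1)[OF F elim(2)] v]])
      also have "\<dots> \<le> C * l2norm v" using elim(1) v by blast
      finally show ?case using C(1) by (simp add: norm_mult abs_mult mult.commute mult_left_mono)
    qed
  qed
qed

text \<open>With natural numbers as indices, unordered sums become series, to which dominated
  convergence for sequences applies.\<close>

lemma ip_sums: "v \<in> ell2 J \<Longrightarrow> w \<in> ell2 J \<Longrightarrow> (\<lambda>i. v i * cnj (w i)) sums ip v w"
  for J :: "nat set"
  unfolding ip_def by (intro has_sum_imp_sums has_sum_infsum ip_summable(1))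

text \<open>Minkowski's integral inequality by duality: on a finite set the slice is paired with
  itself, Cauchy-Schwarz is applied under the integral, and a factor \<open>N\<close> cancels from
  \<open>N * N \<le> B * N\<close>.\<close>

lemma slice_ell2:
  assumes F: "F \<in> opfield M J" and g: "integrable M g"
    and C: "0 \<le> C" "AE x in M. \<forall>v\<in>ell2 J. l2norm (F x v) \<le> C * l2norm v" and v: "v \<in> ell2 J"
  shows "slice M g F v \<in> ell2 J" "l2norm (slice M g F v) \<le> (LINT x|M. cmod (g x)) * C * l2norm v"
proof -
  define B where "B = (LINT x|M. cmod (g x)) * C * l2norm v"
  have B0: "0 \<le> B" using C(1) by (auto simp: B_def intro!: mult_nonneg_nonneg Bochner_Integration.integral_nonneg)
  define s where "s = slice M g F v"
  note int = slice_integrable[OF F v g]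
  have le: "(\<Sum>i\<in>S. (cmod (s i))\<^sup>2) \<le> B\<^sup>2" if S: "finite S" for S
  proof -
    define N where "N = L2_set (\<lambda>i. cmod (s i)) S"
    have N: "0 \<le> N" "(\<Sum>i\<in>S. (cmod (s i))\<^sup>2) = N\<^sup>2" by (auto simp: N_def L2_set_def sum_nonneg)
    have "complex_of_real (N\<^sup>2) = (\<Sum>i\<in>S. s i * cnj (s i))"
      unfolding N(2)[symmetric] of_real_sum complex_norm_square ..
    also have "\<dots> = (\<Sum>i\<in>S. LINT x|M. (g x * F x v i) * cnj (s i))"
      by (intro sum.cong refl) (simp add: s_def slice_def)
    also have "\<dots> = (LINT x|M. (\<Sum>i\<in>S. (g x * F x v i) * cnj (s i)))"
      using int by (intro Bochner_Integration.integral_sum[symmetric]) auto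
    finally have "N\<^sup>2 = cmod (LINT x|M. (\<Sum>i\<in>S. (g x * F x v i) * cnj (s i)))"
      by (metis abs_of_nonneg norm_of_real zero_le_power2)
    also have "\<dots> \<le> (LINT x|M. cmod (\<Sum>i\<in>S. (g x * F x v i) * cnj (s i)))"
      by (rule integral_norm_bound)
    also have "\<dots> \<le> (LINT x|M. cmod (g x) * (C * l2norm v * N))"
    proof (rule integral_mono_AE)
      show "integrable M (\<lambda>x. cmod (\<Sum>i\<in>S. (g x * F x v i) * cnj (s i)))"
        using int by (intro integrable_norm Bochner_Integration.integrable_sum) auto
      show "integrable M (\<lambda>x. cmod (g x) * (C * l2norm v * N))" using g by simp
      show "AE x in M. cmod (\<Sum>i\<in>S. (g x * F x v i) * cnj (s i)) \<le> cmod (g x) * (C * l2norm v * N)"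
        using C(2) AE_space
      proof eventually_elim
        case (elim x)
        have Fx: "F x v \<in> ell2 J" by (rule bounded_opD(1)[OF opfieldD(1)[OF F elim(2)] v])
        have "cmod (\<Sum>i\<in>S. F x v i * cnj (s i)) \<le> (\<Sum>i\<in>S. \<bar>cmod (F x v i)\<bar> * \<bar>cmod (s i)\<bar>)"
          by (rule order_trans[OF norm_sum]) (simp add: norm_mult)
        also have "\<dots> \<le> L2_set (\<lambda>i. cmod (F x v i)) S * N"
          unfolding N_def by (rule L2_set_mult_ineq)
        also have "\<dots> \<le> (C * l2norm v) * N"
        proof (rule mult_right_mono[OF _ N(1)])
          have "L2_set (\<lambda>i. cmod (F x v i)) S \<le> l2norm (F x v)"
            using sum_le_l2norm[OF Fx S] by (auto simp: L2_set_def intro!: real_le_lsqrt sum_nonneg)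
          also have "\<dots> \<le> C * l2norm v" using elim(1) v by blast
          finally show "L2_set (\<lambda>i. cmod (F x v i)) S \<le> C * l2norm v" .
        qed
        finally have "cmod (\<Sum>i\<in>S. F x v i * cnj (s i)) \<le> C * l2norm v * N" .
        moreover have "(\<Sum>i\<in>S. (g x * F x v i) * cnj (s i)) = g x * (\<Sum>i\<in>S. F x v i * cnj (s i))"
          by (simp add: sum_distrib_left mult.assoc)
        ultimately show ?case by (simp add: norm_mult mult_left_mono)
      qed
    qed
    also have "\<dots> = B * N" by (simp add: B_def)
    finally have "N * N \<le> B * N" by (simp add: power2_eq_square)
    then have "N \<le> B" using N(1) B0 by (cases "N = 0") (auto simp: mult_le_cancel_right)
    then show ?thesis unfolding N(2) using N(1) by (rule power_mono)
  qed
  have "s i = 0" if "i \<notin> J" for i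
  proof -
    have "s i = (LINT x|M. 0)" unfolding s_def slice_def
      by (intro Bochner_Integration.integral_cong refl)
         (use ell2_outside[OF bounded_opD(1)[OF opfieldD(1)[OF F] v] that] in simp)
    then show ?thesis by simp
  qed
  from ell2_bounded_sums[OF this le B0]
  show "slice M g F v \<in> ell2 J" "l2norm (slice M g F v) \<le> (LINT x|M. cmod (g x)) * C * l2norm v"
    unfolding s_def B_def by blast+
qed

lemma slice_bounded_op:
  assumes F: "F \<in> opfield M J" and g: "integrable M g"
  shows "bounded_op J (slice M g F)"
proof -
  obtain C where C: "0 \<le> C" "AE x in M. \<forall>v\<in>ell2 J. l2norm (F x v) \<le> C * l2norm v"
    by (rule opfield_bound[OF F])
  note e = slice_ell2[OF F g C]
  show ?thesis
    unfolding bounded_op_def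
  proof (intro conjI ballI allI exI)
    fix v assume v: "v \<in> ell2 J"
    show "slice M g F v \<in> ell2 J" by (rule e(1)[OF v])
    show "l2norm (slice M g F v) \<le> (LINT x|M. cmod (g x)) * C * l2norm v" by (rule e(2)[OF v])
    show "slice M g F (\<lambda>i. v i + w i) = (\<lambda>i. slice M g F v i + slice M g F w i)" if w: "w \<in> ell2 J" for w
    proof
      fix i
      have "slice M g F (\<lambda>i. v i + w i) i = (LINT x|M. g x * F x v i + g x * F x w i)"
        unfolding slice_def
        by (intro Bochner_Integration.integral_cong refl)
           (simp add: bounded_opD(2)[OF opfieldD(1)[OF F] v w] distrib_left)
      then show "slice M g F (\<lambda>i. v i + w i) i = slice M g F v i + slice M g F w i"
        unfolding slice_def using slice_integrable[OF F v g] slice_integrable[OF F w g] by simp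
    qed
    show "slice M g F (\<lambda>i. c * v i) = (\<lambda>i. c * slice M g F v i)" for c
    proof
      fix i
      have "slice M g F (\<lambda>i. c * v i) i = (LINT x|M. c * (g x * F x v i))"
        unfolding slice_def
        by (intro Bochner_Integration.integral_cong refl)
           (simp add: bounded_opD(3)[OF opfieldD(1)[OF F] v] mult.left_commute)
      then show "slice M g F (\<lambda>i. c * v i) i = c * slice M g F v i" by (simp add: slice_def)
    qed
  qed
qed

text \<open>Recovers the weak formula for the slice map from its coordinatewise definition: partial
  sums commute with the integral, and dominated convergence passes to the limit.\<close>

lemma ip_slice:
  assumes F: "F \<in> opfield M J" and g: "integrable M g" and v: "v \<in> ell2 J" and w: "w \<in> ell2 J"
  shows "ip (slice M g F v) w = (LINT x|M. g x * ip (F x v) w)"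
proof -
  obtain C where C: "0 \<le> C" "AE x in M. \<forall>v\<in>ell2 J. l2norm (F x v) \<le> C * l2norm v"
    by (rule opfield_bound[OF F])
  have gm: "g \<in> borel_measurable M" using g by simp
  have sv: "slice M g F v \<in> ell2 J" by (rule bounded_opD(1)[OF slice_bounded_op[OF F g] v])
  have "(\<lambda>N. LINT x|M. g x * (\<Sum>i<N. F x v i * cnj (w i))) \<longlonglongrightarrow> (LINT x|M. g x * ip (F x v) w)"
  proof (rule integral_dominated_convergence[where w = "\<lambda>x. cmod (g x) * (C * l2norm v * l2norm w)"])
    show "(\<lambda>x. g x * ip (F x v) w) \<in> borel_measurable M"
      by (rule borel_measurable_times[OF gm opfieldD(2)[OF F v w]])
    show "(\<lambda>x. g x * (\<Sum>i<N. F x v i * cnj (w i))) \<in> borel_measurable M" for N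
      by (intro borel_measurable_times gm borel_measurable_sum opfield_coord_measurable[OF F v]) simp
    show "integrable M (\<lambda>x. cmod (g x) * (C * l2norm v * l2norm w))" using g by simp
    show "AE x in M. (\<lambda>N. g x * (\<Sum>i<N. F x v i * cnj (w i))) \<longlonglongrightarrow> g x * ip (F x v) w"
    proof (rule AE_I2)
      fix x assume "x \<in> space M"
      then have "F x v \<in> ell2 J" by (rule bounded_opD(1)[OF opfieldD(1)[OF F] v])
      from ip_sums[OF this w] show "(\<lambda>N. g x * (\<Sum>i<N. F x v i * cnj (w i))) \<longlonglongrightarrow> g x * ip (F x v) w"
        unfolding sums_def by (rule tendsto_mult_left)
    qed
    show "AE x in M. norm (g x * (\<Sum>i<N. F x v i * cnj (w i))) \<le> cmod (g x) * (C * l2norm v * l2norm w)" for N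
      using C(2) AE_space
    proof eventually_elim
      case (elim x)
      have Fx: "F x v \<in> ell2 J" by (rule bounded_opD(1)[OF opfieldD(1)[OF F elim(2)] v])
      have "cmod (\<Sum>i<N. F x v i * cnj (w i)) \<le> l2norm (F x v) * l2norm w"
        by (rule ip_partial_bound[OF Fx w]) simp
      also have "\<dots> \<le> (C * l2norm v) * l2norm w"
        by (rule mult_right_mono) (use elim(1) v in auto)
      finally show ?case by (simp add: norm_mult mult_left_mono)
    qed
  qed
  moreover have "(LINT x|M. g x * (\<Sum>i<N. F x v i * cnj (w i))) = (\<Sum>i<N. slice M g F v i * cnj (w i))" for N
  proof -
    have "(LINT x|M. g x * (\<Sum>i<N. F x v i * cnj (w i))) = (LINT x|M. (\<Sum>i<N. (g x * F x v i) * cnj (w i)))"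
      by (simp add: sum_distrib_left mult.assoc)
    also have "\<dots> = (\<Sum>i<N. LINT x|M. (g x * F x v i) * cnj (w i))"
      using slice_integrable[OF F v g] by (intro Bochner_Integration.integral_sum) auto
    finally show ?thesis by (simp add: slice_def)
  qed
  ultimately have "(\<lambda>N. \<Sum>i<N. slice M g F v i * cnj (w i)) \<longlonglongrightarrow> (LINT x|M. g x * ip (F x v) w)" by simp
  with ip_sums[OF sv w] show ?thesis unfolding sums_def by (rule LIMSEQ_unique)
qed

section \<open>Composition and commutation of slices\<close>

lemma op_sums:
  fixes J :: "nat set"
  assumes "bounded_op J T" "v \<in> ell2 J"
  shows "(\<lambda>j. v j * T (bvec j) i) sums T v i"
  by (rule has_sum_imp_sums[OF bounded_op_has_sum[OF assms]])

text \<open>A partial sum of the expansion is \<open>T\<close> applied to a truncation of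
  \<open>v\<close>, whose norm is at most that of \<open>v\<close>. The bound is uniform in
  \<open>S\<close> and dominates the partial sums in \<open>op_slice\<close>.\<close>

lemma op_partial_bound:
  assumes T: "bounded_op J T" and C: "0 \<le> C" "\<And>v. v \<in> ell2 J \<Longrightarrow> l2norm (T v) \<le> C * l2norm v"
    and v: "v \<in> ell2 J" and S: "finite S"
  shows "cmod (\<Sum>j\<in>S. v j * T (bvec j) i) \<le> C * l2norm v"
proof -
  define u where "u = (\<lambda>i. if i \<in> S then v i else 0)"
  have u: "u \<in> ell2 J" unfolding u_def using ell2_restrict[OF v, of S] ell2_mono by blast
  have "((\<lambda>j. u j * T (bvec j) i) has_sum T u i) UNIV" by (rule bounded_op_has_sum[OF T u])
  moreover have "((\<lambda>j. u j * T (bvec j) i) has_sum (\<Sum>j\<in>S. v j * T (bvec j) i)) UNIV"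
    by (rule has_sum_finite_neutralI[where B = S]) (use S in \<open>auto simp: u_def\<close>)
  ultimately have "T u i = (\<Sum>j\<in>S. v j * T (bvec j) i)" by (rule has_sum_unique)
  moreover have "cmod (T u i) \<le> C * l2norm u"
    by (rule order_trans[OF cmod_le_l2norm[OF bounded_opD(1)[OF T u]] C(2)[OF u]])
  moreover have "l2norm u \<le> l2norm v"
  proof (rule ell2_bounded_sums(2)[where J = J])
    show "(\<Sum>i\<in>S'. (cmod (u i))\<^sup>2) \<le> (l2norm v)\<^sup>2" if "finite S'" for S'
      by (rule order_trans[OF sum_mono sum_le_l2norm[OF v that]]) (simp add: u_def)
  qed (use ell2_outside[OF u] in auto)
  ultimately show ?thesis using mult_left_mono[OF _ C(1), of "l2norm u" "l2norm v"] by simp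
qed

text \<open>A bounded operator moves under the integral: its column expansion reduces this to finite
  sums. The same expansion gives measurability of \<open>T (F x v) i\<close>.\<close>

lemma op_slice:
  assumes T: "bounded_op J T" and F: "F \<in> opfield M J" and g: "integrable M g" and v: "v \<in> ell2 J"
  shows "T (slice M g F v) i = (LINT x|M. g x * T (F x v) i)"
proof -
  obtain D where D: "0 \<le> D" "\<And>v. v \<in> ell2 J \<Longrightarrow> l2norm (T v) \<le> D * l2norm v"
    using bounded_op_bound[OF T] by blast
  obtain C where C: "0 \<le> C" "AE x in M. \<forall>v\<in>ell2 J. l2norm (F x v) \<le> C * l2norm v"
    by (rule opfield_bound[OF F])
  have gm: "g \<in> borel_measurable M" using g by simp
  have sv: "slice M g F v \<in> ell2 J" by (rule bounded_opD(1)[OF slice_bounded_op[OF F g] v])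
  have Fx: "F x v \<in> ell2 J" if "x \<in> space M" for x by (rule bounded_opD(1)[OF opfieldD(1)[OF F that] v])
  have meas: "(\<lambda>x. \<Sum>j<N. F x v j * T (bvec j) i) \<in> borel_measurable M" for N
    by (intro borel_measurable_sum borel_measurable_times opfield_coord_measurable[OF F v]) simp
  have lim: "(\<lambda>N. \<Sum>j<N. F x v j * T (bvec j) i) \<longlonglongrightarrow> T (F x v) i" if "x \<in> space M" for x
    using op_sums[OF T Fx[OF that]] unfolding sums_def .
  have "(\<lambda>N. LINT x|M. g x * (\<Sum>j<N. F x v j * T (bvec j) i)) \<longlonglongrightarrow> (LINT x|M. g x * T (F x v) i)"
  proof (rule integral_dominated_convergence[where w = "\<lambda>x. cmod (g x) * (D * (C * l2norm v))"])
    show "(\<lambda>x. g x * T (F x v) i) \<in> borel_measurable M"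
      by (rule borel_measurable_times[OF gm borel_measurable_LIMSEQ_metric[OF meas lim]])
    show "(\<lambda>x. g x * (\<Sum>j<N. F x v j * T (bvec j) i)) \<in> borel_measurable M" for N
      by (rule borel_measurable_times[OF gm meas])
    show "integrable M (\<lambda>x. cmod (g x) * (D * (C * l2norm v)))" using g by simp
    show "AE x in M. (\<lambda>N. g x * (\<Sum>j<N. F x v j * T (bvec j) i)) \<longlonglongrightarrow> g x * T (F x v) i"
      by (rule AE_I2) (rule tendsto_mult_left[OF lim])
    show "AE x in M. norm (g x * (\<Sum>j<N. F x v j * T (bvec j) i)) \<le> cmod (g x) * (D * (C * l2norm v))" for N
      using C(2) AE_space
    proof eventually_elim
      case (elim x)
      have "cmod (\<Sum>j<N. F x v j * T (bvec j) i) \<le> D * l2norm (F x v)"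
        by (rule op_partial_bound[OF T D Fx[OF elim(2)] finite_lessThan])
      also have "\<dots> \<le> D * (C * l2norm v)" by (rule mult_left_mono[OF _ D(1)]) (use elim(1) v in blast)
      finally show ?case by (simp add: norm_mult mult_left_mono)
    qed
  qed
  moreover have "(LINT x|M. g x * (\<Sum>j<N. F x v j * T (bvec j) i)) = (\<Sum>j<N. slice M g F v j * T (bvec j) i)" for N
  proof -
    have "(LINT x|M. g x * (\<Sum>j<N. F x v j * T (bvec j) i)) = (LINT x|M. (\<Sum>j<N. (g x * F x v j) * T (bvec j) i))"
      by (simp add: sum_distrib_left mult.assoc)
    also have "\<dots> = (\<Sum>j<N. LINT x|M. (g x * F x v j) * T (bvec j) i)"
      using slice_integrable[OF F v g] by (intro Bochner_Integration.integral_sum) auto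
    finally show ?thesis by (simp add: slice_def)
  qed
  ultimately have "(\<lambda>N. \<Sum>j<N. slice M g F v j * T (bvec j) i) \<longlonglongrightarrow> (LINT x|M. g x * T (F x v) i)" by simp
  with op_sums[OF T sv] show ?thesis unfolding sums_def by (rule LIMSEQ_unique)
qed

text \<open>Membership in \<open>opfield\<close> gives measurability for fixed vectors only, whereas
  here the vector \<open>G y v\<close> varies. Expanding it in basis vectors exhibits the integrand
  as a limit of sums of products of one-variable functions; Fubini and \<open>op_slice\<close> do
  the rest.\<close>

lemma slice_slice:
  assumes sf: "sigma_finite_measure M" "sigma_finite_measure N"
    and F: "F \<in> opfield M J" and G: "G \<in> opfield N J"
    and f: "integrable M f" and g: "integrable N g" and v: "v \<in> ell2 J"
  shows "(\<lambda>z. F (fst z) (G (snd z) v) i) \<in> borel_measurable (M \<Otimes>\<^sub>M N)"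
    and "slice M f F (slice N g G v) i = (LINT z|(M \<Otimes>\<^sub>M N). tens f g z * F (fst z) (G (snd z) v) i)"
proof -
  interpret pair_sigma_finite M N using sf by (simp add: pair_sigma_finite_def)
  obtain C where C: "0 \<le> C" "AE x in M. \<forall>v\<in>ell2 J. l2norm (F x v) \<le> C * l2norm v"
    by (rule opfield_bound[OF F])
  obtain D where D: "0 \<le> D" "AE y in N. \<forall>v\<in>ell2 J. l2norm (G y v) \<le> D * l2norm v"
    by (rule opfield_bound[OF G])
  have Gy: "G y v \<in> ell2 J" if "y \<in> space N" for y by (rule bounded_opD(1)[OF opfieldD(1)[OF G that] v])
  \<comment> \<open>Columns are cut off outside \<open>J\<close>, where \<open>bvec j\<close> is no
    vector of \<open>ell2 J\<close> and measurability is unknown. The sums are unaffected, since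
    \<open>G y v\<close> vanishes in those coordinates.\<close>
  have col: "(\<lambda>x. if j \<in> J then F x (bvec j) i else 0) \<in> borel_measurable M" for j
    using opfield_coord_measurable[OF F bvec_ell2] by (cases "j \<in> J") auto
  have lim: "(\<lambda>n. \<Sum>j<n. G (snd z) v j * (if j \<in> J then F (fst z) (bvec j) i else 0)) \<longlonglongrightarrow> F (fst z) (G (snd z) v) i"
    if z: "z \<in> space (M \<Otimes>\<^sub>M N)" for z
  proof -
    have z': "fst z \<in> space M" "snd z \<in> space N" using z by (auto simp: space_pair_measure)
    have e: "G (snd z) v j * (if j \<in> J then F (fst z) (bvec j) i else 0) = G (snd z) v j * F (fst z) (bvec j) i" for j
      using ell2_outside[OF Gy[OF z'(2)], of j] by simp
    show ?thesis unfolding e using op_sums[OF opfieldD(1)[OF F z'(1)] Gy[OF z'(2)], of i] unfolding sums_def .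
  qed
  show meas: "(\<lambda>z. F (fst z) (G (snd z) v) i) \<in> borel_measurable (M \<Otimes>\<^sub>M N)"
  proof (rule borel_measurable_LIMSEQ_metric[OF _ lim])
    show "(\<lambda>z. \<Sum>j<n. G (snd z) v j * (if j \<in> J then F (fst z) (bvec j) i else 0)) \<in> borel_measurable (M \<Otimes>\<^sub>M N)" for n
      by (intro borel_measurable_sum borel_measurable_times
          measurable_compose[OF measurable_snd opfield_coord_measurable[OF G v]]
          measurable_compose[OF measurable_fst col])
  qed
  define H where "H z = tens f g z * F (fst z) (G (snd z) v) i" for z
  have [measurable]: "f \<in> borel_measurable M" "g \<in> borel_measurable N" using f g by auto
  have Hm: "H \<in> borel_measurable (M \<Otimes>\<^sub>M N)"
    unfolding H_def[abs_def] by (rule borel_measurable_times[OF _ meas]) (simp add: tens_def)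
  define E where "E = C * (D * l2norm v)"
  have E0: "0 \<le> E" using C(1) D(1) by (simp add: E_def)
  \<comment> \<open>An integrable product majorant: the operator bounds \<open>C\<close> and
    \<open>D\<close> leave only the absolute values of \<open>f\<close> and
    \<open>g\<close>.\<close>
  have bound: "AE y in N. cmod (H (x, y)) \<le> cmod (f x) * E * cmod (g y)"
    if x: "x \<in> space M" "\<forall>v\<in>ell2 J. l2norm (F x v) \<le> C * l2norm v" for x
    using D(2) AE_space
  proof eventually_elim
    case (elim y)
    have "cmod (F x (G y v) i) \<le> l2norm (F x (G y v))"
      by (rule cmod_le_l2norm[OF bounded_opD(1)[OF opfieldD(1)[OF F x(1)] Gy[OF elim(2)]]])
    also have "\<dots> \<le> C * l2norm (G y v)" using x(2) Gy[OF elim(2)] by blast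
    also have "\<dots> \<le> E" unfolding E_def by (rule mult_left_mono[OF _ C(1)]) (use elim(1) v in blast)
    finally have "cmod (f x * g y) * cmod (F x (G y v) i) \<le> cmod (f x * g y) * E" by (rule mult_left_mono) simp
    then show ?case by (simp add: H_def tens_def norm_mult mult_ac)
  qed
  have intg: "integrable N (\<lambda>y. cmod (f x) * E * cmod (g y))" for x using g by simp
  have Hx: "(\<lambda>y. H (x, y)) \<in> borel_measurable N" if "x \<in> space M" for x
    by (rule measurable_compose_Pair1[OF that Hm])
  have int2: "integrable N (\<lambda>y. H (x, y))"
    if x: "x \<in> space M" "\<forall>v\<in>ell2 J. l2norm (F x v) \<le> C * l2norm v" for x
    by (rule Bochner_Integration.integrable_bound[OF intg Hx[OF x(1)]])
       (use bound[OF x] E0 in \<open>auto elim!: eventually_mono simp: abs_mult\<close>)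
  have "integrable (M \<Otimes>\<^sub>M N) H"
  proof (rule Fubini_integrable[OF Hm])
    show "AE x in M. integrable N (\<lambda>y. H (x, y))" using C(2) AE_space by eventually_elim (rule int2)
    have "integrable M (\<lambda>x. cmod (f x) * (E * (LINT y|N. cmod (g y))))" using f by simp
    then show "integrable M (\<lambda>x. LINT y|N. norm (H (x, y)))"
    proof (rule Bochner_Integration.integrable_bound)
      have "(\<lambda>z. norm (H z)) \<in> borel_measurable (M \<Otimes>\<^sub>M N)" using Hm by measurable
      then show "(\<lambda>x. LINT y|N. norm (H (x, y))) \<in> borel_measurable M"
        using M2.borel_measurable_lebesgue_integral[of "\<lambda>x y. norm (H (x, y))" M] by simp
      show "AE x in M. norm (LINT y|N. norm (H (x, y))) \<le> norm (cmod (f x) * (E * (LINT y|N. cmod (g y))))"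
        using C(2) AE_space
      proof eventually_elim
        case (elim x)
        have "(LINT y|N. norm (H (x, y))) \<le> (LINT y|N. cmod (f x) * E * cmod (g y))"
          by (rule integral_mono_AE[OF integrable_norm[OF int2[OF elim(2,1)]] intg bound[OF elim(2,1)]])
        moreover have "0 \<le> (LINT y|N. norm (H (x, y)))" by (rule Bochner_Integration.integral_nonneg) simp
        ultimately show ?case by (simp add: mult.assoc)
      qed
    qed
  qed
  then have "(LINT z|(M \<Otimes>\<^sub>M N). H z) = (LINT x|M. LINT y|N. H (x, y))" by (rule integral_fst'[symmetric])
  also have "\<dots> = (LINT x|M. f x * F x (slice N g G v) i)"
  proof (intro Bochner_Integration.integral_cong refl)
    fix x assume x: "x \<in> space M"
    have "(LINT y|N. H (x, y)) = (LINT y|N. f x * (g y * F x (G y v) i))" by (simp add: H_def tens_def mult.assoc)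
    also have "\<dots> = f x * F x (slice N g G v) i"
      unfolding op_slice[OF opfieldD(1)[OF F x] G g v] by simp
    finally show "(LINT y|N. H (x, y)) = f x * F x (slice N g G v) i" .
  qed
  finally show "slice M f F (slice N g G v) i = (LINT z|(M \<Otimes>\<^sub>M N). tens f g z * F (fst z) (G (snd z) v) i)"
    by (simp add: H_def slice_def)
qed

text \<open>Both composites are integrals over the product space, in opposite orders of the factors.
  After swapping coordinates the integrands differ on a null set only, so commutation a.e. of the
  fields gives exact commutation of the slices.\<close>

lemma slices_commute:
  assumes sf: "sigma_finite_measure M" "sigma_finite_measure N"
    and F: "F \<in> opfield M J" and G: "G \<in> opfield N J"
    and f: "integrable M f" and g: "integrable N g" and v: "v \<in> ell2 J"
    and comm: "AE (x, y) in M \<Otimes>\<^sub>M N. \<forall>v\<in>ell2 J. F x (G y v) = G y (F x v)"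
  shows "slice M f F (slice N g G v) = slice N g G (slice M f F v)"
proof
  fix i
  interpret pair_sigma_finite M N using sf by (simp add: pair_sigma_finite_def)
  have [measurable]: "f \<in> borel_measurable M" "g \<in> borel_measurable N" using f g by auto
  have t: "tens f g \<in> borel_measurable (M \<Otimes>\<^sub>M N)" "tens g f \<in> borel_measurable (N \<Otimes>\<^sub>M M)" by (simp_all add: tens_def)
  note FG = slice_slice[OF sf F G f g v, of i]
  note GF = slice_slice[OF sf(2,1) G F g f v, of i]
  define L where "L z = tens g f (snd z, fst z) * G (snd z) (F (fst z) v) i" for z
  have sw: "(\<lambda>z. (snd z, fst z)) \<in> M \<Otimes>\<^sub>M N \<rightarrow>\<^sub>M N \<Otimes>\<^sub>M M" by measurable
  have L: "L \<in> borel_measurable (M \<Otimes>\<^sub>M N)"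
    using measurable_compose[OF sw borel_measurable_times[OF t(2) GF(1)]] by (simp add: L_def[abs_def])
  have "slice M f F (slice N g G v) i = (LINT z|(M \<Otimes>\<^sub>M N). L z)"
    unfolding FG(2)
  proof (rule integral_cong_AE[OF borel_measurable_times[OF t(1) FG(1)] L])
    show "AE z in M \<Otimes>\<^sub>M N. tens f g z * F (fst z) (G (snd z) v) i = L z"
      using comm by eventually_elim (use v in \<open>auto simp: L_def tens_def\<close>)
  qed
  also have "\<dots> = (LINT z|(N \<Otimes>\<^sub>M M). tens g f z * G (fst z) (F (snd z) v) i)"
    using integral_product_swap[OF L] by (simp add: L_def[abs_def] case_prod_unfold)
  finally show "slice M f F (slice N g G v) i = slice N g G (slice M f F v) i" unfolding GF(2) .
qed

section \<open>Averaging quantum Cantor correlations\<close>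

lemma ucp_vn_opfield: "ucp_vn K M J \<Phi> \<Longrightarrow> f \<in> Cfun K \<Longrightarrow> \<Phi> f \<in> opfield M J"
  unfolding ucp_vn_def vn_tensor_def by blast

lemma ucp_vnD:
  assumes "ucp_vn K M J \<Phi>"
  shows "f \<in> Cfun K \<Longrightarrow> g \<in> Cfun K \<Longrightarrow> AE x in M. \<forall>v\<in>ell2 J.
        \<Phi> (\<lambda>a. f a + g a) x v = (\<lambda>i. \<Phi> f x v i + \<Phi> g x v i)"
    and "f \<in> Cfun K \<Longrightarrow> AE x in M. \<forall>v\<in>ell2 J. \<Phi> (\<lambda>a. c * f a) x v = (\<lambda>i. c * \<Phi> f x v i)"
    and "AE x in M. \<forall>v\<in>ell2 J. \<Phi> (\<lambda>_. 1) x v = v"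
  using assms unfolding ucp_vn_def by blast+

lemma ucp_vn_positive:
  assumes "ucp_vn K M J \<Phi>" "f \<in> Cfun K" "\<And>a. a \<in> K \<Longrightarrow> f a \<in> \<real>\<^sub>\<ge>\<^sub>0" "v \<in> ell2 J"
  shows "AE x in M. ip (\<Phi> f x v) v \<in> \<real>\<^sub>\<ge>\<^sub>0"
proof -
  have pos: "\<forall>m F. (\<forall>i<m. \<forall>j<m. F i j \<in> Cfun K) \<and> (\<forall>a\<in>K. psd m (\<lambda>i j. F i j a)) \<longrightarrow>
        (AE x in M. psd_op J m (\<lambda>i j. \<Phi> (F i j) x))"
    using assms(1) unfolding ucp_vn_def by (elim conjE)
  have "AE x in M. psd_op J 1 (\<lambda>i j. \<Phi> ((\<lambda>i j. f) i j) x)"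
    by (rule pos[rule_format]) (use assms(2,3) in \<open>auto simp: psd_1_iff[simplified]\<close>)
  then show ?thesis by eventually_elim (rule psd_op_1D[OF _ assms(4)])
qed

lemma ucp_vn_sum:
  assumes \<Phi>: "ucp_vn K M J \<Phi>" and U: "finite U" and f: "\<And>u. u \<in> U \<Longrightarrow> f u \<in> Cfun K"
  shows "AE x in M. \<forall>v\<in>ell2 J. \<Phi> (\<lambda>a. \<Sum>u\<in>U. f u a) x v = (\<lambda>i. \<Sum>u\<in>U. \<Phi> (f u) x v i)"
  using U f
proof (induction U rule: finite_induct)
  case empty
  have "AE x in M. \<forall>v\<in>ell2 J. \<Phi> (\<lambda>a. 0 * 1) x v = (\<lambda>i. 0 * \<Phi> (\<lambda>_. 1) x v i)"
    by (rule ucp_vnD(2)[OF \<Phi> Cfun_const])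
  then show ?case by simp
next
  case (insert u U)
  have "AE x in M. \<forall>v\<in>ell2 J. \<Phi> (\<lambda>a. f u a + (\<Sum>u\<in>U. f u a)) x v =
      (\<lambda>i. \<Phi> (f u) x v i + \<Phi> (\<lambda>a. \<Sum>u\<in>U. f u a) x v i)"
    by (rule ucp_vnD(1)[OF \<Phi>]) (use insert in \<open>auto intro!: Cfun_sum\<close>)
  moreover have "AE x in M. \<forall>v\<in>ell2 J. \<Phi> (\<lambda>a. \<Sum>u\<in>U. f u a) x v = (\<lambda>i. \<Sum>u\<in>U. \<Phi> (f u) x v i)"
    by (rule insert.IH) (use insert in auto)
  ultimately show ?case
    by eventually_elim (use insert.hyps in simp)
qed

text \<open>Positivity survives integration against the nonnegative \<open>g\<close>; unitality of
  \<Phi> together with total mass 1 of \<open>g\<close> makes the slices add up to the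
  identity.\<close>

lemma povm_slice:
  assumes fam: "inductive_family d'" and \<Phi>: "ucp_vn (Omega d') M J \<Phi>"
    and g: "integrable M g" "\<And>x. g x \<in> \<real>\<^sub>\<ge>\<^sub>0" "(LINT x|M. g x) = 1"
  shows "povm J (level d' n) (\<lambda>a. slice M g (\<Phi> (chi d' n a)))"
  unfolding povm_def
proof (intro conjI ballI)
  note F = ucp_vn_opfield[OF \<Phi> chi_Cfun]
  show "bounded_op J (slice M g (\<Phi> (chi d' n a)))" for a by (rule slice_bounded_op[OF F g(1)])
  fix v assume v: "v \<in> ell2 J"
  show "ip (slice M g (\<Phi> (chi d' n a)) v) v \<in> \<real>\<^sub>\<ge>\<^sub>0" for a
  proof -
    have "AE x in M. ip (\<Phi> (chi d' n a) x v) v \<in> \<real>\<^sub>\<ge>\<^sub>0"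
      by (rule ucp_vn_positive[OF \<Phi> chi_Cfun chi_nonneg v])
    then have "AE x in M. g x * ip (\<Phi> (chi d' n a) x v) v \<in> \<real>\<^sub>\<ge>\<^sub>0"
      by eventually_elim (rule nonneg_Reals_mult_I[OF g(2)])
    then show ?thesis unfolding ip_slice[OF F g(1) v v] by (rule integral_nonneg_Reals)
  qed
  note int = slice_integrable[OF F v g(1)]
  have one: "(\<lambda>w. \<Sum>a\<in>level d' n. chi d' n a w) = (\<lambda>_. 1)" by (simp add: sum_chi[OF fam])
  have ae: "AE x in M. \<forall>v\<in>ell2 J. \<Phi> (\<lambda>_. 1) x v = (\<lambda>i. \<Sum>a\<in>level d' n. \<Phi> (chi d' n a) x v i)"
    unfolding one[symmetric] by (rule ucp_vn_sum[OF \<Phi> finite_level chi_Cfun])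
  show "(\<lambda>i. \<Sum>a\<in>level d' n. slice M g (\<Phi> (chi d' n a)) v i) = v"
  proof
    fix i
    have "(\<Sum>a\<in>level d' n. slice M g (\<Phi> (chi d' n a)) v i) =
        (LINT x|M. (\<Sum>a\<in>level d' n. g x * \<Phi> (chi d' n a) x v i))"
      unfolding slice_def by (rule Bochner_Integration.integral_sum[symmetric]) (rule int)
    also have "\<dots> = (LINT x|M. g x * v i)"
    proof (rule integral_cong_AE)
      show "(\<lambda>x. \<Sum>a\<in>level d' n. g x * \<Phi> (chi d' n a) x v i) \<in> borel_measurable M"
        using int by (intro borel_measurable_sum borel_measurable_integrable)
      show "(\<lambda>x. g x * v i) \<in> borel_measurable M" using g(1) by simp
      show "AE x in M. (\<Sum>a\<in>level d' n. g x * \<Phi> (chi d' n a) x v i) = g x * v i"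
        using ae ucp_vnD(3)[OF \<Phi>]
      proof eventually_elim
        case (elim x)
        have "v = (\<lambda>i. \<Sum>a\<in>level d' n. \<Phi> (chi d' n a) x v i)" using elim v by metis
        then have "v i = (\<Sum>a\<in>level d' n. \<Phi> (chi d' n a) x v i)" by (rule fun_cong)
        then show ?case by (simp add: sum_distrib_left)
      qed
    qed
    also have "\<dots> = v i" using g(3) by simp
    finally show "(\<Sum>a\<in>level d' n. slice M g (\<Phi> (chi d' n a)) v i) = v i" .
  qed
qed

text \<open>Density of the normalised restriction of \<open>mu d\<close> to a cylinder. As test
  functions in the quantum Cantor classes, such densities produce averages over cylinders.\<close>

definition cyl_density :: "(nat \<Rightarrow> nat) \<Rightarrow> nat \<Rightarrow> (nat \<Rightarrow> nat) \<Rightarrow> (nat \<Rightarrow> nat) \<Rightarrow> complex" where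
  "cyl_density d n s \<omega> = of_nat (card (level d n)) * chi d n s \<omega>"

lemma cyl_density:
  assumes "inductive_family d"
  shows "integrable (mu d) (cyl_density d n s)" "cyl_density d n s \<omega> \<in> \<real>\<^sub>\<ge>\<^sub>0"
    and "s \<in> level d n \<Longrightarrow> (LINT \<omega>|mu d. cyl_density d n s \<omega>) = 1"
proof -
  show "integrable (mu d) (cyl_density d n s)"
    unfolding cyl_density_def[abs_def] by (intro integrable_Cfun[OF assms] Cfun_scale chi_Cfun)
  show "cyl_density d n s \<omega> \<in> \<real>\<^sub>\<ge>\<^sub>0"
    unfolding cyl_density_def by (intro nonneg_Reals_mult_I chi_nonneg) simp
  show "(LINT \<omega>|mu d. cyl_density d n s \<omega>) = 1" if "s \<in> level d n"
    unfolding cyl_density_def using integral_chi[OF assms that] level_nonempty[OF assms, of n] by simp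
qed

text \<open>The form in which \<open>cfin\<close> matches the left-hand side of the identities
  defining \<open>cantor_qs\<close> and \<open>cantor_qc\<close>.\<close>

lemma cfin_density:
  "cfin dX dY dA dB n \<Gamma> s t a b =
    (LINT z|(mu dX \<Otimes>\<^sub>M mu dY). tens (cyl_density dX n s) (cyl_density dY n t) z * \<Gamma> (tens (chi dA n a) (chi dB n b)) z)"
proof -
  have "(LINT z|(mu dX \<Otimes>\<^sub>M mu dY). tens (cyl_density dX n s) (cyl_density dY n t) z * \<Gamma> (tens (chi dA n a) (chi dB n b)) z) =
    (LINT z|(mu dX \<Otimes>\<^sub>M mu dY). (of_nat (card (level dX n)) * of_nat (card (level dY n))) *
      (chi2 dX dY n (s, t) z * \<Gamma> (chi2 dA dB n (a, b)) z))"
    by (intro Bochner_Integration.integral_cong refl)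
       (simp add: tens_def case_prod_unfold cyl_density_def chi2_def mult_ac)
  then show ?thesis by (simp add: cfin_def)
qed

text \<open>The defining identity, evaluated at cylinder functions and cylinder densities, is a
  finite quantum model with the slices as POVMs and the same vector \<xi>.\<close>

lemma cfin_qs:
  assumes fam: "inductive_family dX" "inductive_family dY" "inductive_family dA" "inductive_family dB"
    and C: "cantor_corr dX dY dA dB \<Gamma>" and qs: "cantor_qs dX dY dA dB \<Gamma>"
    and inf: "infinite (UNIV :: 'i set)"
  shows "fin_qs TYPE('i) (level dX n) (level dY n) (level dA n) (level dB n) (\<lambda>s t a b. Re (cfin dX dY dA dB n \<Gamma> s t a b))"
proof -
  obtain J K :: "nat set" and \<xi> \<Phi> \<Psi> where
    m: "\<xi> \<in> ell2 (J \<times> K)" "l2norm \<xi> = 1"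
    "ucp_vn (Omega dA) (mu dX) J \<Phi>" "ucp_vn (Omega dB) (mu dY) K \<Psi>" and
    eq: "\<forall>f1\<in>Cfun (Omega dA). \<forall>f2\<in>Cfun (Omega dB). \<forall>g1 g2.
           integrable (mu dX) g1 \<and> integrable (mu dY) g2 \<longrightarrow>
           (LINT z|(mu dX \<Otimes>\<^sub>M mu dY). tens g1 g2 z * \<Gamma> (tens f1 f2) z) =
           ip (tensor_map (slice (mu dX) g1 (\<Phi> f1)) (slice (mu dY) g2 (\<Psi> f2)) \<xi>) \<xi>"
    using qs unfolding cantor_qs_def by blast
  define P where "P s a = slice (mu dX) (cyl_density dX n s) (\<Phi> (chi dA n a))" for s a
  define Q where "Q t b = slice (mu dY) (cyl_density dY n t) (\<Psi> (chi dB n b))" for t b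
  have model: "qs_model J K \<xi> P Q (level dX n) (level dY n) (level dA n) (level dB n)
    (\<lambda>s t a b. Re (cfin dX dY dA dB n \<Gamma> s t a b))"
    unfolding qs_model_def
  proof (intro conjI ballI m(1,2))
    show "povm J (level dA n) (P s)" if "s \<in> level dX n" for s
      unfolding P_def[abs_def] by (rule povm_slice[OF fam(3) m(3) cyl_density[OF fam(1)]]) (rule that)
    show "povm K (level dB n) (Q t)" if "t \<in> level dY n" for t
      unfolding Q_def[abs_def] by (rule povm_slice[OF fam(4) m(4) cyl_density[OF fam(2)]]) (rule that)
    show "complex_of_real (Re (cfin dX dY dA dB n \<Gamma> s t a b)) = ip (tensor_map (P s a) (Q t b) \<xi>) \<xi>" for s t a b
      unfolding cfin_of_real[OF C] unfolding cfin_density P_def Q_def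
      by (rule eq[rule_format, OF chi_Cfun chi_Cfun]) (intro conjI cyl_density(1) fam)
  qed
  \<comment> \<open>The model lives on sets of naturals; an injection into the infinite type
    \<open>'i\<close> moves it to the index type of the finite class.\<close>
  obtain h :: "nat \<Rightarrow> 'i" where h: "inj h" using infinite_countable_subset[OF inf] by blast
  show ?thesis
    unfolding fin_qs_iff
    using transport_qs_model[OF inj_on_subset[OF h] inj_on_subset[OF h] model] by blast
qed

lemma cfin_qc:
  assumes fam: "inductive_family dX" "inductive_family dY" "inductive_family dA" "inductive_family dB"
    and C: "cantor_corr dX dY dA dB \<Gamma>" and qc: "cantor_qc dX dY dA dB \<Gamma>"
    and inf: "infinite (UNIV :: 'i set)"
  shows "fin_qc TYPE('i) (level dX n) (level dY n) (level dA n) (level dB n) (\<lambda>s t a b. Re (cfin dX dY dA dB n \<Gamma> s t a b))"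
proof -
  obtain J :: "nat set" and \<xi> \<Phi> \<Psi> where
    m: "\<xi> \<in> ell2 J" "l2norm \<xi> = 1"
    "ucp_vn (Omega dA) (mu dX) J \<Phi>" "ucp_vn (Omega dB) (mu dY) J \<Psi>" and
    comm: "\<forall>f\<in>Cfun (Omega dA). \<forall>g\<in>Cfun (Omega dB). AE (x, y) in mu dX \<Otimes>\<^sub>M mu dY. \<forall>v\<in>ell2 J.
           \<Phi> f x (\<Psi> g y v) = \<Psi> g y (\<Phi> f x v)" and
    eq: "\<forall>f1\<in>Cfun (Omega dA). \<forall>f2\<in>Cfun (Omega dB). \<forall>g1 g2.
           integrable (mu dX) g1 \<and> integrable (mu dY) g2 \<longrightarrow>
           (LINT z|(mu dX \<Otimes>\<^sub>M mu dY). tens g1 g2 z * \<Gamma> (tens f1 f2) z) =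
           ip (slice (mu dX) g1 (\<Phi> f1) (slice (mu dY) g2 (\<Psi> f2) \<xi>)) \<xi>"
    using qc unfolding cantor_qc_def by blast
  define P where "P s a = slice (mu dX) (cyl_density dX n s) (\<Phi> (chi dA n a))" for s a
  define Q where "Q t b = slice (mu dY) (cyl_density dY n t) (\<Psi> (chi dB n b))" for t b
  note sf = prob_space_imp_sigma_finite[OF prob_space_mu[OF fam(1)]] prob_space_imp_sigma_finite[OF prob_space_mu[OF fam(2)]]
  have model: "qc_model J \<xi> P Q (level dX n) (level dY n) (level dA n) (level dB n)
    (\<lambda>s t a b. Re (cfin dX dY dA dB n \<Gamma> s t a b))"
    unfolding qc_model_def
  proof (intro conjI ballI m(1,2))
    show "povm J (level dA n) (P s)" if "s \<in> level dX n" for s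
      unfolding P_def[abs_def] by (rule povm_slice[OF fam(3) m(3) cyl_density[OF fam(1)]]) (rule that)
    show "povm J (level dB n) (Q t)" if "t \<in> level dY n" for t
      unfolding Q_def[abs_def] by (rule povm_slice[OF fam(4) m(4) cyl_density[OF fam(2)]]) (rule that)
    show "complex_of_real (Re (cfin dX dY dA dB n \<Gamma> s t a b)) = ip (P s a (Q t b \<xi>)) \<xi>" for s t a b
      unfolding cfin_of_real[OF C] unfolding cfin_density P_def Q_def
      by (rule eq[rule_format, OF chi_Cfun chi_Cfun]) (intro conjI cyl_density(1) fam)
    show "P s a (Q t b w) = Q t b (P s a w)" if "w \<in> ell2 J" for s t a b w
      unfolding P_def Q_def
      by (rule slices_commute[OF sf ucp_vn_opfield[OF m(3) chi_Cfun] ucp_vn_opfield[OF m(4) chi_Cfun]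
            cyl_density(1)[OF fam(1)] cyl_density(1)[OF fam(2)] that])
         (rule comm[rule_format, OF chi_Cfun chi_Cfun])
  qed
  obtain h :: "nat \<Rightarrow> 'i" where h: "inj h" using infinite_countable_subset[OF inf] by blast
  show ?thesis
    unfolding fin_qc_iff using transport_qc_model[OF inj_on_subset[OF h] model] by blast
qed

lemma cfin_fin_class:
  assumes fam: "inductive_family dX" "inductive_family dY" "inductive_family dA" "inductive_family dB"
    and \<Gamma>: "\<Gamma> \<in> cantor_class t dX dY dA dB" and inf: "infinite (UNIV :: 'i set)"
  shows "(\<lambda>s t a b. Re (cfin dX dY dA dB n \<Gamma> s t a b)) \<in>
    fin_class TYPE('i) t (level dX n) (level dY n) (level dA n) (level dB n)"
proof -
  have C: "cantor_corr dX dY dA dB \<Gamma>" using \<Gamma> by (simp add: cantor_class_def)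
  show ?thesis
    using \<Gamma> cfin_fin_corr[OF fam C] cfin_loc[OF fam C] cfin_qs[OF fam C _ inf] cfin_qc[OF fam C _ inf]
      cfin_ns[OF fam C]
    by (cases t) (simp_all add: fin_class_def cantor_class_def)
qed

theorem lemma6p4:
  fixes dX dY dA dB :: "nat \<Rightarrow> nat" and n :: nat
    and lam :: "(nat \<Rightarrow> nat) \<times> (nat \<Rightarrow> nat) \<times> (nat \<Rightarrow> nat) \<times> (nat \<Rightarrow> nat) \<Rightarrow> nat"
    and t :: corr_type
  assumes "inductive_family dX" and "inductive_family dY"
    and "inductive_family dA" and "inductive_family dB"
    and "n \<ge> 1"
    and "rule_fun dX dY dA dB n lam"
    and "infinite (UNIV :: 'i set)"
  shows "(\<forall>p \<in> fin_class TYPE('i) t (level dX n) (level dY n) (level dA n) (level dB n).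
            fin_value (level dX n) (level dY n) p (supp dX dY dA dB n lam) =
            cantor_value dX dY dA dB (lift_corr dX dY dA dB n p) (kappa dX dY dA dB n lam)) \<and>
         omega_fin TYPE('i) t dX dY dA dB n lam =
         omega_cantor t dX dY dA dB (kappa dX dY dA dB n lam)"
proof -
  note fam = assms(1-4)
  let ?fin = "fin_class TYPE('i) t (level dX n) (level dY n) (level dA n) (level dB n)"
  let ?can = "cantor_class t dX dY dA dB"
  let ?fv = "\<lambda>p. fin_value (level dX n) (level dY n) p (supp dX dY dA dB n lam)"
  let ?cv = "\<lambda>\<Gamma>. cantor_value dX dY dA dB \<Gamma> (kappa dX dY dA dB n lam)"
  have lift: "lift_corr dX dY dA dB n p \<in> ?can" if "p \<in> ?fin" for p
    by (rule lift_cantor_class[OF fam that])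
  have corr: "cantor_corr dX dY dA dB \<Gamma>" if "\<Gamma> \<in> ?can" for \<Gamma>
    using that by (simp add: cantor_class_def)
  have up: "?fv p = ?cv (lift_corr dX dY dA dB n p)" if "p \<in> ?fin" for p
    by (rule cantor_value_eq_fin_value[OF fam corr[OF lift[OF that]] cfin_lift[OF fam], symmetric])
  define down where "down \<Gamma> = (\<lambda>s t a b. Re (cfin dX dY dA dB n \<Gamma> s t a b))" for \<Gamma>
  have down: "down \<Gamma> \<in> ?fin" "?cv \<Gamma> = ?fv (down \<Gamma>)" if "\<Gamma> \<in> ?can" for \<Gamma>
  proof -
    show "down \<Gamma> \<in> ?fin" unfolding down_def by (rule cfin_fin_class[OF fam that assms(7)])
    show "?cv \<Gamma> = ?fv (down \<Gamma>)"
      unfolding down_def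
      by (rule cantor_value_eq_fin_value[OF fam corr[OF that]]) (simp add: cfin_of_real[OF corr[OF that]])
  qed
  \<comment> \<open>Equality of the two sets of values gives equality of the suprema directly,
    without any discussion of bounds.\<close>
  have "?fv ` ?fin = ?cv ` ?can"
  proof (intro equalityI subsetI)
    fix r assume "r \<in> ?fv ` ?fin"
    then show "r \<in> ?cv ` ?can" using lift up by blast
  next
    fix r assume "r \<in> ?cv ` ?can"
    then show "r \<in> ?fv ` ?fin" using down by blast
  qed
  then show ?thesis
    unfolding omega_fin_def omega_cantor_def using up by simp
qed

end
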